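(* Consider the renewal risk model $$R_{m,n}(t)=u+ct-\sum_{i=1}^{N_{m,n}(t)}X_i,\qquad t>0,$$ where the inter-arrival times $T_k$ are each distributed as $\sum_{i=1}^m Y_i+\sum_{j=1}^n Z_j$, with $Y_i\sim\Gamma(r_i,\lambda_{1,i})$ and $Z_j\sim\mathrm{ML}(\mu_j,\lambda_{2,j})$ all independent ($r_i,\lambda_{1,i},\lambda_{2,j}\in\mathbb R^+$, $\mu_j\in(0,1]$). Then the ruin probability $\psi(u)$ under the model $R_{m,n}$ satisfies the fractional integro-differential equation $$\mathcal{A}_{m,n}^{*}\left(c\frac{\mathrm d}{\mathrm du}\right)[\psi](u)=\Lambda_{m,n}\left(\int_0^u\psi(u-y)\,\mathrm dF_X(y)+\int_u^\infty\mathrm dF_X(y)\right)$$ with the universal boundary condition $\lim_{u\to\infty}\psi(u)=0$, where $$\Lambda_{m,n}=\prod_{i=1}^m\lambda_{1,i}^{r_i}\prod_{j=1}^n\lambda_{2,j},\qquad \mathcal{A}_{m,n}^{*}\left(c\frac{\mathrm d}{\mathrm du}\right)=\bigodot_{j=1}^{n}\left(c^{\mu_j}\,{}^{\mathrm C}_{u}\mathrm{D}_\infty^{\mu_j}+\lambda_{2,j}\right)\bigodot_{i=1}^m\left(c^{r_i}\,{}^{\lambda_{1,i}/c}_{\phantom{xx}u}\mathrm{R}_\infty^{r_i}\right).$$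
   Context: Risk model: $u$ is the initial capital, $c>0$ the premium rate, the claim sizes $X_1,X_2,\dots$ are i.i.d. positive random variables with distribution function $F_X$, the inter-arrival (waiting) times $T_1,T_2,\dots$ are i.i.d. and independent of the claim sizes, and $N_{m,n}(t)$ is the renewal process counting the claims up to time $t$ (the $i$-th claim occurs at time $T_1+\cdots+T_i$). The net profit condition $c\,\mathbb E[T_i]>\mathbb E[X_i]$ is assumed. The ruin probability is $\psi(u)=\mathbb P[\inf\{R_{m,n}(t):t>0\}<0\mid R_{m,n}(0)=u]$. The integers $m,n\ge0$ are not both zero. $\Gamma(r,\lambda)$ denotes the gamma distribution with density $\frac{\lambda^r}{\Gamma(r)}x^{r-1}e^{-\lambda x}$, $x>0$. $\mathrm{ML}(\mu,\lambda)$ denotes the Mittag-Leffler distribution with density $\lambda x^{\mu-1}E_{\mu,\mu}(-\lambda x^\mu)$, $x>0$, where $E_{\alpha,\beta}(z)=\sum_{k=0}^\infty \frac{z^k}{\Gamma(\alpha k+\beta)}$. The right Caputo fractional derivative of order $r>0$ with upper limit $\infty$ is ${}^{\mathrm C}_{x}\mathrm{D}_\infty^r f(x)=\frac{(-1)^N}{\Gamma(N-r)}\int_x^\infty (y-x)^{N-r-1}f^{(N)}(y)\,\mathrm dy$ with $N=\lfloor r\rfloor+1$. The right fractional differential operator is ${}^{\alpha}_{x}\mathrm{R}_\infty^r[g](x)=e^{\alpha x}\,{}^{\mathrm C}_{x}\mathrm{D}_\infty^r\left[e^{-\alpha x}g(x)\right]$. $\bigodot$ denotes left-composition of operators: $\bigodot_{j=1}^m\mathcal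 L_j[f]=(\mathcal L_m\circ\cdots\circ\mathcal L_1)[f]$ (an empty composition is the identity, an empty product is $1$); in a juxtaposition of operators, the rightmost acts first.
   Formalization: If the last-applied fractional operator has integer order (μ_n if n>0, else r_m), F_X is assumed absolutely continuous; with N=⌊r⌋+1 the equation otherwise fails, e.g. for Poisson arrivals with deterministic claims. *)

theory Defs
  imports "HOL-Probability.Probability"
begin

definition gamma_density :: "real \<Rightarrow> real \<Rightarrow> real \<Rightarrow> real" where
  "gamma_density r l x =
     (if x > 0 then l powr r / Gamma r * x powr (r - 1) * exp (- l * x) else 0)"

definition mittag_leffler :: "real \<Rightarrow> real \<Rightarrow> real \<Rightarrow> real" where
  "mittag_leffler a b z = (\<Sum>k. z ^ k / Gamma (a * real k + b))"

definition mittag_leffler_density :: "real \<Rightarrow> real \<Rightarrow> real \<Rightarrow> real" where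
  "mittag_leffler_density \<mu> l x =
     (if x > 0 then l * x powr (\<mu> - 1) * mittag_leffler \<mu> \<mu> (- l * x powr \<mu>) else 0)"

text \<open>
  Claims and waiting times are indexed from 1; the entries at index 0 of the sequences
  \<open>X\<close> and \<open>T\<close> are never used. If infinitely many arrivals occurred before time \<open>t\<close>, the
  cardinality below would be 0; for waiting times that are i.i.d. and almost surely positive
  this is an event of probability 0.
\<close>

definition claim_count :: "(nat \<Rightarrow> 'a \<Rightarrow> real) \<Rightarrow> real \<Rightarrow> 'a \<Rightarrow> nat" where
  "claim_count T t \<omega> = card {k. 1 \<le> k \<and> (\<Sum>i=1..k. T i \<omega>) \<le> t}"

definition surplus ::
  "real \<Rightarrow> (nat \<Rightarrow> 'a \<Rightarrow> real) \<Rightarrow> (nat \<Rightarrow> 'a \<Rightarrow> real) \<Rightarrow> real \<Rightarrow> real \<Rightarrow> 'a \<Rightarrow> real" where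
  "surplus c X T u t \<omega> = u + c * t - (\<Sum>i=1..claim_count T t \<omega>. X i \<omega>)"

text \<open>
  The infimum is taken in the extended reals, so that paths unbounded from below count as ruined.
  Conditioning on the initial capital is expressed by the parameter \<open>u\<close> of the surplus.
\<close>

definition ruin_probability ::
  "'a measure \<Rightarrow> real \<Rightarrow> (nat \<Rightarrow> 'a \<Rightarrow> real) \<Rightarrow> (nat \<Rightarrow> 'a \<Rightarrow> real) \<Rightarrow> real \<Rightarrow> real" where
  "ruin_probability M c X T u =
     measure M {\<omega> \<in> space M. (INF t\<in>{0<..}. ereal (surplus c X T u t \<omega>)) < 0}"

definition caputo_order :: "real \<Rightarrow> nat" where
  "caputo_order r = nat \<lfloor>r\<rfloor> + 1"

definition right_caputo :: "real \<Rightarrow> (real \<Rightarrow> real) \<Rightarrow> real \<Rightarrow> real" where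
  "right_caputo r f x =
     (- 1) ^ caputo_order r / Gamma (real (caputo_order r) - r) *
     (LINT y:{x<..}|lebesgue.
        (y - x) powr (real (caputo_order r) - r - 1) * (deriv ^^ caputo_order r) f y)"

text \<open>
  Since \<open>deriv\<close> and the integral are total functions, the existence of the quantities in
  \<open>right_caputo\<close> is a separate condition. As usual for Caputo derivatives, the derivative of
  highest order, which only occurs under the integral, is required almost everywhere.
\<close>

definition right_caputo_exists :: "real \<Rightarrow> (real \<Rightarrow> real) \<Rightarrow> real \<Rightarrow> bool" where
  "right_caputo_exists r f x \<longleftrightarrow>
     (\<forall>k < caputo_order r - 1. \<forall>y > x. (deriv ^^ k) f field_differentiable (at y)) \<and>
     (AE y in lebesgue. y > x \<longrightarrow> (deriv ^^ (caputo_order r - 1)) f field_differentiable (at y)) \<and>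
     set_integrable lebesgue {x<..}
       (\<lambda>y. (y - x) powr (real (caputo_order r) - r - 1) * (deriv ^^ caputo_order r) f y)"

definition right_frac_op :: "real \<Rightarrow> real \<Rightarrow> (real \<Rightarrow> real) \<Rightarrow> real \<Rightarrow> real" where
  "right_frac_op \<alpha> r g x = exp (\<alpha> * x) * right_caputo r (\<lambda>y. exp (- \<alpha> * y) * g y) x"

definition gamma_op :: "real \<Rightarrow> real \<Rightarrow> real \<Rightarrow> (real \<Rightarrow> real) \<Rightarrow> real \<Rightarrow> real" where
  "gamma_op c r l f = (\<lambda>u. c powr r * right_frac_op (l / c) r f u)"

definition ml_op :: "real \<Rightarrow> real \<Rightarrow> real \<Rightarrow> (real \<Rightarrow> real) \<Rightarrow> real \<Rightarrow> real" where
  "ml_op c \<mu> l f = (\<lambda>u. c powr \<mu> * right_caputo \<mu> f u + l * f u)"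

text \<open>
  \<open>left_comp L k\<close> is \<open>L k \<circ> \<dots> \<circ> L 1\<close>; \<open>fold\<close> applies the first list element first.
\<close>

definition left_comp :: "(nat \<Rightarrow> 'f \<Rightarrow> 'f) \<Rightarrow> nat \<Rightarrow> 'f \<Rightarrow> 'f" where
  "left_comp L k = fold L [1..<Suc k]"

definition A_star ::
  "real \<Rightarrow> nat \<Rightarrow> nat \<Rightarrow> (nat \<Rightarrow> real) \<Rightarrow> (nat \<Rightarrow> real) \<Rightarrow> (nat \<Rightarrow> real) \<Rightarrow> (nat \<Rightarrow> real) \<Rightarrow>
   (real \<Rightarrow> real) \<Rightarrow> real \<Rightarrow> real" where
  "A_star c m n r l1 \<mu> l2 f =
     left_comp (\<lambda>j. ml_op c (\<mu> j) (l2 j)) n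
       (left_comp (\<lambda>i. gamma_op c (r i) (l1 i)) m f)"

text \<open>Every Caputo derivative evaluated in \<open>A_star c m n r l1 \<mu> l2 f u\<close> exists at \<open>u\<close>.\<close>

definition A_star_exists ::
  "real \<Rightarrow> nat \<Rightarrow> nat \<Rightarrow> (nat \<Rightarrow> real) \<Rightarrow> (nat \<Rightarrow> real) \<Rightarrow> (nat \<Rightarrow> real) \<Rightarrow> (nat \<Rightarrow> real) \<Rightarrow>
   (real \<Rightarrow> real) \<Rightarrow> real \<Rightarrow> bool" where
  "A_star_exists c m n r l1 \<mu> l2 f u \<longleftrightarrow>
     (\<forall>i<m. right_caputo_exists (r (Suc i))
        (\<lambda>y. exp (- (l1 (Suc i) / c) * y) *
             left_comp (\<lambda>i. gamma_op c (r i) (l1 i)) i f y) u) \<and>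
     (\<forall>j<n. right_caputo_exists (\<mu> (Suc j))
        (left_comp (\<lambda>j. ml_op c (\<mu> j) (l2 j)) j
          (left_comp (\<lambda>i. gamma_op c (r i) (l1 i)) m f)) u)"

end

theory Submission
  imports Defs "HOL-Complex_Analysis.Conformal_Mappings"
begin

text \<open>
  For \<open>u \<ge> 0\<close> ruin means that the random walk with steps \<open>X - c T\<close> exceeds \<open>u\<close>. By the net profit condition
  its supremum \<open>W\<close> is almost surely finite, so \<open>\<psi>\<close> is the tail of \<open>W\<close> and tends to 0; by stationarity \<open>\<psi>\<close> is on
  \<open>[0, \<infinity>)\<close> also the tail of \<open>X + W - c T\<close>, where \<open>X\<close>, \<open>W\<close>, \<open>T\<close> are independent, and the integral term
  of the equation is the tail of \<open>X + W\<close>. Each factor of the operator strips one summand from \<open>T\<close>: if \<open>\<eta>\<close> is any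
  law, then applied to the tail of \<open>\<eta>\<close> shifted by \<open>- c Y\<^sub>i\<close> (or \<open>- c Z\<^sub>j\<close>) it returns a multiple of the tail of
  \<open>\<eta>\<close>. All functions involved are of the form \<open>x \<mapsto> \<integral> k (t - x) d\<nu>(t)\<close> with a causal kernel \<open>k\<close>, and
  the Caputo integral acts on them by convolving the kernel with a Riemann-Liouville kernel.
\<close>

section \<open>Riemann-Liouville kernels\<close>

text \<open>Each function to which a factor is applied is identified as a tail only on
  \<open>[0, \<infinity>)\<close>. That is enough, because a right Caputo derivative at
  \<open>x\<close> looks only to the right of \<open>x\<close>. As convolution is commutative and
  associative, the phases not yet stripped can be absorbed into \<eta>, which is why the step for
  one factor treats an arbitrary law and an arbitrary constant. Two obstacles shape the details.
  Since \<eta> may have atoms, the derivative of highest order is available only almost everywhere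
  and comes from Lebesgue differentiation of a tail integral. And the convention
  \<open>N = floor r + 1\<close> makes an operator of integer order \<open>r\<close> differentiate
  \<open>r + 1\<close> times and integrate once, so that the tail of \<eta> itself is differentiated
  and \<eta> needs a density. At an inner factor \<eta> still contains a phase with a density; at
  the outermost factor the density must come from the claim law. Kernels are nonnegative wherever
  integrals are exchanged in \<open>ennreal\<close>; for the Mittag-Leffler kernel this is a theorem
  of its own.\<close>

definition rl_kernel :: "real \<Rightarrow> real \<Rightarrow> real" where
  "rl_kernel a x = (if x > 0 then x powr (a - 1) / Gamma a else 0)"

text \<open>The argument \<open>t - x\<close> lets a kernel that vanishes on the negative axis see
  only the part of \<nu> to the right of \<open>x\<close>; with \<open>rl_kernel a\<close> this is
  the right-sided (Weyl) fractional integral of order \<open>a\<close> of \<nu>. Values are in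
  \<open>ennreal\<close>, since orders below 1 may give \<infinity>; the kernel has to be
  nonnegative for the value to be the integral.\<close>

definition causal_conv :: "(real \<Rightarrow> real) \<Rightarrow> real measure \<Rightarrow> real \<Rightarrow> ennreal" where
  "causal_conv k \<nu> x = (\<integral>\<^sup>+ t. ennreal (k (t - x)) \<partial>\<nu>)"

lemma rl_kernel_measurable [measurable]: "rl_kernel a \<in> borel_measurable borel"
  unfolding rl_kernel_def by measurable

lemma rl_kernel_nonneg: "a > 0 \<Longrightarrow> 0 \<le> rl_kernel a x"
  by (auto simp: rl_kernel_def)

text \<open>Substituting \<open>z * w\<close> for \<open>v\<close> leaves Euler's Beta integral, and
  \<open>Beta b a\<close> cancels the Gamma normalisations. This semigroup law is the whole algebra
  behind the inversion of the gamma phases.\<close>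

lemma rl_kernel_convolution:
  assumes a: "a > 0" and b: "b > 0"
  shows "(\<integral>\<^sup>+ v. ennreal (rl_kernel a (z - v)) * ennreal (rl_kernel b v) \<partial>lborel)
           = ennreal (rl_kernel (a + b) z)"
proof (cases "z > 0")
  case False
  have "ennreal (rl_kernel a (z - v)) * ennreal (rl_kernel b v) = 0" for v
    using False by (auto simp: rl_kernel_def)
  then have "(\<lambda>v. ennreal (rl_kernel a (z - v)) * ennreal (rl_kernel b v)) = (\<lambda>_. 0)" by blast
  then show ?thesis using False by (simp add: rl_kernel_def)
next
  case z: True
  let ?C = "z powr (a + b - 2) / (Gamma a * Gamma b)"
  have C: "?C \<ge> 0" using a b by auto
  have "(\<integral>\<^sup>+ v. ennreal (rl_kernel a (z - v)) * ennreal (rl_kernel b v) \<partial>lborel)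
      = ennreal \<bar>z\<bar> * (\<integral>\<^sup>+ w. ennreal (rl_kernel a (z - (0 + z * w))) * ennreal (rl_kernel b (0 + z * w)) \<partial>lborel)"
    by (rule nn_integral_real_affine) (use z in auto)
  also have "(\<integral>\<^sup>+ w. ennreal (rl_kernel a (z - (0 + z * w))) * ennreal (rl_kernel b (0 + z * w)) \<partial>lborel)
      = (\<integral>\<^sup>+ w. ennreal ?C * ennreal (indicator {0<..<1} w * (w powr (b - 1) * (1 - w) powr (a - 1))) \<partial>lborel)"
  proof (rule nn_integral_cong)
    fix w :: real
    have "z - z * w > 0 \<longleftrightarrow> w < 1" 
      using z by (metis diff_gt_0_iff_gt mult_less_cancel_left_pos mult.right_neutral)
    moreover have "z * w > 0 \<longleftrightarrow> w > 0" using z by (simp add: zero_less_mult_iff)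
    moreover have "(z - z * w) powr (a - 1) = z powr (a - 1) * (1 - w) powr (a - 1)" if "w < 1"
      using that z by (simp add: powr_mult[symmetric] algebra_simps)
    moreover have "(z * w) powr (b - 1) = z powr (b - 1) * w powr (b - 1)" if "w > 0"
      using that z by (simp add: powr_mult)
    moreover have "z powr (a - 1) * z powr (b - 1) = z powr (a + b - 2)"
      by (simp add: powr_add[symmetric])
    ultimately have "rl_kernel a (z - z * w) * rl_kernel b (z * w)
        = ?C * (indicator {0<..<1} w * (w powr (b - 1) * (1 - w) powr (a - 1)))"
      by (auto simp: rl_kernel_def indicator_def field_simps)
    note * = this
    have "ennreal (rl_kernel a (z - (0 + z * w))) * ennreal (rl_kernel b (0 + z * w))
        = ennreal (rl_kernel a (z - z * w) * rl_kernel b (z * w))"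
      using rl_kernel_nonneg[OF a] rl_kernel_nonneg[OF b] by (subst ennreal_mult[symmetric]) auto
    also have "\<dots> = ennreal ?C * ennreal (indicator {0<..<1} w * (w powr (b - 1) * (1 - w) powr (a - 1)))"
      unfolding * by (rule ennreal_mult) (use C in auto)
    finally show "ennreal (rl_kernel a (z - (0 + z * w))) * ennreal (rl_kernel b (0 + z * w))
        = ennreal ?C * ennreal (indicator {0<..<1} w * (w powr (b - 1) * (1 - w) powr (a - 1)))" .
  qed
  also have "\<dots> = ennreal ?C * (\<integral>\<^sup>+ w. ennreal (indicator {0<..<1} w * (w powr (b - 1) * (1 - w) powr (a - 1))) \<partial>lborel)"
    by (rule nn_integral_cmult) auto
  also have "(\<integral>\<^sup>+ w. ennreal (indicator {0<..<1} w * (w powr (b - 1) * (1 - w) powr (a - 1))) \<partial>lborel) = ennreal (Beta b a)"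
    using has_integral_Beta_real[OF b a]
    by (intro nn_integral_has_integral_lebesgue) (auto simp: has_integral_Icc_iff_Ioo)
  finally have "(\<integral>\<^sup>+ v. ennreal (rl_kernel a (z - v)) * ennreal (rl_kernel b v) \<partial>lborel)
     = ennreal z * (ennreal ?C * ennreal (Beta b a))" using z by simp
  also have "\<dots> = ennreal (z * (?C * Beta b a))"
    using z C a b by (simp only: ennreal_mult[symmetric] Beta_def less_imp_le Gamma_real_pos mult_nonneg_nonneg divide_nonneg_nonneg add_pos_pos)
  also have "z * (?C * Beta b a) = rl_kernel (a + b) z"
  proof -
    have "z * z powr (a + b - 2) = z powr (a + b - 1)"
      using z by (simp add: powr_mult_base)
    moreover have "Gamma a > 0" "Gamma b > 0" "Gamma (a+b) > 0" using a b by auto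
    ultimately show ?thesis using z by (simp add: rl_kernel_def Beta_def add.commute field_simps)
  qed
  finally show ?thesis .
qed

lemma causal_conv_measurable:
  assumes [measurable]: "k \<in> borel_measurable borel" and "sigma_finite_measure \<nu>"
    and [measurable_cong]: "sets \<nu> = sets borel"
  shows "causal_conv k \<nu> \<in> borel_measurable borel"
proof -
  interpret sigma_finite_measure \<nu> by fact
  show ?thesis unfolding causal_conv_def by measurable
qed

text \<open>Applying two kernels in turn amounts to applying their convolution: Tonelli, then the
  reflection \<open>y = t - v\<close> in the inner integral.\<close>

lemma causal_conv_comp:
  assumes [measurable]: "k1 \<in> borel_measurable borel" "k2 \<in> borel_measurable borel"
    and "sigma_finite_measure \<nu>" and [measurable_cong]: "sets \<nu> = sets borel"
    and k3: "\<And>z. (\<integral>\<^sup>+ v. ennreal (k1 (z - v)) * ennreal (k2 v) \<partial>lborel) = ennreal (k3 z)"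
  shows "(\<integral>\<^sup>+ y. ennreal (k1 (y - x)) * causal_conv k2 \<nu> y \<partial>lborel) = causal_conv k3 \<nu> x"
proof -
  interpret sigma_finite_measure \<nu> by fact
  interpret pair_sigma_finite \<nu> lborel ..
  have "(\<integral>\<^sup>+ y. ennreal (k1 (y - x)) * causal_conv k2 \<nu> y \<partial>lborel)
      = (\<integral>\<^sup>+ y. \<integral>\<^sup>+ t. ennreal (k1 (y - x)) * ennreal (k2 (t - y)) \<partial>\<nu> \<partial>lborel)"
    unfolding causal_conv_def by (intro nn_integral_cong nn_integral_cmult[symmetric]) auto
  also have "\<dots> = (\<integral>\<^sup>+ t. \<integral>\<^sup>+ y. ennreal (k1 (y - x)) * ennreal (k2 (t - y)) \<partial>lborel \<partial>\<nu>)"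
    by (rule Fubini') measurable
  also have "\<dots> = causal_conv k3 \<nu> x"
    unfolding causal_conv_def
  proof (rule nn_integral_cong)
    fix t
    have "(\<integral>\<^sup>+ y. ennreal (k1 (y - x)) * ennreal (k2 (t - y)) \<partial>lborel)
      = ennreal \<bar>-1\<bar> * (\<integral>\<^sup>+ v. ennreal (k1 (t + (-1) * v - x)) * ennreal (k2 (t - (t + (-1) * v))) \<partial>lborel)"
      by (rule nn_integral_real_affine) auto
    also have "\<dots> = (\<integral>\<^sup>+ v. ennreal (k1 (t - x - v)) * ennreal (k2 v) \<partial>lborel)"
      by (simp add: algebra_simps)
    finally show "(\<integral>\<^sup>+ y. ennreal (k1 (y - x)) * ennreal (k2 (t - y)) \<partial>lborel) = ennreal (k3 (t - x))"
      using k3 by simp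
  qed
  finally show ?thesis .
qed

lemma rl_kernel_1: "rl_kernel 1 x = indicator {0<..} x"
  by (simp add: rl_kernel_def)

lemma causal_conv_rl_kernel_add:
  assumes "a > 0" "b > 0" "sigma_finite_measure \<nu>" "sets \<nu> = sets borel"
  shows "(\<integral>\<^sup>+ y. ennreal (rl_kernel a (y - x)) * causal_conv (rl_kernel b) \<nu> y \<partial>lborel)
           = causal_conv (rl_kernel (a + b)) \<nu> x"
  by (rule causal_conv_comp) (use assms rl_kernel_convolution in auto)

lemma causal_conv_rl_kernel_1:
  assumes "sets \<nu> = sets borel"
  shows "causal_conv (rl_kernel 1) \<nu> x = emeasure \<nu> {x<..}"
proof -
  have "causal_conv (rl_kernel 1) \<nu> x = (\<integral>\<^sup>+ t. indicator {x<..} t \<partial>\<nu>)"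
    unfolding causal_conv_def by (intro nn_integral_cong) (auto simp: rl_kernel_1 indicator_def)
  then show ?thesis using assms by simp
qed

section \<open>Right Caputo derivatives of tail integrals\<close>

context
  fixes q G :: "real \<Rightarrow> real"
  assumes q_measurable [measurable]: "q \<in> borel_measurable borel"
    and q_integrable: "\<And>y. set_integrable lborel {y<..} q"
    and G_eq: "\<And>y. G y = (LINT t:{y<..}|lborel. q t)"
begin

lemma tail_integral_diff:
  assumes "y \<le> z"
  shows "q integrable_on {y..z}" "G y - G z = integral {y..z} q"
proof -
  have sub: "set_integrable lborel A q" if "A \<subseteq> {y - 1<..}" "A \<in> sets lborel" for A
    using set_integrable_subset[OF q_integrable that(2,1)] .
  have i: "set_integrable lborel {y..z} q" by (rule sub) auto
  have U: "{y<..} = {y<..z} \<union> {z<..}" using assms by auto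
  have "G y = (LINT t:{y<..z}|lborel. q t) + G z"
    unfolding G_eq U by (rule set_integral_Un) (auto intro!: sub q_integrable)
  also have "(LINT t:{y<..z}|lborel. q t) = (LINT t:{y..z}|lborel. q t)"
    unfolding set_lebesgue_integral_def
    by (rule integral_cong_AE) (auto simp: indicator_def intro!: AE_I[where N = "{y}"])
  also have "\<dots> = integral {y..z} q" using set_borel_integral_eq_integral(2)[OF i] .
  finally show "G y - G z = integral {y..z} q" by simp
  show "q integrable_on {y..z}" using set_borel_integral_eq_integral(1)[OF i] .
qed

lemma tail_integral_isCont: "isCont G y"
proof -
  have "continuous_on {y - 1..y + 1} (\<lambda>z. G (y - 1) - integral {y - 1..z} q)"
    by (intro continuous_intros indefinite_integral_continuous_1 tail_integral_diff) auto
  moreover have "G (y - 1) - integral {y - 1..z} q = G z" if "z \<in> {y - 1..y + 1}" for z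
    using tail_integral_diff(2)[of "y - 1" z] that by auto
  ultimately have "continuous_on {y - 1..y + 1} G" by (subst continuous_on_cong[OF refl, symmetric]) auto
  then have "continuous_on {y - 1<..<y + 1} G" by (rule continuous_on_subset) auto
  then show ?thesis by (simp add: continuous_on_eq_continuous_at)
qed

lemma tail_integral_DERIV:
  assumes "isCont q y"
  shows "(G has_field_derivative - q y) (at y)"
proof -
  have "((\<lambda>u. integral {y - 1..u} q) has_vector_derivative q y) (at y within {y - 1..y + 1})"
    by (rule integral_has_vector_derivative_continuous_at[where S = "{}", simplified])
       (use assms in \<open>auto intro!: tail_integral_diff continuous_at_imp_continuous_at_within\<close>)
  then have "((\<lambda>u. integral {y - 1..u} q) has_field_derivative q y) (at y)"
    by (simp add: has_real_derivative_iff_has_vector_derivative at_within_Icc_at)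
  then have "((\<lambda>u. G (y - 1) - integral {y - 1..u} q) has_field_derivative - q y) (at y)"
    by (auto intro!: derivative_eq_intros)
  then show ?thesis
  proof (rule has_field_derivative_transform_within_open)
    show "open {y - 1<..}" "y \<in> {y - 1<..}" by auto
    show "G (y - 1) - integral {y - 1..z} q = G z" if "z \<in> {y - 1<..}" for z
      using tail_integral_diff(2)[of "y - 1" z] that by auto
  qed
qed

text \<open>Lebesgue differentiation is available for the intervals from \<open>x\<close> to
  \<open>x + h\<close> with \<open>h > 0\<close>, which gives the right derivative. The left
  derivative is the same statement for the reflected function \<open>?q'\<close>; its exceptional
  set \<open>N2\<close> is reflected back.\<close>

lemma tail_integral_AE_DERIV:
  "AE y in lebesgue. (G has_field_derivative - q y) (at y)"
proof -
  let ?q' = "\<lambda>t. q (- t)"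
  have q_box: "q integrable_on cbox a b" for a b
    using tail_integral_diff(1)[of a b] by (cases "a \<le> b") auto
  then have q'_box: "?q' integrable_on cbox a b" for a b :: real
    using Henstock_Kurzweil_Integration.integrable_reflect_real[of q "- a" "- b"] by simp
  obtain N1 where N1: "negligible N1" and r: "\<And>x e. \<lbrakk>x \<notin> N1; 0 < e\<rbrakk> \<Longrightarrow>
      \<exists>d>0. \<forall>h. 0 < h \<and> h < d \<longrightarrow> norm (integral (cbox x (x + h *\<^sub>R One)) q /\<^sub>R h ^ DIM(real) - q x) < e"
    using integrable_ccontinuous_explicit[OF q_box] by blast
  obtain N2 where N2: "negligible N2" and l: "\<And>x e. \<lbrakk>x \<notin> N2; 0 < e\<rbrakk> \<Longrightarrow>
      \<exists>d>0. \<forall>h. 0 < h \<and> h < d \<longrightarrow> norm (integral (cbox x (x + h *\<^sub>R One)) ?q' /\<^sub>R h ^ DIM(real) - ?q' x) < e"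
    using integrable_ccontinuous_explicit[OF q'_box] by blast
  have neg: "negligible (uminus ` N2)"
    using N2 by (intro negligible_differentiable_image_negligible) (auto intro!: derivative_intros)
  have "AE y in lebesgue. y \<notin> N1 \<union> uminus ` N2"
    using N1 neg by (intro AE_not_in) (auto simp: negligible_iff_null_sets[symmetric])
  then show ?thesis
  proof (rule AE_mp, intro AE_I2 impI)
    fix y assume y: "y \<notin> N1 \<union> uminus ` N2"
    then have y2: "- y \<notin> N2" by force
    have "((\<lambda>h. (G (y + h) - G y) / h) \<longlongrightarrow> - q y) (at_right 0)"
    proof (rule tendstoI)
      fix e :: real assume "e > 0"
      then obtain d where "d > 0" and d: "\<And>h. 0 < h \<Longrightarrow> h < d \<Longrightarrow> \<bar>integral {y..y + h} q / h - q y\<bar> < e"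
        using r[of y e] y by (auto simp: divide_inverse_commute)
      have "dist ((G (y + h) - G y) / h) (- q y) < e" if "0 < h" "h < d" for h
      proof -
        have "(G (y + h) - G y) / h = - (integral {y..y + h} q / h)"
          using tail_integral_diff(2)[of y "y + h"] that by (simp add: field_simps)
        then show ?thesis using d[OF that] by (simp add: dist_real_def abs_minus_commute)
      qed
      then show "eventually (\<lambda>h. dist ((G (y + h) - G y) / h) (- q y) < e) (at_right 0)"
        using \<open>d > 0\<close> by (auto simp: eventually_at_right_field)
    qed
    moreover have "((\<lambda>h. (G (y + h) - G y) / h) \<longlongrightarrow> - q y) (at_left 0)"
    proof (rule tendstoI)
      fix e :: real assume "e > 0"
      then obtain d where "d > 0" and d: "\<And>h. 0 < h \<Longrightarrow> h < d \<Longrightarrow> \<bar>integral {- y..- y + h} ?q' / h - q y\<bar> < e"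
        using l[of "- y" e] y2 by (auto simp: divide_inverse_commute)
      have "dist ((G (y + h) - G y) / h) (- q y) < e" if "h < 0" "- d < h" for h
      proof -
        have "integral {- y..- y + (- h)} ?q' = integral {y + h..y} q"
          using Henstock_Kurzweil_Integration.integral_reflect_real[of "y" "y + h" q] by simp
        moreover have "G (y + h) - G y = integral {y + h..y} q"
          using tail_integral_diff(2)[of "y + h" y] that by simp
        ultimately have "(G (y + h) - G y) / h = - (integral {- y..- y + (- h)} ?q' / (- h))"
          by simp
        then show ?thesis using d[of "- h"] that by (simp add: dist_real_def abs_minus_commute)
      qed
      then show "eventually (\<lambda>h. dist ((G (y + h) - G y) / h) (- q y) < e) (at_left 0)"
        using \<open>d > 0\<close> by (auto simp: eventually_at_left_field intro!: exI[of _ "- d"])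
    qed
    ultimately show "(G has_field_derivative - q y) (at y)"
      unfolding DERIV_def by (subst filterlim_at_split) simp
  qed
qed

end

text \<open>The top derivative of a function is known here only off a null set; completeness of
  Lebesgue measure hands it the measurability of the function that it agrees with there.\<close>

lemma borel_measurable_lebesgue_AE_cong:
  fixes f g :: "real \<Rightarrow> real"
  assumes f: "f \<in> borel_measurable lebesgue" and eq: "AE y in lebesgue. f y = g y"
  shows "g \<in> borel_measurable lebesgue"
proof (rule measurableI)
  fix A :: "real set" assume "A \<in> sets borel"
  then have A: "f -` A \<inter> space lebesgue \<in> sets lebesgue" using f by (rule measurable_sets[rotated])
  have "AE y in lebesgue. y \<in> f -` A \<inter> space lebesgue \<longleftrightarrow> y \<in> g -` A \<inter> space lebesgue"
    using eq by eventually_elim auto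
  from completion.in_sets_AE[OF this A] show "g -` A \<inter> space lebesgue \<in> sets lebesgue" by simp
qed auto

text \<open>The criterion by which every Caputo derivative below is computed. Up to order
  \<open>caputo_order r - 1\<close> the derivatives \<open>D k\<close> are classical; the last of
  them is a tail integral of \<open>q\<close>, hence has derivative \<open>- q\<close> almost
  everywhere, which is the source of the leading minus sign. \<open>F\<close> has to match
  \<open>D 0\<close> only beyond \<open>a\<close>.\<close>

lemma right_caputo_eqI:
  fixes D :: "nat \<Rightarrow> real \<Rightarrow> real"
  assumes F: "\<And>y. y > a \<Longrightarrow> F y = D 0 y"
    and step: "\<And>k y. k < caputo_order r - 1 \<Longrightarrow> y > a \<Longrightarrow> (D k has_field_derivative D (Suc k) y) (at y)"
    and q [measurable]: "q \<in> borel_measurable borel" and q_int: "\<And>y. set_integrable lborel {y<..} q"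
    and last: "\<And>y. D (caputo_order r - 1) y = (LINT t:{y<..}|lborel. q t)"
    and x: "a \<le> x"
    and int: "set_integrable lborel {x<..} (\<lambda>y. (y - x) powr (real (caputo_order r) - r - 1) * q y)"
  shows "right_caputo_exists r F x"
    and "right_caputo r F x = - ((- 1) ^ caputo_order r / Gamma (real (caputo_order r) - r) *
           (LINT y:{x<..}|lborel. (y - x) powr (real (caputo_order r) - r - 1) * q y))"
proof -
  define N where "N = caputo_order r"
  have N: "N = Suc (N - 1)" unfolding N_def caputo_order_def by simp
  have iter: "k \<le> N - 1 \<Longrightarrow> y > a \<Longrightarrow> (deriv ^^ k) F y = D k y" for k y
  proof (induction k arbitrary: y)
    case (Suc k)
    have "((deriv ^^ k) F has_field_derivative D (Suc k) y) (at y)"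
      by (rule has_field_derivative_transform_within_open[where S = "{a<..}", OF step])
         (use Suc in \<open>auto simp: N_def\<close>)
    then show ?case by (simp add: DERIV_imp_deriv)
  qed (use F in auto)
  have iter_deriv: "((deriv ^^ k) F has_field_derivative d) (at y)"
    if "k \<le> N - 1" "y > a" "(D k has_field_derivative d) (at y)" for k y d
    by (rule has_field_derivative_transform_within_open[where S = "{a<..}", OF that(3)])
       (use that iter in auto)
  have AE: "AE y in lebesgue. y > a \<longrightarrow> ((deriv ^^ (N - 1)) F has_field_derivative - q y) (at y)"
    using tail_integral_AE_DERIV[OF q q_int last]
    by (rule AE_mp) (auto intro!: AE_I2 iter_deriv simp: N_def)
  let ?w = "\<lambda>y. (y - x) powr (real N - r - 1)"
  let ?g = "\<lambda>y. indicator {x<..} y *\<^sub>R (?w y * (deriv ^^ N) F y)"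
  let ?h = "\<lambda>y. indicator {x<..} y *\<^sub>R (?w y * - q y)"
  have eq: "AE y in lebesgue. ?h y = ?g y"
    using AE
  proof (rule AE_mp, intro AE_I2 impI)
    fix y assume y: "y > a \<longrightarrow> ((deriv ^^ (N - 1)) F has_field_derivative - q y) (at y)"
    have "(deriv ^^ N) F y = deriv ((deriv ^^ (N - 1)) F) y"
      by (subst N) simp
    then show "?h y = ?g y" using y x by (auto simp: indicator_def DERIV_imp_deriv)
  qed
  have hm: "?h \<in> borel_measurable borel" by measurable
  then have hm': "?h \<in> borel_measurable lebesgue" by (simp add: measurable_completion)
  then have gm: "?g \<in> borel_measurable lebesgue"
    using eq by (rule borel_measurable_lebesgue_AE_cong)
  have hi: "integrable lborel ?h"
    using int unfolding set_integrable_def N_def by (simp add: algebra_simps)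
  then have "integrable lebesgue ?h" using hm by (simp add: integrable_completion)
  then have gi: "integrable lebesgue ?g" using integrable_cong_AE[OF hm' gm eq] by simp
  show "right_caputo_exists r F x"
    unfolding right_caputo_exists_def N_def[symmetric]
  proof (intro conjI allI impI)
    show "(deriv ^^ k) F field_differentiable at y" if "k < N - 1" "y > x" for k y
      using iter_deriv[of k y, OF _ _ step] that x by (auto simp: field_differentiable_def N_def)
    show "AE y in lebesgue. x < y \<longrightarrow> (deriv ^^ (N - 1)) F field_differentiable at y"
      using AE by (rule AE_mp) (use x in \<open>auto intro!: AE_I2 simp: field_differentiable_def\<close>)
    show "set_integrable lebesgue {x<..} (\<lambda>y. ?w y * (deriv ^^ N) F y)"
      using gi unfolding set_integrable_def .
  qed
  have "(LINT y:{x<..}|lebesgue. ?w y * (deriv ^^ N) F y) = integral\<^sup>L lebesgue ?h"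
    unfolding set_lebesgue_integral_def using integral_cong_AE[OF hm' gm eq] by simp
  also have "\<dots> = integral\<^sup>L lborel ?h" using hm by (simp add: integral_completion)
  also have "\<dots> = - (LINT y:{x<..}|lborel. ?w y * q y)"
    unfolding set_lebesgue_integral_def by simp
  finally show "right_caputo r F x = - ((- 1) ^ caputo_order r / Gamma (real (caputo_order r) - r) *
           (LINT y:{x<..}|lborel. (y - x) powr (real (caputo_order r) - r - 1) * q y))"
    unfolding right_caputo_def N_def by simp
qed

text \<open>A finite integral forces \<open>w * Q\<close> to be finite almost everywhere, so
  \<open>enn2real\<close> loses nothing that the weight can see, although \<open>Q\<close> may be
  infinite at some points.\<close>

lemma nn_integral_weighted_real:
  fixes w :: "real \<Rightarrow> real" and Q :: "real \<Rightarrow> ennreal"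
  assumes [measurable]: "w \<in> borel_measurable borel" "Q \<in> borel_measurable borel"
    and w: "\<And>y. 0 \<le> w y"
    and fin: "(\<integral>\<^sup>+ y. ennreal (w y) * Q y \<partial>lborel) < \<infinity>"
  shows "integrable lborel (\<lambda>y. w y * enn2real (Q y))"
    and "(LINT y|lborel. w y * enn2real (Q y)) = enn2real (\<integral>\<^sup>+ y. ennreal (w y) * Q y \<partial>lborel)"
proof -
  have eq: "w y * enn2real (Q y) = enn2real (ennreal (w y) * Q y)" for y
    using w by (simp add: enn2real_mult)
  have "AE y in lborel. ennreal (w y) * Q y \<noteq> \<infinity>"
    using fin by (intro nn_integral_PInf_AE) auto
  then have AE: "AE y in lborel. ennreal (w y * enn2real (Q y)) = ennreal (w y) * Q y"
    unfolding eq by eventually_elim (simp add: less_top)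
  then have nn: "(\<integral>\<^sup>+ y. ennreal (w y * enn2real (Q y)) \<partial>lborel) = (\<integral>\<^sup>+ y. ennreal (w y) * Q y \<partial>lborel)"
    by (rule nn_integral_cong_AE)
  show "integrable lborel (\<lambda>y. w y * enn2real (Q y))"
    by (rule integrableI_nonneg) (use fin nn w in auto)
  show "(LINT y|lborel. w y * enn2real (Q y)) = enn2real (\<integral>\<^sup>+ y. ennreal (w y) * Q y \<partial>lborel)"
    by (subst integral_eq_nn_integral) (use w nn in auto)
qed

lemma ennreal_indicator_rl: "ennreal (rl_kernel 1 (y - x)) = indicator {x<..} y"
  by (auto simp: rl_kernel_1 indicator_def)

lemma tail_integral_real:
  fixes Q :: "real \<Rightarrow> ennreal"
  assumes [measurable]: "Q \<in> borel_measurable borel"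
    and fin: "(\<integral>\<^sup>+ y. indicator {x<..} y * Q y \<partial>lborel) < \<infinity>"
  shows "set_integrable lborel {x<..} (\<lambda>y. enn2real (Q y))"
    and "(LINT y:{x<..}|lborel. enn2real (Q y)) = enn2real (\<integral>\<^sup>+ y. indicator {x<..} y * Q y \<partial>lborel)"
  using nn_integral_weighted_real[of "indicator {x<..}" Q] fin
  by (simp_all add: set_integrable_def set_lebesgue_integral_def ennreal_indicator)

text \<open>Up to the factor \<open>C\<close>, \<open>F\<close> is the Weyl integral of order
  \<open>r\<close> of the tail of \<nu>, since that tail is itself the integral of order 1. With
  \<open>s = frac r\<close>, differentiating \<open>N - 1\<close> times lowers the order from
  \<open>r + 1\<close> to \<open>1 + s\<close>, one more derivative lowers it to \<open>s\<close>,
  and the Caputo weight is the kernel of order \<open>1 - s\<close>, which raises it to 1 again: the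
  tail of \<nu>.\<close>

lemma weyl_caputo:
  assumes sf: "sigma_finite_measure \<nu>" and sets: "sets \<nu> = sets borel"
    and fin: "\<And>b x. b \<ge> 1 \<Longrightarrow> causal_conv (rl_kernel b) \<nu> x < \<infinity>"
    and r: "r > 0" and x: "a \<le> x"
    and F: "\<And>y. y > a \<Longrightarrow> F y = C * enn2real (causal_conv (rl_kernel (r + 1)) \<nu> y)"
    and dens: "r \<in> \<int> \<Longrightarrow> \<exists>p :: real \<Rightarrow> ennreal. p \<in> borel_measurable borel \<and>
        (\<forall>x. emeasure \<nu> {x<..} = (\<integral>\<^sup>+ y. indicator {x<..} y * p y \<partial>lborel))"
  shows "right_caputo_exists r F x" "right_caputo r F x = C * measure \<nu> {x<..}"
proof -
  define s where "s = frac r"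
  define N where "N = caputo_order r"
  define K where "K = (\<lambda>b. causal_conv (rl_kernel b) \<nu>)"
  define Kr where "Kr = (\<lambda>b y. enn2real (K b y))"
  have s: "0 \<le> s" "s < 1" unfolding s_def by (auto simp: frac_lt_1)
  have rN: "r = real N - 1 + s" and N1: "N \<ge> 1"
    using r by (auto simp: N_def caputo_order_def s_def frac_def)
  have Km [measurable]: "K b \<in> borel_measurable borel" for b
    unfolding K_def by (rule causal_conv_measurable[OF _ sf sets]) simp
  have Krm [measurable]: "Kr b \<in> borel_measurable borel" for b unfolding Kr_def by simp
  have K1: "K 1 y = emeasure \<nu> {y<..}" for y
    unfolding K_def by (rule causal_conv_rl_kernel_1[OF sets])
  have Kadd: "(\<integral>\<^sup>+ y. ennreal (rl_kernel b (y - z)) * K b' y \<partial>lborel) = K (b + b') z" if "b > 0" "b' > 0" for b b' z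
    unfolding K_def by (rule causal_conv_rl_kernel_add[OF that sf sets])
  have Ktail: "(\<integral>\<^sup>+ y. indicator {z<..} y * K b y \<partial>lborel) = K (b + 1) z" if "b > 0" for b z
    using Kadd[of 1 b z] that by (simp add: ennreal_indicator_rl add.commute)
  have Kfin: "K b z < \<infinity>" if "b \<ge> 1" for b z unfolding K_def by (rule fin[OF that])
  have Krtail: "set_integrable lborel {z<..} (Kr b)" "Kr (b + 1) z = (LINT y:{z<..}|lborel. Kr b y)" if "b > 0" for b z
    using tail_integral_real[of "K b" z] Kfin[of "b + 1"] that by (auto simp: Ktail Kr_def)
  \<comment> \<open>\<open>Q\<close> is minus the almost everywhere derivative of
    \<open>K (1 + s)\<close>. For \<open>s > 0\<close> it is the integral of order \<open>s\<close>;
    for \<open>s = 0\<close> the kernel would be a Dirac mass, and a density of \<nu> takes its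
    place.\<close>
  obtain Q :: "real \<Rightarrow> ennreal" where Qm [measurable]: "Q \<in> borel_measurable borel"
    and Q1: "\<And>z. (\<integral>\<^sup>+ y. indicator {z<..} y * Q y \<partial>lborel) = K (1 + s) z"
    and Q2: "\<And>z. (\<integral>\<^sup>+ y. ennreal (rl_kernel (1 - s) (y - z)) * Q y \<partial>lborel) = K 1 z"
  proof (cases "s = 0")
    case True
    then have "r \<in> \<int>" by (simp add: s_def frac_eq_0_iff)
    then obtain p where "p \<in> borel_measurable borel" "\<And>x. emeasure \<nu> {x<..} = (\<integral>\<^sup>+ y. indicator {x<..} y * p y \<partial>lborel)"
      using dens by blast
    then show thesis using that[of p] True by (simp add: K1 ennreal_indicator_rl)
  next
    case False
    then have "s > 0" using s by simp
    then show thesis using that[of "K s"] s Kadd[of "1 - s" s] by (simp add: Ktail add.commute)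
  qed
  define q where "q = (\<lambda>y. C * (-1) ^ (N - 1) * enn2real (Q y))"
  define D where "D = (\<lambda>k y. C * (-1) ^ k * Kr (r + 1 - real k) y)"
  have Qtail: "set_integrable lborel {z<..} (\<lambda>y. enn2real (Q y))"
       "Kr (1 + s) z = (LINT y:{z<..}|lborel. enn2real (Q y))" for z
    using tail_integral_real[of Q z] Kfin[of "1 + s"] s by (auto simp: Q1 Kr_def)
  \<comment> \<open>For \<open>j = 0\<close> the order \<open>s\<close> may be 0, so continuity is
    taken from \<open>Q\<close>; all higher orders are tail integrals of a kernel integral of
    positive order.\<close>
  have cont: "isCont (Kr (1 + s + real j)) y" for j y
  proof (cases "j = 0")
    case True
    then show ?thesis using tail_integral_isCont[OF _ Qtail] by simp
  next
    case False
    then have "s + real j > 0" using s by auto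
    then show ?thesis using tail_integral_isCont[OF _ Krtail[of "s + real j"]]
      by (simp add: ac_simps)
  qed
  have step: "(D k has_field_derivative D (Suc k) y) (at y)" if "k < N - 1" for k y
  proof -
    define j where "j = N - 2 - k"
    have j: "r - real k = 1 + s + real j" using that rN unfolding j_def by (simp add: of_nat_diff)
    have "(Kr (r - real k + 1) has_field_derivative - Kr (r - real k) y) (at y)"
      by (rule tail_integral_DERIV[OF _ Krtail]) (use cont[of y j] j s in auto)
    then show ?thesis unfolding D_def by (auto intro!: derivative_eq_intros simp: algebra_simps)
  qed
  have w: "integrable lborel (\<lambda>y. rl_kernel (1 - s) (y - x) * enn2real (Q y))"
    "(LINT y|lborel. rl_kernel (1 - s) (y - x) * enn2real (Q y)) = Kr 1 x"
    using nn_integral_weighted_real[of "\<lambda>y. rl_kernel (1 - s) (y - x)" Q] s Kfin[of 1]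
    by (auto simp: rl_kernel_nonneg Q2 Kr_def)
  have G: "Gamma (1 - s) > 0" using s by simp
  have e: "real N - r - 1 = - s" "real N - r = 1 - s" using rN by auto
  have wq: "indicator {x<..} y *\<^sub>R ((y - x) powr (- s) * q y)
      = (C * (-1) ^ (N - 1) * Gamma (1 - s)) * (rl_kernel (1 - s) (y - x) * enn2real (Q y))" for y
    using G by (auto simp: q_def rl_kernel_def indicator_def)
  have qi: "set_integrable lborel {x<..} (\<lambda>y. (y - x) powr (- s) * q y)"
    and qe: "(LINT y:{x<..}|lborel. (y - x) powr (- s) * q y) = C * (-1) ^ (N - 1) * Gamma (1 - s) * Kr 1 x"
    unfolding set_integrable_def set_lebesgue_integral_def wq using w by auto
  have last: "D (N - 1) y = (LINT t:{y<..}|lborel. q t)" for y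
    using Qtail(2)[of y] rN N1 unfolding q_def D_def
    by (simp add: of_nat_diff add.commute set_lebesgue_integral_def)
  have F0: "F y = D 0 y" if "a < y" for y using F[OF that] by (simp add: D_def Kr_def K_def)
  have qm: "q \<in> borel_measurable borel" unfolding q_def by simp
  have qti: "set_integrable lborel {y<..} q" for y
    unfolding q_def using Qtail(1) by (intro set_integrable_mult_right)
  note cap = right_caputo_eqI[where D = D and a = a and q = q and x = x and r = r and F = F, folded N_def,
      OF F0 step qm qti last x, unfolded e(1), OF _ _ qi, simplified]
  show "right_caputo_exists r F x" by (rule cap(1))
  have sg: "(- 1) ^ N * (-1) ^ (N - 1) = (-1::real)"
    using N1 by (cases N) (auto simp: power_mult_distrib[symmetric])
  have "right_caputo r F x = - (((- 1) ^ N * (-1) ^ (N - 1)) * (C * Kr 1 x))"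
    unfolding cap(2) e qe using G by simp
  also have "\<dots> = C * Kr 1 x" unfolding sg by simp
  finally show "right_caputo r F x = C * measure \<nu> {x<..}"
    by (simp add: Kr_def K1 measure_def)
qed

section \<open>Tails of distributions, and measures with a prescribed tail\<close>

lemma (in real_distribution) measure_Ioi_eq_cdf: "measure M {x<..} = 1 - cdf M x"
proof -
  have "{x<..} = space M - {..x}" by auto
  then show ?thesis using prob_compl[of "{..x}"] by (simp add: cdf_def)
qed

lemma (in real_distribution) measure_Ioi_antimono: "x \<le> y \<Longrightarrow> measure M {y<..} \<le> measure M {x<..}"
  by (simp add: measure_Ioi_eq_cdf cdf_nondecreasing)

lemma (in real_distribution) measure_Ioi_right_cont: "continuous (at_right x) (\<lambda>y. measure M {y<..})"
  unfolding measure_Ioi_eq_cdf by (intro continuous_intros cdf_is_right_cont)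

lemma (in real_distribution) measure_Ioi_measurable [measurable]:
  "(\<lambda>y. measure M {y<..}) \<in> borel_measurable borel"
proof -
  have "mono (\<lambda>y. - measure M {y<..})" by (auto intro!: monoI measure_Ioi_antimono)
  then have "(\<lambda>y. - (- measure M {y<..})) \<in> borel_measurable borel"
    by (intro borel_measurable_uminus borel_measurable_mono)
  then show ?thesis by simp
qed

text \<open>Used for \<phi> equal to \<open>exp (- \<alpha> * y)\<close> times a tail, which is
  unbounded towards the left. The measure is then infinite and no cumulative distribution function
  from the left exists, so the half-line is exhausted by bounded intervals instead.\<close>

lemma emeasure_interval_measure_Ioi:
  fixes \<phi> :: "real \<Rightarrow> real"
  assumes anti: "\<And>x y. x \<le> y \<Longrightarrow> \<phi> y \<le> \<phi> x" and rc: "\<And>x. continuous (at_right x) \<phi>"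
    and lim: "(\<phi> \<longlongrightarrow> 0) at_top"
  shows "emeasure (interval_measure (\<lambda>x. - \<phi> x)) {x<..} = ennreal (\<phi> x)"
proof (rule LIMSEQ_unique)
  let ?I = "interval_measure (\<lambda>x. - \<phi> x)"
  have U: "{x<..} = (\<Union>n. {x<..x + real n})"
  proof (intro set_eqI iffI)
    fix y assume "y \<in> {x<..}"
    moreover obtain n where "y - x \<le> real n" using real_arch_simple by blast
    ultimately show "y \<in> (\<Union>n. {x<..x + real n})" by (auto intro!: bexI[of _ n] simp: algebra_simps)
  qed auto
  show "(\<lambda>n. emeasure ?I {x<..x + real n}) \<longlonglongrightarrow> emeasure ?I {x<..}"
    unfolding U by (rule Lim_emeasure_incseq) (auto simp: incseq_def)
  have "emeasure ?I {x<..x + real n} = ennreal (\<phi> x - \<phi> (x + real n))" for n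
    by (subst emeasure_interval_measure_Ioc) (use anti rc in \<open>auto intro!: continuous_intros\<close>)
  moreover have "(\<lambda>n. \<phi> (x + real n)) \<longlonglongrightarrow> 0"
    by (rule filterlim_compose[OF lim]) real_asymp
  then have "(\<lambda>n. ennreal (\<phi> x - \<phi> (x + real n))) \<longlonglongrightarrow> ennreal (\<phi> x - 0)"
    by (intro tendsto_intros)
  ultimately show "(\<lambda>n. emeasure ?I {x<..x + real n}) \<longlonglongrightarrow> ennreal (\<phi> x)" by simp
qed

section \<open>Inversion of the gamma phases\<close>

lemma real_distribution_convolution:
  assumes "real_distribution \<eta>" "real_distribution D"
  shows "real_distribution (convolution \<eta> D)"
proof -
  interpret \<eta>: real_distribution \<eta> by fact
  interpret D: real_distribution D by fact
  interpret pair_prob_space \<eta> D ..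
  show ?thesis unfolding convolution_def real_distribution_def real_distribution_axioms_def
    by (auto intro!: prob_space_distr)
qed

lemma emeasure_convolution_Ioi:
  assumes "real_distribution \<eta>" "real_distribution D"
  shows "emeasure (convolution \<eta> D) {u<..} = (\<integral>\<^sup>+ y. emeasure \<eta> {u - y<..} \<partial>D)"
proof -
  interpret \<eta>: real_distribution \<eta> by fact
  interpret D: real_distribution D by fact
  have "convolution \<eta> D = convolution D \<eta>"
    by (rule convolution_commutative) (auto simp: \<eta>.finite_measure_axioms D.finite_measure_axioms)
  also have "emeasure (convolution D \<eta>) {u<..} = (\<integral>\<^sup>+ y. emeasure \<eta> {a. a + y \<in> {u<..}} \<partial>D)"
    by (rule convolution_emeasure) (auto simp: \<eta>.finite_measure_axioms D.finite_measure_axioms)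
  also have "\<dots> = (\<integral>\<^sup>+ y. emeasure \<eta> {u - y<..} \<partial>D)"
    by (intro nn_integral_cong arg_cong[where f = "emeasure \<eta>"]) auto
  finally show ?thesis .
qed

lemma gamma_density_eq_rl_kernel:
  "gamma_density r l y = l powr r * rl_kernel r y * exp (- l * y)"
  by (simp add: gamma_density_def rl_kernel_def)

lemma gamma_density_measurable [measurable]: "gamma_density r l \<in> borel_measurable borel"
  unfolding gamma_density_def by measurable

lemma nn_integral_exp_Icc:
  assumes "\<alpha> > 0" "x \<le> t"
  shows "(\<integral>\<^sup>+ y. indicator {x..t} y * ennreal (\<alpha> * exp (- \<alpha> * y)) \<partial>lborel) = ennreal (exp (- \<alpha> * x) - exp (- \<alpha> * t))"
proof -
  have "(\<integral>\<^sup>+ y. ennreal (\<alpha> * exp (- \<alpha> * y)) * indicator {x..t} y \<partial>lborel)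
      = ennreal (- exp (- \<alpha> * t) - (- exp (- \<alpha> * x)))"
    by (rule nn_integral_FTC_Icc) (use assms in \<open>auto intro!: derivative_eq_intros\<close>)
  then show ?thesis by (simp add: mult.commute)
qed

text \<open>Product rule in integrated form: \<open>p\<close> is minus the derivative of
  \<open>exp (- \<alpha> * y)\<close> times the tail, with the Radon-Nikodym density
  \<open>h\<close> in place of a classical one. By Tonelli, a point \<open>t > x\<close> of \<eta>
  receives \<open>exp (- \<alpha> * x) - exp (- \<alpha> * t)\<close> from the first summand of
  \<open>p\<close> and \<open>exp (- \<alpha> * t)\<close> from the second.\<close>

lemma exp_tail_density:
  assumes \<eta>: "real_distribution \<eta>" and \<alpha>: "\<alpha> > 0" and ac: "absolutely_continuous lborel \<eta>"
  shows "\<exists>p :: real \<Rightarrow> ennreal. p \<in> borel_measurable borel \<and>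
     (\<forall>x. ennreal (exp (- \<alpha> * x) * measure \<eta> {x<..}) = (\<integral>\<^sup>+ y. indicator {x<..} y * p y \<partial>lborel))"
proof -
  interpret \<eta>: real_distribution \<eta> by fact
  interpret pair_sigma_finite \<eta> lborel ..
  define h where "h = RN_deriv lborel \<eta>"
  have hm [measurable]: "h \<in> borel_measurable borel" unfolding h_def by simp
  have dens: "density lborel h = \<eta>"
    unfolding h_def by (rule sigma_finite_measure.density_RN_deriv[OF sigma_finite_lborel ac]) simp
  define p where "p = (\<lambda>y. ennreal (\<alpha> * exp (- \<alpha> * y)) * emeasure \<eta> {y<..} + ennreal (exp (- \<alpha> * y)) * h y)"
  have tm [measurable]: "(\<lambda>y. emeasure \<eta> {y<..}) \<in> borel_measurable borel"
    unfolding \<eta>.emeasure_eq_measure by simp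
  have "ennreal (exp (- \<alpha> * x) * measure \<eta> {x<..}) = (\<integral>\<^sup>+ y. indicator {x<..} y * p y \<partial>lborel)" for x
  proof -
    have "(\<integral>\<^sup>+ y. indicator {x<..} y * p y \<partial>lborel)
        = (\<integral>\<^sup>+ y. indicator {x<..} y * (ennreal (\<alpha> * exp (- \<alpha> * y)) * emeasure \<eta> {y<..}) \<partial>lborel)
          + (\<integral>\<^sup>+ y. h y * (indicator {x<..} y * ennreal (exp (- \<alpha> * y))) \<partial>lborel)"
      unfolding p_def by (subst nn_integral_add[symmetric]) (auto simp: algebra_simps)
    also have "(\<integral>\<^sup>+ y. h y * (indicator {x<..} y * ennreal (exp (- \<alpha> * y))) \<partial>lborel)
        = (\<integral>\<^sup>+ t. indicator {x<..} t * ennreal (exp (- \<alpha> * t)) \<partial>\<eta>)"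
      by (subst dens[symmetric], subst nn_integral_density) auto
    also have "(\<integral>\<^sup>+ y. indicator {x<..} y * (ennreal (\<alpha> * exp (- \<alpha> * y)) * emeasure \<eta> {y<..}) \<partial>lborel)
        = (\<integral>\<^sup>+ y. \<integral>\<^sup>+ t. indicator {x<..} y * (ennreal (\<alpha> * exp (- \<alpha> * y)) * indicator {y<..} t) \<partial>\<eta> \<partial>lborel)"
      by (intro nn_integral_cong) (simp add: nn_integral_cmult)
    also have "\<dots> = (\<integral>\<^sup>+ t. \<integral>\<^sup>+ y. indicator {x<..} y * (ennreal (\<alpha> * exp (- \<alpha> * y)) * indicator {y<..} t) \<partial>lborel \<partial>\<eta>)"
      by (rule Fubini') (simp add: indicator_def)
    also have "\<dots> = (\<integral>\<^sup>+ t. indicator {x<..} t * ennreal (exp (- \<alpha> * x) - exp (- \<alpha> * t)) \<partial>\<eta>)"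
    proof (rule nn_integral_cong)
      fix t
      show "(\<integral>\<^sup>+ y. indicator {x<..} y * (ennreal (\<alpha> * exp (- \<alpha> * y)) * indicator {y<..} t) \<partial>lborel)
         = indicator {x<..} t * ennreal (exp (- \<alpha> * x) - exp (- \<alpha> * t))"
      proof (cases "x < t")
        case True
        have "AE y in lborel. y \<noteq> x \<and> y \<noteq> t"
          by (intro AE_conjI AE_lborel_singleton)
        then have "AE y in lborel. indicator {x<..} y * (ennreal (\<alpha> * exp (- \<alpha> * y)) * indicator {y<..} t)
            = indicator {x..t} y * ennreal (\<alpha> * exp (- \<alpha> * y))"
          by eventually_elim (auto simp: indicator_def)
        from nn_integral_cong_AE[OF this] show ?thesis using nn_integral_exp_Icc[OF \<alpha>, of x t] True by simp
      next
        case False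
        then have "indicator {x<..} y * (ennreal (\<alpha> * exp (- \<alpha> * y)) * indicator {y<..} t) = 0" for y
          by (auto simp: indicator_def)
        then have "(\<lambda>y. indicator {x<..} y * (ennreal (\<alpha> * exp (- \<alpha> * y)) * indicator {y<..} t)) = (\<lambda>_. 0)" by blast
        then show ?thesis using False by simp
      qed
    qed
    also have "\<dots> + (\<integral>\<^sup>+ t. indicator {x<..} t * ennreal (exp (- \<alpha> * t)) \<partial>\<eta>)
        = (\<integral>\<^sup>+ t. ennreal (exp (- \<alpha> * x)) * indicator {x<..} t \<partial>\<eta>)"
    proof (subst nn_integral_add[symmetric])
      have "indicator {x<..} t * ennreal (exp (- \<alpha> * x) - exp (- \<alpha> * t)) + indicator {x<..} t * ennreal (exp (- \<alpha> * t))
         = ennreal (exp (- \<alpha> * x)) * indicator {x<..} t" for t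
        using \<alpha> by (auto simp: indicator_def ennreal_plus[symmetric] simp del: ennreal_plus)
      then show "(\<integral>\<^sup>+ t. (indicator {x<..} t * ennreal (exp (- \<alpha> * x) - exp (- \<alpha> * t)) + indicator {x<..} t * ennreal (exp (- \<alpha> * t))) \<partial>\<eta>)
        = (\<integral>\<^sup>+ t. ennreal (exp (- \<alpha> * x)) * indicator {x<..} t \<partial>\<eta>)" by simp
    qed auto
    also have "\<dots> = ennreal (exp (- \<alpha> * x) * measure \<eta> {x<..})"
      by (simp add: nn_integral_cmult ennreal_mult' \<eta>.emeasure_eq_measure)
    finally show ?thesis by simp
  qed
  moreover have "p \<in> borel_measurable borel" unfolding p_def by measurable
  ultimately show ?thesis by blast
qed

text \<open>The exponential weight in the operator cancels the exponential factor of the gamma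
  density: weighted with \<open>exp (- \<alpha> * u)\<close>, where \<open>\<alpha> = l / c\<close>,
  the tail of the shifted law is a pure Weyl integral of order \<open>r\<close> of \<phi>, the
  equally weighted tail of \<eta>. The scale factors recombine as
  \<open>c powr r * \<alpha> powr r = l powr r\<close>.\<close>

lemma gamma_op_tail:
  fixes \<eta> D :: "real measure" and F :: "real \<Rightarrow> real"
  assumes \<eta>: "real_distribution \<eta>" and pos: "r > 0" "l > 0" "c > 0" and x: "x \<ge> 0"
    and D: "D = distr (density lborel (\<lambda>y. ennreal (gamma_density r l y))) borel (\<lambda>y. - (c * y))"
    and D_prob: "real_distribution D"
    and F: "\<And>y. y \<ge> 0 \<Longrightarrow> F y = C * measure (convolution \<eta> D) {y<..}"
    and ac: "r \<in> \<int> \<Longrightarrow> absolutely_continuous lborel \<eta>"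
  shows "right_caputo_exists r (\<lambda>y. exp (- (l / c) * y) * F y) x"
    and "gamma_op c r l F x = l powr r * C * measure \<eta> {x<..}"
proof -
  interpret \<eta>: real_distribution \<eta> by fact
  interpret D: real_distribution D by fact
  interpret \<eta>D: real_distribution "convolution \<eta> D" by (rule real_distribution_convolution) fact+
  define \<alpha> where "\<alpha> = l / c"
  have \<alpha>: "\<alpha> > 0" using pos by (simp add: \<alpha>_def)
  define \<phi> where "\<phi> = (\<lambda>y. exp (- \<alpha> * y) * measure \<eta> {y<..})"
  have anti: "\<phi> y \<le> \<phi> x" if "x \<le> y" for x y
    unfolding \<phi>_def using that \<alpha> by (intro mult_mono \<eta>.measure_Ioi_antimono) auto
  have rc: "continuous (at_right x) \<phi>" for x
    unfolding \<phi>_def by (intro continuous_intros \<eta>.measure_Ioi_right_cont)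
  have \<phi>_le: "\<phi> y \<le> exp (- \<alpha> * y)" and \<phi>_nn: "0 \<le> \<phi> y" for y
    using \<eta>.prob_le_1[of "{y<..}"] by (auto simp: \<phi>_def mult_left_le)
  have lim: "(\<phi> \<longlongrightarrow> 0) at_top"
  proof (rule tendsto_sandwich[OF _ _ tendsto_const])
    show "((\<lambda>y. exp (- \<alpha> * y)) \<longlongrightarrow> 0) at_top" using \<alpha> by real_asymp
  qed (use \<phi>_le \<phi>_nn in auto)
  define \<nu> where "\<nu> = interval_measure (\<lambda>x. - \<phi> x)"
  have sets: "sets \<nu> = sets borel" by (simp add: \<nu>_def)
  have sf: "sigma_finite_measure \<nu>"
    unfolding \<nu>_def by (rule sigma_finite_interval_measure) (use anti rc in \<open>auto intro!: continuous_intros\<close>)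
  have \<nu>: "emeasure \<nu> {y<..} = ennreal (\<phi> y)" for y
    unfolding \<nu>_def by (rule emeasure_interval_measure_Ioi[OF anti rc lim])
  then have \<nu>': "measure \<nu> {y<..} = \<phi> y" for y using \<phi>_nn by (simp add: measure_def)
  have \<phi>m [measurable]: "\<phi> \<in> borel_measurable borel" unfolding \<phi>_def by measurable
  have tm [measurable]: "(\<lambda>y. emeasure \<eta> {y<..}) \<in> borel_measurable borel"
    unfolding \<eta>.emeasure_eq_measure by simp
  have Kb: "causal_conv (rl_kernel (b + 1)) \<nu> u = (\<integral>\<^sup>+ v. ennreal (rl_kernel b (v - u)) * ennreal (\<phi> v) \<partial>lborel)"
    if "b > 0" for b u
    using causal_conv_rl_kernel_add[OF that zero_less_one sf sets, of u]
    by (simp add: causal_conv_rl_kernel_1[OF sets] \<nu>)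
  \<comment> \<open>With \<open>v = u + c * y\<close> the gamma density is a constant times
    \<open>rl_kernel r (v - u)\<close> times \<open>exp (- \<alpha> * (v - u))\<close>, and the
    prefactor turns this exponential into the one contained in \<open>\<phi> v\<close>.\<close>
  have tail: "ennreal (exp (- \<alpha> * u) * measure (convolution \<eta> D) {u<..})
      = ennreal (\<alpha> powr r) * causal_conv (rl_kernel (r + 1)) \<nu> u" for u
  proof -
    have "emeasure (convolution \<eta> D) {u<..} = (\<integral>\<^sup>+ y. emeasure \<eta> {u - y<..} \<partial>D)"
      by (rule emeasure_convolution_Ioi) fact+
    also have "\<dots> = (\<integral>\<^sup>+ y. ennreal (gamma_density r l y) * emeasure \<eta> {u + c * y<..} \<partial>lborel)"
      unfolding D by (subst nn_integral_distr) (auto simp: nn_integral_density)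
    finally have "ennreal (exp (- \<alpha> * u) * measure (convolution \<eta> D) {u<..})
       = (\<integral>\<^sup>+ y. ennreal (exp (- \<alpha> * u)) * (ennreal (gamma_density r l y) * emeasure \<eta> {u + c * y<..}) \<partial>lborel)"
      by (subst nn_integral_cmult) (auto simp: ennreal_mult' \<eta>D.emeasure_eq_measure)
    also have "\<dots> = ennreal \<bar>1 / c\<bar> * (\<integral>\<^sup>+ v. ennreal (exp (- \<alpha> * u)) * (ennreal (gamma_density r l (- u / c + 1 / c * v))
           * emeasure \<eta> {u + c * (- u / c + 1 / c * v)<..}) \<partial>lborel)"
      by (rule nn_integral_real_affine) (use pos in auto)
    also have "\<dots> = ennreal (1 / c) * (\<integral>\<^sup>+ v. ennreal (c * \<alpha> powr r) * (ennreal (rl_kernel r (v - u)) * ennreal (\<phi> v)) \<partial>lborel)"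
    proof (rule arg_cong2[where f = "(*)"])
      show "ennreal \<bar>1 / c\<bar> = ennreal (1 / c)" using pos by simp
      show "(\<integral>\<^sup>+ v. ennreal (exp (- \<alpha> * u)) * (ennreal (gamma_density r l (- u / c + 1 / c * v))
           * emeasure \<eta> {u + c * (- u / c + 1 / c * v)<..}) \<partial>lborel)
        = (\<integral>\<^sup>+ v. ennreal (c * \<alpha> powr r) * (ennreal (rl_kernel r (v - u)) * ennreal (\<phi> v)) \<partial>lborel)"
      proof (rule nn_integral_cong)
        fix v
        have a1: "- u / c + 1 / c * v = (v - u) / c" by (simp add: diff_divide_distrib)
        have a2: "u + c * ((v - u) / c) = v" using pos by simp
        have rl: "rl_kernel r (w / c) = c powr (1 - r) * rl_kernel r w" for w
          using pos by (auto simp: rl_kernel_def powr_divide powr_diff zero_less_divide_iff field_simps)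
        have ex: "exp (- \<alpha> * u) * exp (- l * ((v - u) / c)) = exp (- \<alpha> * v)"
          using pos by (simp add: exp_add[symmetric] \<alpha>_def field_simps)
        have pw: "l powr r * c powr (1 - r) = c * \<alpha> powr r"
          using pos by (simp add: \<alpha>_def powr_divide powr_diff)
        have "exp (- \<alpha> * u) * (gamma_density r l ((v - u) / c) * measure \<eta> {v<..})
            = (l powr r * c powr (1 - r)) * (rl_kernel r (v - u) * ((exp (- \<alpha> * u) * exp (- l * ((v - u) / c))) * measure \<eta> {v<..}))"
          unfolding gamma_density_eq_rl_kernel rl by (simp only: ac_simps)
        also have "\<dots> = c * \<alpha> powr r * (rl_kernel r (v - u) * \<phi> v)"
          unfolding ex pw \<phi>_def ..
        finally have eq: "exp (- \<alpha> * u) * (gamma_density r l ((v - u) / c) * measure \<eta> {v<..}) = c * \<alpha> powr r * (rl_kernel r (v - u) * \<phi> v)" .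
        have nn: "0 \<le> gamma_density r l ((v - u) / c)" "0 \<le> rl_kernel r (v - u)"
          using pos rl_kernel_nonneg by (auto simp: gamma_density_eq_rl_kernel)
        have "ennreal (exp (- \<alpha> * u)) * (ennreal (gamma_density r l ((v - u) / c)) * emeasure \<eta> {v<..})
          = ennreal (exp (- \<alpha> * u) * (gamma_density r l ((v - u) / c) * measure \<eta> {v<..}))"
          unfolding \<eta>.emeasure_eq_measure using nn by (simp add: ennreal_mult)
        also have "\<dots> = ennreal (c * \<alpha> powr r) * (ennreal (rl_kernel r (v - u)) * ennreal (\<phi> v))"
          unfolding eq using nn \<phi>_nn pos by (simp add: ennreal_mult)
        finally show "ennreal (exp (- \<alpha> * u)) * (ennreal (gamma_density r l (- u / c + 1 / c * v))
           * emeasure \<eta> {u + c * (- u / c + 1 / c * v)<..})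
           = ennreal (c * \<alpha> powr r) * (ennreal (rl_kernel r (v - u)) * ennreal (\<phi> v))"
          unfolding a1 a2 .
      qed
    qed
    also have "\<dots> = ennreal (1 / c) * (ennreal (c * \<alpha> powr r) * causal_conv (rl_kernel (r + 1)) \<nu> u)"
      unfolding Kb[OF pos(1)] by (subst nn_integral_cmult) auto
    also have "\<dots> = ennreal (1 / c * (c * \<alpha> powr r)) * causal_conv (rl_kernel (r + 1)) \<nu> u"
      using pos by (subst ennreal_mult) (auto simp: mult.assoc)
    finally show ?thesis using pos by simp
  qed
  have tail': "exp (- \<alpha> * u) * measure (convolution \<eta> D) {u<..} = \<alpha> powr r * enn2real (causal_conv (rl_kernel (r + 1)) \<nu> u)" for u
    using arg_cong[OF tail[of u], of enn2real] by (simp add: enn2real_mult)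
  \<comment> \<open>For \<open>b > 1\<close> the bound
    \<open>\<phi> v \<le> exp (- \<alpha> * v)\<close> and the substitution
    \<open>v = u + t / \<alpha>\<close> reduce finiteness to Euler's integral for
    \<open>Gamma (b - 1)\<close>.\<close>
  have fin: "causal_conv (rl_kernel b) \<nu> u < \<infinity>" if "b \<ge> 1" for b u
  proof (cases "b = 1")
    case True
    then show ?thesis by (simp add: causal_conv_rl_kernel_1[OF sets] \<nu>)
  next
    case False
    define a where "a = b - 1"
    have a: "a > 0" using False that by (simp add: a_def)
    have "causal_conv (rl_kernel b) \<nu> u = (\<integral>\<^sup>+ v. ennreal (rl_kernel a (v - u)) * ennreal (\<phi> v) \<partial>lborel)"
      using Kb[OF a, of u] by (simp add: a_def)
    also have "\<dots> \<le> (\<integral>\<^sup>+ v. ennreal (rl_kernel a (v - u)) * ennreal (exp (- \<alpha> * v)) \<partial>lborel)"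
      by (intro nn_integral_mono mult_left_mono ennreal_leI \<phi>_le) auto
    also have "\<dots> = ennreal \<bar>1 / \<alpha>\<bar> * (\<integral>\<^sup>+ t. ennreal (rl_kernel a (u + 1 / \<alpha> * t - u)) * ennreal (exp (- \<alpha> * (u + 1 / \<alpha> * t))) \<partial>lborel)"
      by (rule nn_integral_real_affine) (use \<alpha> in auto)
    also have "(\<integral>\<^sup>+ t. ennreal (rl_kernel a (u + 1 / \<alpha> * t - u)) * ennreal (exp (- \<alpha> * (u + 1 / \<alpha> * t))) \<partial>lborel)
        = (\<integral>\<^sup>+ t. ennreal (\<alpha> powr (1 - a) * exp (- \<alpha> * u) / Gamma a) * (ennreal (t powr (a - 1) / exp t) * indicator {0..} t) \<partial>lborel)"
    proof (rule nn_integral_cong_AE)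
      have "AE t in lborel. t \<noteq> (0::real)" by (rule AE_lborel_singleton)
      then show "AE t in lborel. ennreal (rl_kernel a (u + 1 / \<alpha> * t - u)) * ennreal (exp (- \<alpha> * (u + 1 / \<alpha> * t)))
         = ennreal (\<alpha> powr (1 - a) * exp (- \<alpha> * u) / Gamma a) * (ennreal (t powr (a - 1) / exp t) * indicator {0..} t)"
      proof eventually_elim
        fix t :: real assume t: "t \<noteq> 0"
        show "ennreal (rl_kernel a (u + 1 / \<alpha> * t - u)) * ennreal (exp (- \<alpha> * (u + 1 / \<alpha> * t)))
         = ennreal (\<alpha> powr (1 - a) * exp (- \<alpha> * u) / Gamma a) * (ennreal (t powr (a - 1) / exp t) * indicator {0..} t)"
        proof (cases "t > 0")
          case True
          have "rl_kernel a (u + 1 / \<alpha> * t - u) * exp (- \<alpha> * (u + 1 / \<alpha> * t))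
             = \<alpha> powr (1 - a) * exp (- \<alpha> * u) / Gamma a * (t powr (a - 1) / exp t)"
          proof -
            have "- \<alpha> * (u + 1 / \<alpha> * t) = - \<alpha> * u - t" using \<alpha> by (simp add: algebra_simps)
            then have e: "exp (- \<alpha> * (u + 1 / \<alpha> * t)) = exp (- \<alpha> * u) / exp t" by (simp only: exp_diff)
            have "rl_kernel a (u + 1 / \<alpha> * t - u) = \<alpha> powr (1 - a) / Gamma a * t powr (a - 1)"
              using True \<alpha> by (simp add: rl_kernel_def powr_divide powr_diff ac_simps)
            then show ?thesis unfolding e by simp
          qed
          moreover have "0 \<le> rl_kernel a (u + 1 / \<alpha> * t - u)" by (rule rl_kernel_nonneg[OF a])
          moreover have "0 \<le> \<alpha> powr (1 - a) * exp (- \<alpha> * u) / Gamma a" using a by auto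
          ultimately show ?thesis using True by (simp add: ennreal_mult[symmetric])
        next
          case False
          then have "t < 0" using t by simp
          then have "t / \<alpha> < 0" using \<alpha> by (simp add: divide_neg_pos)
          then show ?thesis using \<open>t < 0\<close> by (simp add: rl_kernel_def)
        qed
      qed
    qed
    also have "\<dots> = ennreal (\<alpha> powr (1 - a) * exp (- \<alpha> * u) / Gamma a) * ennreal (Gamma a)"
      using nn_integral_has_integral_lebesgue'[OF _ Gamma_integral_real[OF a]]
      by (subst nn_integral_cmult) auto
    finally show ?thesis by (simp add: ennreal_mult_less_top le_less_trans)
  qed
  have dens: "\<exists>p :: real \<Rightarrow> ennreal. p \<in> borel_measurable borel \<and>
        (\<forall>x. emeasure \<nu> {x<..} = (\<integral>\<^sup>+ y. indicator {x<..} y * p y \<partial>lborel))" if "r \<in> \<int>"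
    using exp_tail_density[OF \<eta> \<alpha> ac[OF that]] unfolding \<nu> \<phi>_def .
  have F': "exp (- (l / c) * y) * F y = (C * \<alpha> powr r) * enn2real (causal_conv (rl_kernel (r + 1)) \<nu> y)" if "y > 0" for y
  proof -
    have "exp (- (l / c) * y) * F y = C * (exp (- \<alpha> * y) * measure (convolution \<eta> D) {y<..})"
      using F[of y] that by (simp add: \<alpha>_def)
    then show ?thesis unfolding tail' by simp
  qed
  note cap = weyl_caputo[OF sf sets fin pos(1) x F' dens]
  show "right_caputo_exists r (\<lambda>y. exp (- (l / c) * y) * F y) x" by (rule cap(1))
  have "gamma_op c r l F x = c powr r * (exp (\<alpha> * x) * (C * \<alpha> powr r * \<phi> x))"
    using cap(2) unfolding gamma_op_def right_frac_op_def \<nu>' by (simp add: \<alpha>_def)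
  also have "\<dots> = (c powr r * \<alpha> powr r) * C * ((exp (\<alpha> * x) * exp (- \<alpha> * x)) * measure \<eta> {x<..})"
    unfolding \<phi>_def by (simp only: ac_simps)
  also have "c powr r * \<alpha> powr r = l powr r"
    using pos by (simp add: \<alpha>_def powr_mult[symmetric])
  also have "exp (\<alpha> * x) * exp (- \<alpha> * x) = 1" by (simp add: exp_add[symmetric])
  finally show "gamma_op c r l F x = l powr r * C * measure \<eta> {x<..}" by simp
qed

section \<open>Mittag-Leffler kernels\<close>

text \<open>Euler's integral restricted to \<open>{R..R+1}\<close>. As \<open>R\<close> is free,
  Gamma outgrows every geometric sequence.\<close>

lemma Gamma_real_lower_bound:
  assumes y: "y \<ge> (1::real)" and R: "R > 0"
  shows "R powr (y - 1) * exp (- (R + 1)) \<le> Gamma y"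
proof -
  have "ennreal (R powr (y - 1) * exp (- (R + 1)))
      = (\<integral>\<^sup>+ t. ennreal (R powr (y - 1) * exp (- (R + 1))) * indicator {R..R+1} t \<partial>lborel)"
    by (subst nn_integral_cmult_indicator) auto
  also have "\<dots> \<le> (\<integral>\<^sup>+ t. ennreal (t powr (y - 1) / exp t) * indicator {0..} t \<partial>lborel)"
  proof (rule nn_integral_mono)
    fix t :: real
    have "R powr (y - 1) * exp (- (R + 1)) \<le> t powr (y - 1) / exp t" if "t \<in> {R..R+1}"
    proof -
      have "R powr (y - 1) * exp (- (R + 1)) \<le> t powr (y - 1) * exp (- t)"
        using that y R by (intro mult_mono powr_mono2) auto
      then show ?thesis by (simp add: exp_minus divide_inverse)
    qed
    then show "ennreal (R powr (y - 1) * exp (- (R + 1))) * indicator {R..R+1} t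
        \<le> ennreal (t powr (y - 1) / exp t) * indicator {0..} t"
      using R by (auto simp: indicator_def intro!: ennreal_leI)
  qed
  also have "\<dots> = ennreal (Gamma y)"
    using nn_integral_has_integral_lebesgue'[OF _ Gamma_integral_real[of y]] y by simp
  finally show ?thesis using y by (subst (asm) ennreal_le_iff) auto
qed

text \<open>The absolute value is there because the first arguments \<open>a * k + b\<close> may be
  negative; from some index on they exceed 1 and the lower bound on Gamma applies.\<close>

lemma summable_power_over_Gamma:
  fixes x a b :: real
  assumes a: "a > 0" and x: "x \<ge> 0"
  shows "summable (\<lambda>k. x ^ k / \<bar>Gamma (a * real k + b)\<bar>)"
proof -
  \<comment> \<open>Chosen so that \<open>R powr a = 2 * x + 1\<close>: the series is then dominated
    by a geometric one of ratio \<open>x / (2 * x + 1) \<le> 1 / 2\<close>.\<close>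
  define R where "R = (2 * x + 1) powr (1 / a)"
  have R: "R > 0" and Ra: "R powr a = 2 * x + 1" using a x by (auto simp: R_def powr_powr)
  have "eventually (\<lambda>k. a * real k + b \<ge> 1) sequentially"
    using a by real_asymp
  then have "eventually (\<lambda>k. norm (x ^ k / \<bar>Gamma (a * real k + b)\<bar>) \<le> exp (R + 1) * R powr (1 - b) * (1/2) ^ k) sequentially"
  proof eventually_elim
    case (elim k)
    have G: "0 < R powr (a * real k + b - 1) * exp (- (R + 1))" using R by simp
    have lb: "R powr (a * real k + b - 1) * exp (- (R + 1)) \<le> Gamma (a * real k + b)"
      using Gamma_real_lower_bound[OF elim R] .
    have "x ^ k / \<bar>Gamma (a * real k + b)\<bar> \<le> x ^ k / (R powr (a * real k + b - 1) * exp (- (R + 1)))"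
      using lb G x by (intro divide_left_mono) auto
    also have "R powr (a * real k + b - 1) = (2 * x + 1) ^ k / R powr (1 - b)"
    proof -
      have "R powr (a * real k + b - 1) = (R powr a) powr real k * R powr (- (1 - b))"
        by (simp add: powr_powr powr_add[symmetric] algebra_simps)
      then show ?thesis
        unfolding Ra powr_minus_divide[of R "1 - b"] using x by (simp add: powr_realpow)
    qed
    also have "x ^ k / ((2 * x + 1) ^ k / R powr (1 - b) * exp (- (R + 1)))
        = exp (R + 1) * R powr (1 - b) * (x / (2 * x + 1)) ^ k"
      by (simp only: exp_minus power_divide) (simp add: divide_inverse)
    also have "\<dots> \<le> exp (R + 1) * R powr (1 - b) * (1 / 2) ^ k"
      using x by (intro mult_left_mono power_mono) (auto simp: field_simps)
    finally show ?case using x by simp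
  qed
  moreover have "summable (\<lambda>k. exp (R + 1) * R powr (1 - b) * (1/2::real) ^ k)"
    by (intro summable_mult summable_geometric) simp
  ultimately show ?thesis by (rule summable_comparison_test_ev)
qed

text \<open>Order \<open>b = 0\<close> gives the Mittag-Leffler density, \<open>b = 1\<close> its distribution function.\<close>

definition ml_kernel :: "real \<Rightarrow> real \<Rightarrow> real \<Rightarrow> real \<Rightarrow> real" where
  "ml_kernel \<mu> l b z = (\<Sum>k. l * (- l) ^ k * rl_kernel (\<mu> * real k + \<mu> + b) z)"

lemma ml_kernel_measurable [measurable]: "ml_kernel \<mu> l b \<in> borel_measurable borel"
  unfolding ml_kernel_def by measurable

lemma ml_kernel_nonpos: "z \<le> 0 \<Longrightarrow> ml_kernel \<mu> l b z = 0"
  by (simp add: ml_kernel_def rl_kernel_def)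

lemma rl_kernel_power:
  assumes "z > 0"
  shows "rl_kernel (\<mu> * real k + \<mu> + b) z = z powr (\<mu> + b - 1) * ((z powr \<mu>) ^ k / Gamma (\<mu> * real k + (\<mu> + b)))"
proof -
  have "z powr (\<mu> * real k + \<mu> + b - 1) = z powr (\<mu> + b - 1) * (z powr \<mu>) powr real k"
    by (simp add: powr_powr powr_add[symmetric] algebra_simps)
  then show ?thesis using assms by (simp add: rl_kernel_def powr_realpow add.assoc)
qed

lemma summable_ml_kernel:
  assumes "\<mu> > 0" "l > 0"
  shows "summable (\<lambda>k. \<bar>l * (- l) ^ k * rl_kernel (\<mu> * real k + \<mu> + b) z\<bar>)"
proof (cases "z > 0")
  case True
  have "summable (\<lambda>k. (l * z powr (\<mu> + b - 1)) * ((l * z powr \<mu>) ^ k / \<bar>Gamma (\<mu> * real k + (\<mu> + b))\<bar>))"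
    using assms by (intro summable_mult summable_power_over_Gamma) auto
  then show ?thesis
    by (rule back_subst[where P = summable])
       (use True assms in \<open>auto simp: rl_kernel_power abs_mult power_abs power_mult_distrib fun_eq_iff\<close>)
next
  case False
  then show ?thesis by (simp add: rl_kernel_def)
qed

lemma ml_kernel_sums:
  assumes "\<mu> > 0" "l > 0"
  shows "(\<lambda>k. l * (- l) ^ k * rl_kernel (\<mu> * real k + \<mu> + b) z) sums ml_kernel \<mu> l b z"
  unfolding ml_kernel_def
  by (rule summable_sums, rule summable_rabs_cancel, rule summable_ml_kernel[OF assms])

text \<open>Split off the summand \<open>k = 0\<close>; the remaining series is the same with its
  order raised by \<mu>. At order \<open>b = 0\<close> this is the Volterra equation, at
  \<open>b = 1 - \<mu>\<close> the identity behind the inversion.\<close>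

lemma ml_kernel_recurrence:
  assumes "\<mu> > 0" "l > 0"
  shows "ml_kernel \<mu> l b z = l * rl_kernel (\<mu> + b) z - l * ml_kernel \<mu> l (\<mu> + b) z"
proof -
  let ?f = "\<lambda>k. l * (- l) ^ k * rl_kernel (\<mu> * real k + \<mu> + b) z"
  have "(\<lambda>k. ?f (Suc k)) sums (ml_kernel \<mu> l b z - ?f 0)"
    using ml_kernel_sums[OF assms, of b z] by (subst sums_Suc_iff) simp
  moreover have "(\<lambda>k. - l * (l * (- l) ^ k * rl_kernel (\<mu> * real k + \<mu> + (\<mu> + b)) z)) sums (- l * ml_kernel \<mu> l (\<mu> + b) z)"
    by (intro sums_mult ml_kernel_sums assms)
  moreover have "(\<lambda>k. ?f (Suc k)) = (\<lambda>k. - l * (l * (- l) ^ k * rl_kernel (\<mu> * real k + \<mu> + (\<mu> + b)) z))"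
    by (simp add: fun_eq_iff algebra_simps)
  ultimately show ?thesis using sums_unique2 by fastforce
qed

lemma mittag_leffler_density_eq_ml_kernel:
  "mittag_leffler_density \<mu> l z = ml_kernel \<mu> l 0 z" if "\<mu> > 0" "l > 0"
proof (cases "z > 0")
  case True
  have s: "(\<lambda>k. (- l * z powr \<mu>) ^ k / Gamma (\<mu> * real k + \<mu>)) sums mittag_leffler \<mu> \<mu> (- l * z powr \<mu>)"
    unfolding mittag_leffler_def
  proof (rule summable_sums, rule summable_rabs_cancel)
    have "summable (\<lambda>k. (l * z powr \<mu>) ^ k / \<bar>Gamma (\<mu> * real k + \<mu>)\<bar>)"
      using that by (intro summable_power_over_Gamma) auto
    then show "summable (\<lambda>k. \<bar>(- l * z powr \<mu>) ^ k / Gamma (\<mu> * real k + \<mu>)\<bar>)"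
      using that by (simp add: power_abs abs_mult)
  qed
  have "(\<lambda>k. l * z powr (\<mu> - 1) * ((- l * z powr \<mu>) ^ k / Gamma (\<mu> * real k + \<mu>)))
      = (\<lambda>k. l * (- l) ^ k * rl_kernel (\<mu> * real k + \<mu> + 0) z)"
    unfolding rl_kernel_power[OF True] by (simp add: power_mult_distrib[of "- l", symmetric] fun_eq_iff)
  then show ?thesis
    using sums_mult[OF s, of "l * z powr (\<mu> - 1)"] ml_kernel_sums[OF that, of 0 z] True
    by (simp add: mittag_leffler_density_def sums_unique2)
next
  case False
  then show ?thesis by (simp add: mittag_leffler_density_def ml_kernel_nonpos)
qed

lemma rl_kernel_convolution_real:
  assumes "a > 0" "b > 0"
  shows "integrable lborel (\<lambda>v. rl_kernel a (z - v) * rl_kernel b v)"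
    and "(LINT v|lborel. rl_kernel a (z - v) * rl_kernel b v) = rl_kernel (a + b) z"
proof -
  have "(\<integral>\<^sup>+ v. ennreal (rl_kernel a (z - v) * rl_kernel b v) \<partial>lborel) = ennreal (rl_kernel (a + b) z)"
    using rl_kernel_convolution[OF assms, of z] assms by (simp add: ennreal_mult rl_kernel_nonneg)
  then show "integrable lborel (\<lambda>v. rl_kernel a (z - v) * rl_kernel b v)"
    "(LINT v|lborel. rl_kernel a (z - v) * rl_kernel b v) = rl_kernel (a + b) z"
    using assms by (auto intro!: integrableI_nonneg simp: integral_eq_nn_integral rl_kernel_nonneg)
qed

text \<open>Termwise by the semigroup law, which adds \<open>b\<close> to each order. Sum and
  integral may be exchanged because the integrals of the absolute values form the series with all
  signs positive, which converges as well.\<close>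

lemma ml_kernel_convolution:
  assumes \<mu>: "\<mu> > 0" and l: "l > 0" and b: "b > 0"
  shows "integrable lborel (\<lambda>v. rl_kernel b (z - v) * ml_kernel \<mu> l 0 v)"
    and "(LINT v|lborel. rl_kernel b (z - v) * ml_kernel \<mu> l 0 v) = ml_kernel \<mu> l b z"
proof -
  define f where "f = (\<lambda>k v. rl_kernel b (z - v) * (l * (- l) ^ k * rl_kernel (\<mu> * real k + \<mu> + 0) v))"
  have pos: "\<mu> * real k + \<mu> > 0" for k using \<mu> by (intro add_nonneg_pos) auto
  have fi: "integrable lborel (f k)" and fe: "integral\<^sup>L lborel (f k) = l * (- l) ^ k * rl_kernel (\<mu> * real k + \<mu> + b) z" for k
    using rl_kernel_convolution_real[OF b pos[of k], of z]
    unfolding f_def by (auto simp: mult.left_commute[of "rl_kernel b _"] add.commute)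
  have fn: "norm (f k v) = l * l ^ k * (rl_kernel b (z - v) * rl_kernel (\<mu> * real k + \<mu>) v)" for k v
    unfolding f_def using l rl_kernel_nonneg[OF b] rl_kernel_nonneg[OF pos[of k]] by (simp add: abs_mult power_abs)
  have s1: "AE v in lborel. summable (\<lambda>k. norm (f k v))"
    unfolding f_def real_norm_def abs_mult[of "rl_kernel b _"]
    by (intro AE_I2 summable_mult summable_ml_kernel \<mu> l)
  have s2: "summable (\<lambda>k. LINT v|lborel. norm (f k v))"
  proof -
    have "(LINT v|lborel. norm (f k v)) = \<bar>l * (- l) ^ k * rl_kernel (\<mu> * real k + \<mu> + b) z\<bar>" for k
      unfolding fn using rl_kernel_convolution_real[OF b pos[of k], of z] l
        rl_kernel_nonneg[of "\<mu> * real k + \<mu> + b" z] pos[of k] b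
      by (simp add: abs_mult power_abs add.commute)
    then show ?thesis using summable_ml_kernel[OF \<mu> l, of b z] by simp
  qed
  have sum: "(\<Sum>k. f k v) = rl_kernel b (z - v) * ml_kernel \<mu> l 0 v" for v
    unfolding f_def ml_kernel_def
    by (rule suminf_mult) (rule sums_summable[OF ml_kernel_sums[OF \<mu> l]])
  show "integrable lborel (\<lambda>v. rl_kernel b (z - v) * ml_kernel \<mu> l 0 v)"
    using integrable_suminf[OF fi s1 s2] unfolding sum .
  show "(LINT v|lborel. rl_kernel b (z - v) * ml_kernel \<mu> l 0 v) = ml_kernel \<mu> l b z"
    using integral_suminf[OF fi s1 s2] unfolding sum fe ml_kernel_def .
qed

section \<open>Positivity of the Mittag-Leffler kernel\<close>

definition ml_entire :: "real \<Rightarrow> real \<Rightarrow> real \<Rightarrow> real" where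
  "ml_entire \<mu> l y = (\<Sum>k. (- l * y) ^ k / Gamma (\<mu> * real k + \<mu>))"

lemma ml_kernel_eq_entire:
  assumes "\<mu> > 0" "l > 0" "z > 0"
  shows "ml_kernel \<mu> l 0 z = l * z powr (\<mu> - 1) * ml_entire \<mu> l (z powr \<mu>)"
  using mittag_leffler_density_eq_ml_kernel[OF assms(1,2), of z] assms(3)
  by (simp add: mittag_leffler_density_def ml_entire_def mittag_leffler_def)

text \<open>Extends the power series factor of the kernel to an entire function, so that its zeros
  can be shown to be isolated.\<close>

lemma ml_entire_holomorphic:
  assumes "\<mu> > 0" "l > 0"
  obtains H :: "complex \<Rightarrow> complex" where "H holomorphic_on UNIV"
    "\<And>y. H (of_real y) = of_real (ml_entire \<mu> l y)"
proof -
  define a :: "nat \<Rightarrow> complex" where "a = (\<lambda>k. of_real ((- l) ^ k / Gamma (\<mu> * real k + \<mu>)))"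
  define H where "H = (\<lambda>w. \<Sum>k. a k * w ^ k)"
  have summ: "summable (\<lambda>k. norm (a k * w ^ k))" for w
  proof -
    have "summable (\<lambda>k. (l * norm w) ^ k / \<bar>Gamma (\<mu> * real k + \<mu>)\<bar>)"
      using assms by (intro summable_power_over_Gamma) auto
    then show ?thesis
      by (rule back_subst[where P = summable])
         (use assms in \<open>auto simp: a_def fun_eq_iff norm_mult norm_power norm_divide power_abs power_mult_distrib\<close>)
  qed
  have H: "(\<lambda>k. a k * w ^ k) sums H w" for w
    unfolding H_def by (rule summable_sums, rule summable_norm_cancel, rule summ)
  have hol: "H holomorphic_on ball 0 R" for R
    by (rule power_series_holomorphic[where a = a]) (use H in simp)
  have "H holomorphic_on UNIV"
  proof (rule holomorphic_on_subset)
    show "H holomorphic_on (\<Union>n. ball 0 (real n))"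
      using hol by (intro holomorphic_on_UN_open) auto
    show "UNIV \<subseteq> (\<Union>n. ball (0::complex) (real n))" using reals_Archimedean2 by (auto simp: dist_norm)
  qed
  moreover have "H (of_real y) = of_real (ml_entire \<mu> l y)" for y
  proof -
    let ?f = "\<lambda>k. (- l * y) ^ k / Gamma (\<mu> * real k + \<mu>)"
    have eq: "a k * of_real y ^ k = of_real (?f k)" for k
      unfolding a_def by (simp add: power_mult_distrib[symmetric])
    have "summable (\<lambda>k. of_real (?f k) :: complex)"
      using sums_summable[OF H[of "of_real y"]] unfolding eq .
    then have "summable ?f" by (simp only: summable_of_real_iff)
    then have "(\<lambda>k. of_real (?f k) :: complex) sums of_real (ml_entire \<mu> l y)"
      unfolding ml_entire_def by (intro sums_of_real summable_sums)
    then show ?thesis using H[of "of_real y"] unfolding eq by (rule sums_unique2[symmetric])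
  qed
  ultimately show thesis by (rule that)
qed

text \<open>
  The kernel \<open>d\<close> solves the Volterra equation \<open>d = l k - l (k * d)\<close> with \<open>k = rl_kernel \<mu>\<close>. If \<open>t0\<close> is
  the place where \<open>d\<close> first turns negative (there is such a place since zeros of analytic functions
  are isolated), then \<open>(k * d) t0 = k t0\<close>, and log-convexity of \<open>k\<close> gives \<open>(k * d) t2 \<le> k t2\<close> and
  hence \<open>d t2 \<ge> 0\<close> shortly after \<open>t0\<close>.
\<close>

lemma ml_kernel_nonneg:
  assumes \<mu>: "0 < \<mu>" "\<mu> \<le> 1" and l: "l > 0"
  shows "0 \<le> ml_kernel \<mu> l 0 t"
proof (rule ccontr)
  assume neg: "\<not> 0 \<le> ml_kernel \<mu> l 0 t"
  then have t: "t > 0" using ml_kernel_nonpos[of t \<mu> l 0] by (cases "t > 0") auto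
  let ?h = "ml_entire \<mu> l"
  let ?d = "ml_kernel \<mu> l 0"
  have d: "?d z = l * z powr (\<mu> - 1) * ?h (z powr \<mu>)" if "z > 0" for z
    by (rule ml_kernel_eq_entire[OF \<mu>(1) l that])
  have d_sign: "?d z < 0 \<longleftrightarrow> ?h (z powr \<mu>) < 0" "0 \<le> ?d z \<longleftrightarrow> 0 \<le> ?h (z powr \<mu>)"
    "?d z = 0 \<longleftrightarrow> ?h (z powr \<mu>) = 0" if z: "z > 0" for z
  proof -
    obtain m where "m > 0" and m: "?d z = m * ?h (z powr \<mu>)"
      by (rule that[of "l * z powr (\<mu> - 1)"]) (use d[OF z] z l in auto)
    then show "?d z < 0 \<longleftrightarrow> ?h (z powr \<mu>) < 0" "0 \<le> ?d z \<longleftrightarrow> 0 \<le> ?h (z powr \<mu>)"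
      "?d z = 0 \<longleftrightarrow> ?h (z powr \<mu>) = 0"
      unfolding m by (auto simp: mult_less_0_iff zero_le_mult_iff)
  qed
  obtain H where H: "H holomorphic_on UNIV" "\<And>y. H (of_real y) = of_real (?h y)"
    using ml_entire_holomorphic[OF \<mu>(1) l] by blast
  have "continuous_on UNIV (\<lambda>y. Re (H (of_real y)))"
    by (intro continuous_intros continuous_on_compose2[OF holomorphic_on_imp_continuous_on[OF H(1)]]) auto
  then have cont: "continuous_on UNIV ?h" unfolding H(2) by simp
  have h0: "?h 0 > 0"
    using \<mu> unfolding ml_entire_def by (subst suminf_finite[of "{0}"]) auto
  \<comment> \<open>The sign change is located in the variable \<open>y = z powr \<mu>\<close>,
    where the kernel is a positive factor times \<open>?h\<close>; \<open>y0\<close> will be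
    \<open>t0 powr \<mu>\<close>.\<close>
  define S where "S = {y. 0 \<le> y \<and> ?h y < 0}"
  define y0 where "y0 = Inf S"
  have "t powr \<mu> \<in> S" using neg d_sign(2)[OF t] unfolding S_def by simp
  then have S_ne: "S \<noteq> {}" by blast
  have S_bdd: "bdd_below S" unfolding S_def by (auto intro!: bdd_belowI[of _ 0])
  have y0: "y0 \<ge> 0" unfolding y0_def using S_ne by (intro cInf_greatest) (auto simp: S_def)
  have before: "?h y \<ge> 0" if "0 \<le> y" "y < y0" for y
    using that cInf_lower[OF _ S_bdd, of y] unfolding y0_def S_def by force
  have after: "\<exists>y\<in>S. y < y0 + e" if "e > 0" for e
    using cInf_lessD[OF S_ne, of "y0 + e"] that unfolding y0_def by auto
  have hc: "isCont ?h y" for y using cont by (simp add: continuous_on_eq_continuous_at)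
  have h_y0: "?h y0 = 0"
  proof (rule antisym)
    show "?h y0 \<le> 0"
    proof (rule ccontr)
      assume "\<not> ?h y0 \<le> 0"
      then have "eventually (\<lambda>y. ?h y > 0) (at y0)"
        using hc[of y0] unfolding isCont_def by (intro order_tendstoD) auto
      then obtain e where "e > 0" "\<And>y. y \<noteq> y0 \<Longrightarrow> dist y y0 < e \<Longrightarrow> ?h y > 0"
        unfolding eventually_at by auto
      moreover obtain y where "y \<in> S" "y < y0 + e" using after[OF \<open>e > 0\<close>] by blast
      moreover have "y \<ge> y0" using cInf_lower[OF \<open>y \<in> S\<close> S_bdd] unfolding y0_def .
      ultimately show False using \<open>\<not> ?h y0 \<le> 0\<close> unfolding S_def dist_real_def
        by (cases "y = y0") fastforce+
    qed
    show "0 \<le> ?h y0"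
    proof (rule ccontr)
      assume n: "\<not> 0 \<le> ?h y0"
      then have "eventually (\<lambda>y. ?h y < 0) (at y0)"
        using hc[of y0] unfolding isCont_def by (intro order_tendstoD) auto
      then obtain e where e: "e > 0" "\<And>y. y \<noteq> y0 \<Longrightarrow> dist y y0 < e \<Longrightarrow> ?h y < 0"
        unfolding eventually_at by auto
      have "y0 > 0" using n h0 y0 by (cases "y0 = 0") auto
      define y where "y = max (y0 / 2) (y0 - e / 2)"
      have "0 \<le> y" "y < y0" "dist y y0 < e" using \<open>y0 > 0\<close> e(1) by (auto simp: y_def dist_real_def)
      then show False using e(2)[of y] before[of y] by auto
    qed
  qed
  then have y0_pos: "y0 > 0" using h0 y0 by (cases "y0 = 0") auto
  \<comment> \<open>\<open>?h 0 > 0\<close> rules out that \<open>H\<close> vanishes identically.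
    Within the radius \<rho> a negative value at \<open>y2\<close> then persists on the whole
    interval from \<open>y0\<close> to \<open>y2\<close> by the intermediate value theorem.\<close>
  obtain \<rho> where \<rho>: "\<rho> > 0" "\<And>w. w \<in> ball (of_real y0) \<rho> - {of_real y0} \<Longrightarrow> H w \<noteq> 0"
  proof (rule isolated_zeros[OF H(1) open_UNIV connected_UNIV])
    show "H (of_real y0) = 0" using h_y0 H(2) by simp
    show "H (of_real 0) \<noteq> 0" unfolding H(2) using h0 by simp
  qed auto
  have nz: "?h y \<noteq> 0" if "y \<noteq> y0" "dist y y0 < \<rho>" for y
    using \<rho>(2)[of "of_real y"] that unfolding H(2)
    by (auto simp: dist_norm norm_minus_commute simp flip: of_real_diff)
  obtain y2 where y2: "y2 \<in> S" "y2 < y0 + \<rho>" using after[OF \<rho>(1)] by blast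
  have y2': "y2 > y0"
  proof -
    have "y0 \<le> y2" using cInf_lower[OF y2(1) S_bdd] unfolding y0_def .
    moreover have "y2 \<noteq> y0" using y2(1) h_y0 unfolding S_def by auto
    ultimately show ?thesis by simp
  qed
  have between: "?h y < 0" if y: "y0 < y" "y \<le> y2" for y
  proof (rule ccontr)
    assume "\<not> ?h y < 0"
    then have "?h y \<ge> 0" "?h y2 \<le> 0" using y2(1) by (auto simp: S_def)
    then obtain w where w: "y \<le> w" "w \<le> y2" "?h w = 0"
      using IVT2[of ?h y2 0 y] y hc by auto
    then show False using nz[of w] y y2(2) by (auto simp: dist_real_def)
  qed
  define t0 where "t0 = y0 powr (1 / \<mu>)"
  define t2 where "t2 = y2 powr (1 / \<mu>)"
  have t0: "t0 > 0" "t0 powr \<mu> = y0" using y0_pos \<mu> by (auto simp: t0_def powr_powr)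
  have t2: "t2 > 0" "t2 powr \<mu> = y2" using y0_pos y2' \<mu> by (auto simp: t2_def powr_powr)
  have t02: "t0 < t2" unfolding t0_def t2_def using y0_pos y2' \<mu> by (intro powr_less_mono2) auto
  have d_before: "0 \<le> ?d v" if "v < t0" for v
  proof (cases "v > 0")
    case True
    have "v powr \<mu> < t0 powr \<mu>" using that True \<mu> by (intro powr_less_mono2) auto
    then show ?thesis using d_sign(2)[OF True] before[of "v powr \<mu>"] t0 by simp
  qed (simp add: ml_kernel_nonpos)
  have d_between: "?d v < 0" if "t0 < v" "v \<le> t2" for v
  proof -
    have "t0 powr \<mu> < v powr \<mu>" using that t0 \<mu> by (intro powr_less_mono2) auto
    moreover have "v powr \<mu> \<le> t2 powr \<mu>" using that t0 \<mu> by (intro powr_mono2) auto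
    ultimately show ?thesis using d_sign(1)[of v] between[of "v powr \<mu>"] t0 t2 that by simp
  qed
  have d_t0: "?d t0 = 0" using d_sign(3)[OF t0(1)] t0(2) h_y0 by simp
  let ?k = "rl_kernel \<mu>"
  have volterra: "?d z = l * ?k z - l * (LINT v|lborel. ?k (z - v) * ?d v)" for z
    using ml_kernel_recurrence[OF \<mu>(1) l, of 0 z] ml_kernel_convolution(2)[OF \<mu>(1) l \<mu>(1), of z] by simp
  have k_pos: "?k z > 0" if "z > 0" for z using that \<mu> by (simp add: rl_kernel_def)
  have int_t0: "(LINT v|lborel. ?k (t0 - v) * ?d v) = ?k t0"
    using volterra[of t0] l d_t0 by simp
  \<comment> \<open>For \<open>0 < v < t0\<close> the kernel ratio is compared through
    \<open>t2 * (t0 - v) \<le> (t2 - v) * t0\<close>, reversed by the exponent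
    \<open>\<mu> - 1 \<le> 0\<close>, and \<open>?d v\<close> is nonnegative. Beyond
    \<open>t0\<close> the right side vanishes while the left side is nonpositive or zero.\<close>
  have le: "?k (t2 - v) * ?d v \<le> ?k t2 / ?k t0 * (?k (t0 - v) * ?d v)" for v
  proof -
    consider "v \<le> 0" | "0 < v" "v < t0" | "v = t0" | "t0 < v" "v \<le> t2" | "t2 < v" by linarith
    then show ?thesis
    proof cases
      case 2
      have "(t2 - v) powr (\<mu> - 1) * t0 powr (\<mu> - 1) = ((t2 - v) * t0) powr (\<mu> - 1)"
        using 2 t02 t0 by (simp add: powr_mult)
      also have "\<dots> \<le> (t2 * (t0 - v)) powr (\<mu> - 1)"
      proof (rule powr_mono2')
        show "0 < t2 * (t0 - v)" using 2 t2 by simp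
        show "t2 * (t0 - v) \<le> (t2 - v) * t0" using 2 t02 by (simp add: algebra_simps)
      qed (use \<mu> in auto)
      also have "\<dots> = t2 powr (\<mu> - 1) * (t0 - v) powr (\<mu> - 1)"
        using 2 t2 by (simp add: powr_mult)
      finally have "?k (t2 - v) * ?k t0 \<le> ?k t2 * ?k (t0 - v)"
        using 2 t02 t0 t2 \<mu> by (simp add: rl_kernel_def divide_right_mono)
      then have "?k (t2 - v) \<le> ?k t2 / ?k t0 * ?k (t0 - v)"
        using k_pos[OF t0(1)] by (simp add: field_simps)
      then show ?thesis using d_before[OF 2(2)] by (metis mult.assoc mult_right_mono)
    next
      case 4
      then show ?thesis using d_between[OF 4] rl_kernel_nonneg[OF \<mu>(1), of "t2 - v"]
        by (simp add: rl_kernel_def[of _ "t0 - v"] mult_nonneg_nonpos)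
    qed (use d_t0 t02 in \<open>auto simp: ml_kernel_nonpos rl_kernel_def\<close>)
  qed
  have "(LINT v|lborel. ?k (t2 - v) * ?d v) \<le> (LINT v|lborel. ?k t2 / ?k t0 * (?k (t0 - v) * ?d v))"
    by (intro integral_mono integrable_mult_right ml_kernel_convolution(1) \<mu> l le)
  also have "\<dots> = ?k t2" using int_t0 k_pos[OF t0(1)] by simp
  finally have "?d t2 \<ge> 0" using volterra[of t2] l by (simp add: mult_left_mono)
  then show False using d_between[of t2] t02 by simp
qed

section \<open>Inversion of the Mittag-Leffler phases\<close>

text \<open>A Mittag-Leffler variable scaled by \<open>c\<close> is again Mittag-Leffler, with rate
  \<open>l / c powr \<mu>\<close>: every summand scales by the power of \<open>c\<close> that this
  rate absorbs.\<close>

lemma ml_kernel_scale: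
  assumes \<mu>: "\<mu> > 0" and l: "l > 0" and c: "c > 0"
  shows "ml_kernel \<mu> l 0 (z / c) = c * ml_kernel \<mu> (l / c powr \<mu>) 0 z"
proof -
  let ?L = "l / c powr \<mu>"
  have "l * (- l) ^ k * rl_kernel (\<mu> * real k + \<mu> + 0) (z / c)
      = c * (?L * (- ?L) ^ k * rl_kernel (\<mu> * real k + \<mu> + 0) z)" for k
  proof -
    have rl: "rl_kernel a (z / c) = c powr (1 - a) * rl_kernel a z" for a
      using c by (auto simp: rl_kernel_def powr_divide powr_diff zero_less_divide_iff field_simps)
    have "c powr (1 - (\<mu> * real k + \<mu> + 0)) = c / ((c powr \<mu>) ^ k * c powr \<mu>)"
      using c by (simp add: powr_diff powr_add powr_powr[symmetric] powr_realpow)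
    moreover have "(- ?L) ^ k = (- l) ^ k / (c powr \<mu>) ^ k"
      by (simp add: power_divide[symmetric])
    ultimately show ?thesis unfolding rl by (simp add: ac_simps)
  qed
  then have eq: "(\<lambda>k. l * (- l) ^ k * rl_kernel (\<mu> * real k + \<mu> + 0) (z / c))
      = (\<lambda>k. c * (?L * (- ?L) ^ k * rl_kernel (\<mu> * real k + \<mu> + 0) z))" by blast
  have "(\<lambda>k. l * (- l) ^ k * rl_kernel (\<mu> * real k + \<mu> + 0) (z / c)) sums (c * ml_kernel \<mu> ?L 0 z)"
    unfolding eq using assms by (intro sums_mult ml_kernel_sums) auto
  then show ?thesis unfolding ml_kernel_def by (rule sums_unique[symmetric])
qed

lemma ml_kernel_convolution_nn:
  assumes \<mu>: "0 < \<mu>" "\<mu> \<le> 1" and l: "l > 0" and b: "b > 0"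
  shows "(\<integral>\<^sup>+ v. ennreal (rl_kernel b (z - v)) * ennreal (ml_kernel \<mu> l 0 v) \<partial>lborel) = ennreal (ml_kernel \<mu> l b z)"
proof -
  have nn: "0 \<le> rl_kernel b (z - v) * ml_kernel \<mu> l 0 v" for v
    using rl_kernel_nonneg[OF b] ml_kernel_nonneg[OF \<mu> l] by simp
  have "(\<integral>\<^sup>+ v. ennreal (rl_kernel b (z - v)) * ennreal (ml_kernel \<mu> l 0 v) \<partial>lborel)
      = (\<integral>\<^sup>+ v. ennreal (rl_kernel b (z - v) * ml_kernel \<mu> l 0 v) \<partial>lborel)"
    using rl_kernel_nonneg[OF b] ml_kernel_nonneg[OF \<mu> l] by (simp add: ennreal_mult)
  also have "\<dots> = ennreal (ml_kernel \<mu> l b z)"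
    using nn_integral_eq_integral[OF ml_kernel_convolution(1)[OF \<mu>(1) l b, of z]] nn
    by (simp add: ml_kernel_convolution(2)[OF \<mu>(1) l b])
  finally show ?thesis .
qed

text \<open>Let \<open>f\<close> be the tail of \<eta>, \<open>h\<close> that of the shifted law,
  and \<open>d\<close>, \<open>G\<close> the density and distribution function of the scaled phase.
  Then \<open>h\<close> integrates \<open>G (t - x)\<close> over \<eta>, and minus its derivative
  integrates \<open>d\<close>. The Caputo weight of order \<open>1 - \<mu>\<close> takes
  \<open>d\<close> to \<open>L * (1 - G)\<close> on the positive axis, so the Caputo derivative of
  \<open>h\<close> is \<open>L * (f - h)\<close>; as \<open>c powr \<mu> * L = l\<close>, adding
  \<open>l * h\<close> leaves \<open>l * f\<close>.\<close>

lemma ml_op_tail: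
  fixes \<eta> D :: "real measure" and F :: "real \<Rightarrow> real"
  assumes \<eta>: "real_distribution \<eta>" and \<mu>: "0 < \<mu>" "\<mu> \<le> 1" and l: "l > 0" and c: "c > 0" and x: "x \<ge> 0"
    and D: "D = distr (density lborel (\<lambda>y. ennreal (mittag_leffler_density \<mu> l y))) borel (\<lambda>y. - (c * y))"
    and D_prob: "real_distribution D"
    and F: "\<And>y. y \<ge> 0 \<Longrightarrow> F y = C * measure (convolution \<eta> D) {y<..}"
    and ac: "\<mu> \<in> \<int> \<Longrightarrow> absolutely_continuous lborel \<eta>"
  shows "right_caputo_exists \<mu> F x"
    and "ml_op c \<mu> l F x = l * C * measure \<eta> {x<..}"
proof -
  interpret \<eta>: real_distribution \<eta> by fact
  interpret D: real_distribution D by fact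
  interpret \<eta>D: real_distribution "convolution \<eta> D" by (rule real_distribution_convolution) fact+
  define L where "L = l / c powr \<mu>"
  have L: "L > 0" using l c by (simp add: L_def)
  define d where "d = ml_kernel \<mu> L 0"
  define G where "G = ml_kernel \<mu> L 1"
  define f where "f = (\<lambda>y. measure \<eta> {y<..})"
  define h where "h = (\<lambda>y. measure (convolution \<eta> D) {y<..})"
  have dm [measurable]: "d \<in> borel_measurable borel" and Gm [measurable]: "G \<in> borel_measurable borel"
    unfolding d_def G_def by simp_all
  have mlm [measurable]: "mittag_leffler_density \<mu> l \<in> borel_measurable borel"
    unfolding mittag_leffler_density_eq_ml_kernel[OF \<mu>(1) l, abs_def] by simp
  have d_nn: "0 \<le> d z" for z unfolding d_def by (rule ml_kernel_nonneg[OF \<mu> L])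
  have d_scale: "mittag_leffler_density \<mu> l (z / c) = c * d z" for z
    unfolding mittag_leffler_density_eq_ml_kernel[OF \<mu>(1) l] d_def L_def
    by (rule ml_kernel_scale[OF \<mu>(1) l c])
  have sf: "sigma_finite_measure \<eta>" by (rule \<eta>.sigma_finite_measure_axioms)
  have sets: "sets \<eta> = sets borel" by simp
  \<comment> \<open>Read off from \<open>D\<close> being a probability law. It yields
    \<open>G \<le> 1\<close> without any asymptotics of the Mittag-Leffler function.\<close>
  have mass: "(\<integral>\<^sup>+ y. ennreal (d y) \<partial>lborel) = 1"
  proof -
    have "1 = emeasure D (space D)" by (rule D.emeasure_space_1[symmetric])
    also have "\<dots> = (\<integral>\<^sup>+ y. ennreal (mittag_leffler_density \<mu> l y) \<partial>lborel)"
      unfolding D by (simp add: emeasure_distr emeasure_density)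
    also have "\<dots> = ennreal \<bar>1 / c\<bar> * (\<integral>\<^sup>+ z. ennreal (mittag_leffler_density \<mu> l (0 + 1 / c * z)) \<partial>lborel)"
      by (rule nn_integral_real_affine) (use c in auto)
    also have "\<dots> = ennreal (1 / c) * (\<integral>\<^sup>+ z. ennreal c * ennreal (d z) \<partial>lborel)"
      using c d_nn by (simp add: d_scale ennreal_mult)
    also have "\<dots> = ennreal (1 / c) * ennreal c * (\<integral>\<^sup>+ z. ennreal (d z) \<partial>lborel)"
      by (subst nn_integral_cmult) (auto simp: mult.assoc)
    also have "ennreal (1 / c) * ennreal c = 1" using c by (simp add: ennreal_mult[symmetric])
    finally show ?thesis by simp
  qed
  have conv: "(\<integral>\<^sup>+ v. ennreal (rl_kernel b (z - v)) * ennreal (d v) \<partial>lborel) = ennreal (ml_kernel \<mu> L b z)" if "b > 0" for b z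
    unfolding d_def by (rule ml_kernel_convolution_nn[OF \<mu> L that])
  have conv': "(\<integral>\<^sup>+ v. ennreal (d (z - v)) * ennreal (rl_kernel 1 v) \<partial>lborel) = ennreal (G z)" for z
  proof -
    have "(\<integral>\<^sup>+ v. ennreal (d (z - v)) * ennreal (rl_kernel 1 v) \<partial>lborel)
       = ennreal \<bar>- 1\<bar> * (\<integral>\<^sup>+ v. ennreal (d (z - (z + - 1 * v))) * ennreal (rl_kernel 1 (z + - 1 * v)) \<partial>lborel)"
      by (rule nn_integral_real_affine) auto
    then show ?thesis using conv[of 1 z] by (simp add: G_def mult.commute)
  qed
  have G_nn: "0 \<le> G z" for z
  proof -
    have "G z = (LINT v|lborel. rl_kernel 1 (z - v) * d v)"
      unfolding G_def d_def by (rule ml_kernel_convolution(2)[symmetric, OF \<mu>(1) L]) simp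
    then show ?thesis using d_nn by (simp add: integral_nonneg rl_kernel_nonneg)
  qed
  have G_le: "G z \<le> rl_kernel 1 z" for z
  proof (cases "z > 0")
    case True
    have "ennreal (G z) = (\<integral>\<^sup>+ v. ennreal (rl_kernel 1 (z - v)) * ennreal (d v) \<partial>lborel)"
      using conv[of 1 z] by (simp add: G_def)
    also have "\<dots> \<le> (\<integral>\<^sup>+ v. ennreal (d v) \<partial>lborel)"
      by (intro nn_integral_mono) (auto simp: rl_kernel_1 indicator_def)
    finally show ?thesis using True G_nn by (simp add: mass rl_kernel_1)
  qed (simp add: G_def ml_kernel_nonpos rl_kernel_1)
  have one: "causal_conv (rl_kernel 1) \<eta> u = ennreal (f u)" for u
    using causal_conv_rl_kernel_1[OF sets, of u] by (simp add: f_def \<eta>.emeasure_eq_measure)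
  have [measurable]: "(\<lambda>y. emeasure \<eta> {y<..}) \<in> borel_measurable borel"
    unfolding \<eta>.emeasure_eq_measure by simp
  have tail: "causal_conv G \<eta> u = ennreal (h u)" for u
  proof -
    have "ennreal (h u) = (\<integral>\<^sup>+ y. emeasure \<eta> {u - y<..} \<partial>D)"
      using emeasure_convolution_Ioi[OF \<eta> D_prob, of u] by (simp add: h_def \<eta>D.emeasure_eq_measure)
    also have "\<dots> = (\<integral>\<^sup>+ y. ennreal (mittag_leffler_density \<mu> l y) * emeasure \<eta> {u + c * y<..} \<partial>lborel)"
      unfolding D by (subst nn_integral_distr) (auto simp: nn_integral_density)
    also have "\<dots> = ennreal \<bar>1 / c\<bar> * (\<integral>\<^sup>+ v. ennreal (mittag_leffler_density \<mu> l (- u / c + 1 / c * v))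
           * emeasure \<eta> {u + c * (- u / c + 1 / c * v)<..} \<partial>lborel)"
      by (rule nn_integral_real_affine) (use c in auto)
    also have "(\<integral>\<^sup>+ v. ennreal (mittag_leffler_density \<mu> l (- u / c + 1 / c * v))
           * emeasure \<eta> {u + c * (- u / c + 1 / c * v)<..} \<partial>lborel)
        = (\<integral>\<^sup>+ v. ennreal c * (ennreal (d (v - u)) * causal_conv (rl_kernel 1) \<eta> v) \<partial>lborel)"
    proof (rule nn_integral_cong)
      fix v
      have a1: "- u / c + 1 / c * v = (v - u) / c" by (simp add: diff_divide_distrib)
      have a2: "u + c * ((v - u) / c) = v" using c by simp
      show "ennreal (mittag_leffler_density \<mu> l (- u / c + 1 / c * v))
           * emeasure \<eta> {u + c * (- u / c + 1 / c * v)<..}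
         = ennreal c * (ennreal (d (v - u)) * causal_conv (rl_kernel 1) \<eta> v)"
        unfolding a1 a2 d_scale one using c d_nn
        by (simp add: ennreal_mult f_def \<eta>.emeasure_eq_measure mult.assoc)
    qed
    also have "\<dots> = ennreal c * (\<integral>\<^sup>+ v. ennreal (d (v - u)) * causal_conv (rl_kernel 1) \<eta> v \<partial>lborel)"
      by (rule nn_integral_cmult) (use causal_conv_measurable[OF _ sf sets] in measurable)
    also have "(\<integral>\<^sup>+ v. ennreal (d (v - u)) * causal_conv (rl_kernel 1) \<eta> v \<partial>lborel) = causal_conv G \<eta> u"
      by (rule causal_conv_comp[OF _ _ sf sets conv']) auto
    also have "ennreal \<bar>1 / c\<bar> * (ennreal c * causal_conv G \<eta> u) = causal_conv G \<eta> u"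
      using c by (simp add: mult.assoc[symmetric] ennreal_mult[symmetric])
    finally show ?thesis by simp
  qed
  define Q where "Q = causal_conv d \<eta>"
  have Qm [measurable]: "Q \<in> borel_measurable borel"
    unfolding Q_def by (rule causal_conv_measurable[OF _ sf sets]) simp
  have Q1: "(\<integral>\<^sup>+ y. indicator {u<..} y * Q y \<partial>lborel) = ennreal (h u)" for u
  proof -
    have "(\<integral>\<^sup>+ y. ennreal (rl_kernel 1 (y - u)) * Q y \<partial>lborel) = causal_conv G \<eta> u"
      unfolding Q_def G_def by (rule causal_conv_comp[OF _ _ sf sets conv]) auto
    then show ?thesis by (simp add: ennreal_indicator_rl tail)
  qed
  have fh: "h u \<le> f u" for u
  proof -
    have "causal_conv G \<eta> u \<le> causal_conv (rl_kernel 1) \<eta> u"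
      unfolding causal_conv_def by (intro nn_integral_mono ennreal_leI G_le)
    then show ?thesis unfolding one tail by (simp add: f_def)
  qed
  \<comment> \<open>The recurrence subtracts, which \<open>ennreal\<close> does not do faithfully,
    so \<open>L * h u\<close> is added on both sides and cancelled as a finite quantity.\<close>
  have rest: "causal_conv (ml_kernel \<mu> L (1 - \<mu>)) \<eta> u = ennreal (L * (f u - h u))" for u
  proof -
    let ?A = "causal_conv (ml_kernel \<mu> L (1 - \<mu>)) \<eta> u"
    have k: "ml_kernel \<mu> L (1 - \<mu>) z = L * (rl_kernel 1 z - G z)" for z
      using ml_kernel_recurrence[OF \<mu>(1) L, of "1 - \<mu>" z] by (simp add: G_def right_diff_distrib)
    have "?A + ennreal L * causal_conv G \<eta> u
        = (\<integral>\<^sup>+ t. ennreal (ml_kernel \<mu> L (1 - \<mu>) (t - u)) + ennreal L * ennreal (G (t - u)) \<partial>\<eta>)"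
      unfolding causal_conv_def by (subst nn_integral_add) (auto simp: nn_integral_cmult)
    also have "\<dots> = (\<integral>\<^sup>+ t. ennreal L * ennreal (rl_kernel 1 (t - u)) \<partial>\<eta>)"
    proof (rule nn_integral_cong)
      fix t
      have "ennreal (ml_kernel \<mu> L (1 - \<mu>) (t - u)) + ennreal L * ennreal (G (t - u))
          = ennreal (L * (rl_kernel 1 (t - u) - G (t - u)) + L * G (t - u))"
        unfolding k using L G_nn G_le by (subst ennreal_plus) (auto simp: ennreal_mult)
      also have "\<dots> = ennreal (L * rl_kernel 1 (t - u))" by (simp add: algebra_simps)
      finally show "ennreal (ml_kernel \<mu> L (1 - \<mu>) (t - u)) + ennreal L * ennreal (G (t - u))
          = ennreal L * ennreal (rl_kernel 1 (t - u))"
        using L by (simp add: ennreal_mult rl_kernel_nonneg)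
    qed
    also have "\<dots> = ennreal L * ennreal (f u)"
      unfolding one[symmetric] causal_conv_def by (rule nn_integral_cmult) simp
    finally have "?A + ennreal (L * h u) = ennreal (L * f u)"
      using L by (simp add: tail ennreal_mult h_def f_def)
    then have "?A = ennreal (L * f u) - ennreal (L * h u)"
      by (metis ennreal_add_diff_cancel_right ennreal_neq_top)
    then show ?thesis using L by (simp add: ennreal_minus h_def right_diff_distrib)
  qed
  have F0: "F y = C * h y" if "0 < y" for y using F[of y] that by (simp add: h_def)
  have h_tail: "set_integrable lborel {y<..} (\<lambda>y. enn2real (Q y))" "h y = (LINT t:{y<..}|lborel. enn2real (Q t))" for y
    using tail_integral_real[of Q y] by (simp_all add: Q1 h_def)
  have main: "right_caputo_exists \<mu> F x \<and> right_caputo \<mu> F x = C * (L * (f x - h x))"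
  proof (cases "\<mu> = 1")
    case False
    then have \<mu>1: "\<mu> < 1" using \<mu> by simp
    then have N: "caputo_order \<mu> = 1" using \<mu> by (simp add: caputo_order_def floor_eq_iff)
    define q where "q = (\<lambda>y. C * enn2real (Q y))"
    have "(\<integral>\<^sup>+ y. ennreal (rl_kernel (1 - \<mu>) (y - x)) * Q y \<partial>lborel) = causal_conv (ml_kernel \<mu> L (1 - \<mu>)) \<eta> x"
      unfolding Q_def by (rule causal_conv_comp[OF _ _ sf sets conv]) (use \<mu>1 in auto)
    then have w: "integrable lborel (\<lambda>y. rl_kernel (1 - \<mu>) (y - x) * enn2real (Q y))"
      "(LINT y|lborel. rl_kernel (1 - \<mu>) (y - x) * enn2real (Q y)) = L * (f x - h x)"
      using nn_integral_weighted_real[of "\<lambda>y. rl_kernel (1 - \<mu>) (y - x)" Q] \<mu>1 L fh[of x]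
      by (auto simp: rl_kernel_nonneg rest)
    have \<Gamma>: "Gamma (1 - \<mu>) > 0" using \<mu>1 by simp
    have wq: "indicator {x<..} y *\<^sub>R ((y - x) powr (- \<mu>) * q y)
        = (C * Gamma (1 - \<mu>)) * (rl_kernel (1 - \<mu>) (y - x) * enn2real (Q y))" for y
      using \<Gamma> by (auto simp: q_def rl_kernel_def indicator_def)
    have qi: "set_integrable lborel {x<..} (\<lambda>y. (y - x) powr (- \<mu>) * q y)"
      and qe: "(LINT y:{x<..}|lborel. (y - x) powr (- \<mu>) * q y) = C * Gamma (1 - \<mu>) * (L * (f x - h x))"
      unfolding set_integrable_def set_lebesgue_integral_def wq using w by auto
    have qm: "q \<in> borel_measurable borel" unfolding q_def by simp
    have qti: "set_integrable lborel {y<..} q" for y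
      unfolding q_def using h_tail(1) by (intro set_integrable_mult_right)
    have last: "C * h y = (LINT t:{y<..}|lborel. q t)" for y
      unfolding q_def h_tail(2) by simp
    note cap = right_caputo_eqI[where D = "\<lambda>_ y. C * h y" and a = 0 and q = q and x = x and r = \<mu> and F = F,
        unfolded N, OF F0 _ qm qti last x, simplified, OF qi]
    show ?thesis using cap \<Gamma> unfolding qe by simp
  next
    \<comment> \<open>The exponential case: \<open>caputo_order 1 = 2\<close>, so the Caputo
      integral only undoes a second derivative. Since the order \<open>1 - \<mu>\<close> is 0, the
      identity \<open>rest\<close> already gives \<open>h' = - L * (f - h)\<close>, and
      differentiating once more calls for the density \<open>p\<close> of \<eta>.\<close>
    case True
    have N: "caputo_order \<mu> = 2" using True by (simp add: caputo_order_def)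
    define p where "p = RN_deriv lborel \<eta>"
    have pm [measurable]: "p \<in> borel_measurable borel" unfolding p_def by simp
    have dens: "density lborel p = \<eta>"
      unfolding p_def using True ac
      by (intro sigma_finite_measure.density_RN_deriv[OF sigma_finite_lborel]) auto
    have p1: "(\<integral>\<^sup>+ y. indicator {u<..} y * p y \<partial>lborel) = ennreal (f u)" for u
    proof -
      have "ennreal (f u) = emeasure (density lborel p) {u<..}"
        unfolding dens by (simp add: f_def \<eta>.emeasure_eq_measure)
      then show ?thesis by (simp add: emeasure_density mult.commute)
    qed
    have f_tail: "set_integrable lborel {y<..} (\<lambda>y. enn2real (p y))" "f y = (LINT t:{y<..}|lborel. enn2real (p t))" for y
      using tail_integral_real[of p y] by (simp_all add: p1 f_def)
    have Qe: "enn2real (Q y) = L * (f y - h y)" for y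
      using rest[of y] True L fh[of y] by (simp add: Q_def d_def)
    have cont: "isCont (\<lambda>y. enn2real (Q y)) y" for y
      unfolding Qe using tail_integral_isCont[OF _ f_tail, of y] tail_integral_isCont[OF _ h_tail, of y]
      by (auto intro!: continuous_intros)
    have h_deriv: "(h has_field_derivative - (L * (f y - h y))) (at y)" for y
    proof -
      have m: "(\<lambda>y. enn2real (Q y)) \<in> borel_measurable borel" by simp
      show ?thesis using tail_integral_DERIV[OF m h_tail cont, of y] unfolding Qe .
    qed
    define D' where "D' = (\<lambda>k::nat. if k = 0 then (\<lambda>y. C * h y) else (\<lambda>y. - (C * L) * (f y - h y)))"
    define q where "q = (\<lambda>y. - (C * L) * (enn2real (p y) - enn2real (Q y)))"
    have step: "(D' k has_field_derivative D' (Suc k) y) (at y)" if "k < 2 - 1" for k y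
      using that DERIV_cmult[OF h_deriv[of y], of C] by (simp add: D'_def mult.assoc)
    have qm: "q \<in> borel_measurable borel" unfolding q_def by simp
    have qti: "set_integrable lborel {y<..} q" for y
      unfolding q_def using h_tail(1) f_tail(1) by (intro set_integrable_mult_right set_integral_diff)
    have last: "D' (2 - 1) y = (LINT t:{y<..}|lborel. q t)" for y
    proof -
      have "(LINT t:{y<..}|lborel. q t) = - (C * L) * (LINT t:{y<..}|lborel. enn2real (p t) - enn2real (Q t))"
        unfolding q_def by (rule set_integral_mult_right)
      also have "\<dots> = - (C * L) * (f y - h y)"
        unfolding f_tail(2) h_tail(2) by (subst set_integral_diff(2)[OF f_tail(1) h_tail(1)]) simp
      finally show ?thesis by (simp add: D'_def)
    qed
    have pw: "indicator {x<..} y *\<^sub>R ((y - x) powr (real 2 - 1 - 1) * q y) = indicator {x<..} y *\<^sub>R q y" for y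
      by (auto simp: indicator_def)
    have qi: "set_integrable lborel {x<..} (\<lambda>y. (y - x) powr (real 2 - 1 - 1) * q y)"
      and qe: "(LINT y:{x<..}|lborel. (y - x) powr (real 2 - 1 - 1) * q y) = - (C * L) * (f x - h x)"
      using qti[of x] last[of x] unfolding set_integrable_def set_lebesgue_integral_def pw by (auto simp: D'_def)
    have F1: "F y = D' 0 y" if "0 < y" for y using F0[OF that] by (simp add: D'_def)
    note cap = right_caputo_eqI[where D = D' and a = 0 and q = q and x = x and r = \<mu> and F = F,
        unfolded N[unfolded True] True, OF F1 step qm qti last x qi]
    show ?thesis unfolding True using cap qe by simp
  qed
  then show "right_caputo_exists \<mu> F x" by simp
  have "ml_op c \<mu> l F x = c powr \<mu> * (C * (L * (f x - h x))) + l * (C * h x)"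
    unfolding ml_op_def using main F[OF x] by (simp add: h_def)
  also have "\<dots> = (c powr \<mu> * L) * C * (f x - h x) + l * C * h x" by (simp add: algebra_simps)
  also have "c powr \<mu> * L = l" using c by (simp add: L_def)
  finally show "ml_op c \<mu> l F x = l * C * measure \<eta> {x<..}"
    by (simp add: f_def algebra_simps)
qed

section \<open>Suprema of random walks with negative drift\<close>

text \<open>The largest of the partial sums of orders 0 to \<open>n\<close>, by recursion on the
  first step: prepending a step then acts as \<open>max 0 (s + _)\<close>, matching the invariance
  of an i.i.d. sequence under prepending.\<close>

primrec walk_max :: "nat \<Rightarrow> (nat \<Rightarrow> real) \<Rightarrow> real" where
  "walk_max 0 x = 0"
| "walk_max (Suc n) x = max 0 (x 0 + walk_max n (\<lambda>i. x (Suc i)))"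

lemma walk_max_nonneg: "0 \<le> walk_max n x"
  by (cases n) auto

lemma walk_max_mono: "walk_max n x \<le> walk_max (Suc n) x"
proof (induction n arbitrary: x)
  case (Suc n)
  have "max 0 (x 0 + walk_max n (\<lambda>i. x (Suc i))) \<le> max 0 (x 0 + walk_max (Suc n) (\<lambda>i. x (Suc i)))"
    by (intro max.mono add_left_mono Suc order.refl)
  then show ?case by (simp only: walk_max.simps(2)[of "Suc n" x] walk_max.simps(2)[of n x])
qed simp

lemma incseq_walk_max: "incseq (\<lambda>n. walk_max n x)"
  by (intro incseq_SucI walk_max_mono)

lemma walk_max_gt_iff:
  assumes "u \<ge> 0"
  shows "u < walk_max n x \<longleftrightarrow> (\<exists>k\<in>{1..n}. u < (\<Sum>i<k. x i))"
  using assms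
proof (induction n arbitrary: x u)
  case (Suc n)
  have ex: "(\<exists>k\<in>{1..Suc n}. u < (\<Sum>i<k. x i)) \<longleftrightarrow> (\<exists>k\<in>{0..n}. u < x 0 + (\<Sum>i<k. x (Suc i)))" (is "?L = ?R")
  proof -
    have "{1..Suc n} = Suc ` {0..n}" by (simp add: image_Suc_atLeastAtMost)
    moreover have "(\<exists>k\<in>Suc ` {0..n}. P k) \<longleftrightarrow> (\<exists>k\<in>{0..n}. P (Suc k))" for P by blast
    ultimately show ?thesis by (simp only: sum.lessThan_Suc_shift)
  qed
  show ?case
  proof (cases "u < x 0")
    case True
    then have ?R by (intro bexI[of _ 0]) auto
    moreover have "u < x 0 + walk_max n (\<lambda>i. x (Suc i))"
      using True walk_max_nonneg[of n "\<lambda>i. x (Suc i)"] by simp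
    ultimately show ?thesis using ex by simp
  next
    case False
    then have "u < walk_max (Suc n) x \<longleftrightarrow> u - x 0 < walk_max n (\<lambda>i. x (Suc i))"
      using Suc.prems by auto
    also have "\<dots> \<longleftrightarrow> (\<exists>k\<in>{1..n}. u - x 0 < (\<Sum>i<k. x (Suc i)))"
      using False by (intro Suc.IH) simp
    also have "\<dots> \<longleftrightarrow> ?R"
    proof
      assume ?R
      then obtain k where k: "k \<le> n" "u < x 0 + (\<Sum>i<k. x (Suc i))" by auto
      with False have "k \<noteq> 0" by (cases k) auto
      with k show "\<exists>k\<in>{1..n}. u - x 0 < (\<Sum>i<k. x (Suc i))" by (intro bexI[of _ k]) auto
    next
      assume "\<exists>k\<in>{1..n}. u - x 0 < (\<Sum>i<k. x (Suc i))"
      then obtain k where "k \<in> {1..n}" "u - x 0 < (\<Sum>i<k. x (Suc i))" by blast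
      then show ?R by (intro bexI[of _ k]) auto
    qed
    finally show ?thesis using ex by simp
  qed
qed simp

definition walk_sup :: "(nat \<Rightarrow> real) \<Rightarrow> ereal" where
  "walk_sup x = (SUP n. ereal (walk_max n x))"

lemma walk_sup_gt_iff:
  assumes "u \<ge> 0"
  shows "ereal u < walk_sup x \<longleftrightarrow> (\<exists>k\<ge>1. u < (\<Sum>i<k. x i))"
proof -
  have "ereal u < walk_sup x \<longleftrightarrow> (\<exists>n. u < walk_max n x)"
    unfolding walk_sup_def less_SUP_iff by simp
  also have "\<dots> \<longleftrightarrow> (\<exists>n. \<exists>k\<in>{1..n}. u < (\<Sum>i<k. x i))"
    unfolding walk_max_gt_iff[OF assms] ..
  also have "\<dots> \<longleftrightarrow> (\<exists>k\<ge>1. u < (\<Sum>i<k. x i))"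
    by (meson atLeastAtMost_iff order.refl)
  finally show ?thesis .
qed

lemma walk_sup_nonneg: "0 \<le> walk_sup x"
  unfolding walk_sup_def by (rule SUP_upper2[of 0]) auto

lemma walk_max_le: "(\<And>i. x i \<le> y i) \<Longrightarrow> walk_max n x \<le> walk_max n y"
proof (induction n arbitrary: x y)
  case (Suc n)
  then show ?case unfolding walk_max.simps by (intro max.mono add_mono order.refl Suc)
qed simp

lemma walk_sup_le: "(\<And>i. x i \<le> y i) \<Longrightarrow> walk_sup x \<le> walk_sup y"
  unfolding walk_sup_def by (intro SUP_mono) (auto intro!: walk_max_le)

lemma walk_max_case_nat: "walk_max (Suc n) (case_nat s x) = max 0 (s + walk_max n x)"
  by simp

text \<open>The Lindley-type identity, obtained by letting \<open>n\<close> grow in the finite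
  version: both \<open>max 0\<close> and the addition of a real number commute with the
  supremum.\<close>

lemma walk_sup_case_nat: "walk_sup (case_nat s x) = max 0 (ereal s + walk_sup x)"
proof -
  have "walk_sup (case_nat s x) = (SUP n. ereal (walk_max (Suc n) (case_nat s x)))"
    unfolding walk_sup_def
  proof (rule antisym)
    show "(SUP n. ereal (walk_max n (case_nat s x))) \<le> (SUP n. ereal (walk_max (Suc n) (case_nat s x)))"
    proof (rule SUP_mono)
      fix n :: nat
      show "\<exists>m\<in>UNIV. ereal (walk_max n (case_nat s x)) \<le> ereal (walk_max (Suc m) (case_nat s x))"
        by (intro bexI[of _ n]) (simp_all only: ereal_less_eq walk_max_mono UNIV_I)
    qed
    show "(SUP n. ereal (walk_max (Suc n) (case_nat s x))) \<le> (SUP n. ereal (walk_max n (case_nat s x)))"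
      by (rule SUP_mono) blast
  qed
  also have "\<dots> = (SUP n. max 0 (ereal s + ereal (walk_max n x)))"
    unfolding walk_max_case_nat by (intro SUP_cong refl) (simp add: zero_ereal_def)
  also have "\<dots> = max 0 (SUP n. ereal s + ereal (walk_max n x))"
  proof (rule antisym)
    show "max 0 (SUP n. ereal s + ereal (walk_max n x)) \<le> (SUP n. max 0 (ereal s + ereal (walk_max n x)))"
    proof (rule max.boundedI)
      show "0 \<le> (SUP n. max 0 (ereal s + ereal (walk_max n x)))"
        by (rule SUP_upper2[of 0]) (rule UNIV_I, rule max.cobounded1)
      show "(SUP n. ereal s + ereal (walk_max n x)) \<le> (SUP n. max 0 (ereal s + ereal (walk_max n x)))"
      proof (rule SUP_mono)
        show "\<exists>m\<in>UNIV. ereal s + ereal (walk_max n x) \<le> max 0 (ereal s + ereal (walk_max m x))" for n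
          by (intro bexI[of _ n] max.cobounded2 UNIV_I)
      qed
    qed
  qed (rule SUP_least, rule max.mono[OF order.refl], rule SUP_upper, rule UNIV_I)
  also have "(SUP n. ereal s + ereal (walk_max n x)) = ereal s + walk_sup x"
    unfolding walk_sup_def by (rule SUP_ereal_add_right) auto
  finally show ?thesis .
qed

lemma walk_max_measurable [measurable]:
  "walk_max n \<in> borel_measurable (PiM UNIV (\<lambda>_::nat. borel))"
proof (induction n)
  case (Suc n)
  have "(\<lambda>x i. x (Suc i)) \<in> measurable (PiM UNIV (\<lambda>_::nat. borel :: real measure)) (PiM UNIV (\<lambda>_::nat. borel))"
    by (rule measurable_PiM_single') auto
  from measurable_compose[OF this Suc]
  have [measurable]: "(\<lambda>x. walk_max n (\<lambda>i. x (Suc i))) \<in> borel_measurable (PiM UNIV (\<lambda>_::nat. borel))" .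
  have [measurable]: "(\<lambda>x. x 0) \<in> borel_measurable (PiM UNIV (\<lambda>_::nat. borel :: real measure))"
    by (rule measurable_component_singleton) simp
  show ?case unfolding walk_max.simps by measurable
qed simp

lemma walk_sup_measurable [measurable]:
  "walk_sup \<in> borel_measurable (PiM UNIV (\<lambda>_::nat. borel))"
  unfolding walk_sup_def by measurable

lemma sequence_space_real_distribution:
  assumes "real_distribution D"
  shows "sequence_space D"
proof -
  interpret real_distribution D by fact
  show ?thesis unfolding sequence_space_def product_prob_space_def product_prob_space_axioms_def product_sigma_finite_def
    by (auto intro: prob_space_axioms sigma_finite_measure_axioms)
qed

text \<open>
  Garsia's proof of the maximal ergodic lemma, applied on the shift-invariant event \<open>B\<close> that the
  walk is unbounded above: \<open>walk_max (Suc n) (case_nat s x) - walk_max n x = max s (- walk_max n x)\<close>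
  has nonnegative mean over \<open>B\<close> and tends to \<open>s\<close> there, so that a negative mean of \<open>s\<close> forces
  \<open>B\<close> to be null.
\<close>

lemma walk_sup_finite:
  assumes D: "real_distribution D" and int: "integrable D (\<lambda>s. s)" and neg: "(\<integral>s. s \<partial>D) < 0"
  shows "AE x in PiM UNIV (\<lambda>_::nat. D). walk_sup x < \<infinity>"
proof -
  interpret D: real_distribution D by fact
  interpret sequence_space D by (rule sequence_space_real_distribution[OF D])
  interpret DS: pair_prob_space D S ..
  have setsS [measurable_cong]: "sets S = sets (PiM UNIV (\<lambda>_::nat. borel))"
    by (rule sets_PiM_cong) auto
  have wm [measurable]: "walk_max n \<in> borel_measurable S" for n
    using walk_max_measurable measurable_cong_sets[OF setsS refl] by blast
  have ws [measurable]: "walk_sup \<in> borel_measurable S"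
    using walk_sup_measurable measurable_cong_sets[OF setsS refl] by blast
  have cm [measurable]: "(\<lambda>(s, x). case_nat s x) \<in> measurable (D \<Otimes>\<^sub>M S) S"
    unfolding split_beta' by (rule measurable_case_nat') measurable
  define B where "B = {x \<in> space S. walk_sup x = \<infinity>}"
  have Bm [measurable]: "B \<in> sets S" unfolding B_def by measurable
  \<comment> \<open>A finite first step cannot change whether the supremum is infinite, so
    \<open>B\<close> is shift-invariant.\<close>
  have iB: "indicator B (case_nat s x) = (indicator B x :: real)" for s x
    using walk_sup_nonneg[of x]
    by (cases "walk_sup x") (auto simp: B_def walk_sup_case_nat indicator_def space_PiM max_def)
  have fst_int: "integrable (D \<Otimes>\<^sub>M S) (\<lambda>z. fst z)"
  proof -
    have "integrable (distr (D \<Otimes>\<^sub>M S) D fst) (\<lambda>s. s)" unfolding P.distr_pair_fst by (rule int)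
    then show ?thesis by (subst (asm) integrable_distr_eq) auto
  qed
  have snd_distr: "distr (D \<Otimes>\<^sub>M S) S snd = S"
  proof (rule measure_eqI)
    fix A assume "A \<in> sets (distr (D \<Otimes>\<^sub>M S) S snd)"
    then have A: "A \<in> sets S" by simp
    then have "snd -` A \<inter> space (D \<Otimes>\<^sub>M S) = space D \<times> A"
      using sets.sets_into_space[OF A] by (auto simp: space_pair_measure)
    then show "emeasure (distr (D \<Otimes>\<^sub>M S) S snd) A = emeasure S A"
      using A by (simp add: emeasure_distr P.emeasure_pair_measure_Times D.emeasure_space_1[simplified])
  qed simp
  have snd_int: "integrable (D \<Otimes>\<^sub>M S) (\<lambda>z. f (snd z))" "(\<integral>z. f (snd z) \<partial>(D \<Otimes>\<^sub>M S)) = integral\<^sup>L S f"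
    if "integrable S f" for f :: "(nat \<Rightarrow> real) \<Rightarrow> real"
  proof -
    have f: "f \<in> borel_measurable S" using that by auto
    show "integrable (D \<Otimes>\<^sub>M S) (\<lambda>z. f (snd z))"
      using that by (subst (asm) snd_distr[symmetric], subst (asm) integrable_distr_eq) (use f in auto)
    show "(\<integral>z. f (snd z) \<partial>(D \<Otimes>\<^sub>M S)) = integral\<^sup>L S f"
      by (subst (2) snd_distr[symmetric], subst integral_distr) (use f in auto)
  qed
  \<comment> \<open>Prepending an independent step preserves the product law; this is the only form
    in which stationarity of the steps is used.\<close>
  have shift_int: "integrable (D \<Otimes>\<^sub>M S) (\<lambda>z. f (case_nat (fst z) (snd z))) \<longleftrightarrow> integrable S f"
    "(\<integral>z. f (case_nat (fst z) (snd z)) \<partial>(D \<Otimes>\<^sub>M S)) = integral\<^sup>L S f"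
    if f: "f \<in> borel_measurable S" for f :: "(nat \<Rightarrow> real) \<Rightarrow> real"
  proof -
    show "integrable (D \<Otimes>\<^sub>M S) (\<lambda>z. f (case_nat (fst z) (snd z))) \<longleftrightarrow> integrable S f"
      by (subst (2) PiM_iter[symmetric], subst integrable_distr_eq[OF cm f]) (simp add: split_beta')
    show "(\<integral>z. f (case_nat (fst z) (snd z)) \<partial>(D \<Otimes>\<^sub>M S)) = integral\<^sup>L S f"
      by (subst (2) PiM_iter[symmetric], subst integral_distr[OF cm f]) (simp add: split_beta')
  qed
  have wint: "integrable S (walk_max n)" for n
  proof (induction n)
    case (Suc n)
    have "integrable (D \<Otimes>\<^sub>M S) (\<lambda>z. walk_max (Suc n) (case_nat (fst z) (snd z)))"
    proof (rule Bochner_Integration.integrable_bound)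
      show "integrable (D \<Otimes>\<^sub>M S) (\<lambda>z. \<bar>fst z\<bar> + walk_max n (snd z))"
        by (intro Bochner_Integration.integrable_add integrable_abs fst_int snd_int Suc)
      show "(\<lambda>z. walk_max (Suc n) (case_nat (fst z) (snd z))) \<in> borel_measurable (D \<Otimes>\<^sub>M S)"
        using measurable_compose[OF cm wm[of "Suc n"]] by (simp add: split_beta' del: walk_max.simps)
      show "AE z in D \<Otimes>\<^sub>M S. norm (walk_max (Suc n) (case_nat (fst z) (snd z))) \<le> norm (\<bar>fst z\<bar> + walk_max n (snd z))"
        unfolding walk_max_case_nat using walk_max_nonneg by (intro AE_I2) (smt (verit) real_norm_def)
    qed
    then show ?case using shift_int(1)[OF wm[of "Suc n"]] by (simp del: walk_max.simps)
  qed (simp add: P.finite_measure_axioms)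
  let ?b = "\<lambda>z. indicator B (snd z) :: real"
  define g where "g = (\<lambda>n z. max (- walk_max n (snd z)) (fst z) * ?b z)"
  have wBint: "integrable S (\<lambda>x. walk_max n x * indicator B x)" for n
    using wint by (rule integrable_real_mult_indicator[OF Bm])
  have g_ge: "0 \<le> integral\<^sup>L (D \<Otimes>\<^sub>M S) (g n)" for n
  proof -
    let ?f = "\<lambda>n x. walk_max n x * indicator B x :: real"
    have eq: "g n z = ?f (Suc n) (case_nat (fst z) (snd z)) - ?f n (snd z)" for z
      unfolding g_def walk_max_case_nat iB by (simp add: left_diff_distrib[symmetric] max_def)
    have "integral\<^sup>L (D \<Otimes>\<^sub>M S) (g n) = (\<integral>z. ?f (Suc n) (case_nat (fst z) (snd z)) \<partial>(D \<Otimes>\<^sub>M S)) - (\<integral>z. ?f n (snd z) \<partial>(D \<Otimes>\<^sub>M S))"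
      unfolding eq[abs_def]
      by (rule Bochner_Integration.integral_diff) (use shift_int(1)[of "?f (Suc n)"] wBint[of "Suc n"] snd_int(1)[OF wBint[of n]] in auto)
    also have "\<dots> = integral\<^sup>L S (?f (Suc n)) - integral\<^sup>L S (?f n)"
      using shift_int(2)[of "?f (Suc n)"] wBint[of "Suc n"] snd_int(2)[OF wBint[of n]] by auto
    also have "\<dots> \<ge> 0"
      using integral_mono[OF wBint[of n] wBint[of "Suc n"]] walk_max_mono[of n]
      by (simp add: mult_right_mono del: walk_max.simps)
    finally show ?thesis .
  qed
  have "(\<lambda>n. integral\<^sup>L (D \<Otimes>\<^sub>M S) (g n)) \<longlonglongrightarrow> (\<integral>z. fst z * ?b z \<partial>(D \<Otimes>\<^sub>M S))"
  proof (rule integral_dominated_convergence[where w = "\<lambda>z. \<bar>fst z\<bar>"])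
    show "integrable (D \<Otimes>\<^sub>M S) (\<lambda>z. \<bar>fst z\<bar>)" using fst_int by (rule integrable_abs)
    show "(\<lambda>z. fst z * ?b z) \<in> borel_measurable (D \<Otimes>\<^sub>M S)" by measurable
    show "g n \<in> borel_measurable (D \<Otimes>\<^sub>M S)" for n unfolding g_def by measurable
    \<comment> \<open>As \<open>- walk_max\<close> is at most 0, the maximum equals \<open>s\<close>
      for \<open>s \<ge> 0\<close> and lies between \<open>s\<close> and 0 otherwise.\<close>
    show "AE z in D \<Otimes>\<^sub>M S. norm (g n z) \<le> \<bar>fst z\<bar>" for n
      using walk_max_nonneg[of n] by (intro AE_I2) (auto simp: g_def indicator_def max_def abs_if, (smt (verit))+)
    show "AE z in D \<Otimes>\<^sub>M S. (\<lambda>n. g n z) \<longlonglongrightarrow> fst z * ?b z"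
    proof (rule AE_I2)
      fix z
      show "(\<lambda>n. g n z) \<longlonglongrightarrow> fst z * ?b z"
      proof (cases "snd z \<in> B")
        case True
        then have "ereal (- fst z) < walk_sup (snd z)" by (simp add: B_def)
        then obtain n0 where n0: "- fst z < walk_max n0 (snd z)"
          unfolding walk_sup_def less_SUP_iff by auto
        have "eventually (\<lambda>n. g n z = fst z * ?b z) sequentially"
          using eventually_ge_at_top[of n0]
        proof eventually_elim
          case (elim n)
          have "walk_max n0 (snd z) \<le> walk_max n (snd z)"
            using incseqD[OF incseq_walk_max elim] .
          then show ?case using n0 by (simp add: g_def max_def)
        qed
        then show ?thesis by (rule tendsto_eventually)
      qed (simp add: g_def)
    qed
  qed
  then have ge: "0 \<le> (\<integral>z. fst z * ?b z \<partial>(D \<Otimes>\<^sub>M S))"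
    by (rule LIMSEQ_le_const) (use g_ge in auto)
  have "integrable (D \<Otimes>\<^sub>M S) (\<lambda>z. fst z * ?b z)"
    by (rule Bochner_Integration.integrable_bound[OF fst_int]) (auto simp: indicator_def)
  then have "(\<integral>z. fst z * ?b z \<partial>(D \<Otimes>\<^sub>M S)) = (\<integral>s. \<integral>x. s * indicator B x \<partial>S \<partial>D)"
    by (subst DS.integral_fst'[symmetric]) auto
  also have "\<dots> = (\<integral>s. s \<partial>D) * measure S B" by simp
  finally have "0 \<le> (\<integral>s. s \<partial>D) * measure S B" using ge by simp
  then have "measure S B = 0" using neg measure_nonneg[of S B] by (simp add: zero_le_mult_iff)
  then have "emeasure S B = 0" by (simp add: P.emeasure_eq_measure)
  then have "AE x in S. x \<notin> B" by (intro AE_not_in) (auto simp: null_sets_def)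
  then show ?thesis by (rule AE_mp) (auto simp: B_def intro!: AE_I2)
qed

text \<open>The last claim is the fixed point equation: prepending a step \<open>s\<close> to an
  independent walk with supremum \<open>W\<close> gives \<open>max 0 (s + W)\<close>, and for
  \<open>u \<ge> 0\<close> the cut at 0 is irrelevant to exceeding \<open>u\<close>.\<close>

lemma walk_sup_law:
  assumes D: "real_distribution D" and fin: "AE x in PiM UNIV (\<lambda>_::nat. D). walk_sup x < \<infinity>"
  defines "Q \<equiv> distr (PiM UNIV (\<lambda>_::nat. D)) borel (\<lambda>x. real_of_ereal (walk_sup x))"
  shows "real_distribution Q"
    and "u \<ge> 0 \<Longrightarrow> measure Q {u<..} = measure (PiM UNIV (\<lambda>_::nat. D)) {x \<in> space (PiM UNIV (\<lambda>_::nat. D)). ereal u < walk_sup x}"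
    and "u < 0 \<Longrightarrow> measure Q {u<..} = 1"
    and "u \<ge> 0 \<Longrightarrow> measure (convolution D Q) {u<..} = measure (PiM UNIV (\<lambda>_::nat. D)) {x \<in> space (PiM UNIV (\<lambda>_::nat. D)). ereal u < walk_sup x}"
proof -
  interpret D: real_distribution D by fact
  interpret sequence_space D by (rule sequence_space_real_distribution[OF D])
  interpret DS: pair_prob_space D S ..
  have setsS [measurable_cong]: "sets S = sets (PiM UNIV (\<lambda>_::nat. borel))"
    by (rule sets_PiM_cong) auto
  have ws [measurable]: "walk_sup \<in> borel_measurable S"
    using walk_sup_measurable measurable_cong_sets[OF setsS refl] by blast
  have cm [measurable]: "(\<lambda>(s, x). case_nat s x) \<in> measurable (D \<Otimes>\<^sub>M S) S"
    unfolding split_beta' by (rule measurable_case_nat') measurable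
  show Q: "real_distribution Q"
    unfolding Q_def real_distribution_def real_distribution_axioms_def by (auto intro!: P.prob_space_distr)
  interpret Q: real_distribution Q by fact
  have re: "walk_sup x = ereal (real_of_ereal (walk_sup x))" if "walk_sup x < \<infinity>" for x
    using that walk_sup_nonneg[of x] by (cases "walk_sup x") auto
  let ?A = "{x \<in> space S. ereal u < walk_sup x}"
  have mQ: "measure Q A = measure S {x \<in> space S. real_of_ereal (walk_sup x) \<in> A}" if "A \<in> sets borel" for A
    unfolding Q_def using that by (subst measure_distr) (auto intro!: arg_cong[where f = "measure S"])
  show "measure Q {u<..} = measure S ?A" if "u \<ge> 0"
  proof -
    have "AE x in S. x \<in> {x \<in> space S. real_of_ereal (walk_sup x) \<in> {u<..}} \<longleftrightarrow> x \<in> ?A"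
      using fin
    proof eventually_elim
      case (elim x)
      show ?case using re[OF elim] by (metis (no_types, lifting) greaterThan_iff less_ereal.simps(1) mem_Collect_eq)
    qed
    then show ?thesis by (subst mQ, simp, intro measure_eq_AE) auto
  qed
  show "measure Q {u<..} = 1" if "u < 0"
  proof -
    have "{x \<in> space S. real_of_ereal (walk_sup x) \<in> {u<..}} = space S"
      using real_of_ereal_pos[OF walk_sup_nonneg] that by (auto intro: less_le_trans)
    then show ?thesis by (subst mQ) (simp_all add: P.prob_space)
  qed
  show "measure (convolution D Q) {u<..} = measure S ?A" if u: "u \<ge> 0"
  proof -
    have A: "?A \<in> sets S" by measurable
    have "emeasure S ?A = emeasure (D \<Otimes>\<^sub>M S) ((\<lambda>(s, x). case_nat s x) -` ?A \<inter> space (D \<Otimes>\<^sub>M S))"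
      by (subst (1) PiM_iter[symmetric], subst emeasure_distr[OF cm A]) simp
    also have "\<dots> = (\<integral>\<^sup>+ s. emeasure S (Pair s -` ((\<lambda>(s, x). case_nat s x) -` ?A \<inter> space (D \<Otimes>\<^sub>M S))) \<partial>D)"
      by (rule P.emeasure_pair_measure_alt) (rule measurable_sets[OF cm A])
    also have "\<dots> = (\<integral>\<^sup>+ s. emeasure Q {a. a + s \<in> {u<..}} \<partial>D)"
    proof (rule nn_integral_cong)
      fix s
      have "{a. a + s \<in> {u<..}} = {u - s<..}" by auto
      then have "emeasure Q {a. a + s \<in> {u<..}} = emeasure S {x \<in> space S. u < real_of_ereal (walk_sup x) + s}"
        unfolding Q_def by (simp, subst emeasure_distr) (auto intro!: arg_cong[where f = "emeasure S"])
      also have "\<dots> = emeasure S {x \<in> space S. ereal u < max 0 (ereal s + walk_sup x)}"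
      proof (rule emeasure_eq_AE)
        show "AE x in S. x \<in> {x \<in> space S. u < real_of_ereal (walk_sup x) + s} \<longleftrightarrow> x \<in> {x \<in> space S. ereal u < max 0 (ereal s + walk_sup x)}"
          using fin
        proof eventually_elim
          case (elim x)
          define w where "w = real_of_ereal (walk_sup x)"
          have "walk_sup x = ereal w" using re[OF elim] by (simp add: w_def)
          then show ?case using u by (auto simp: less_max_iff_disj)
        qed
      qed measurable
      also have "{x \<in> space S. ereal u < max 0 (ereal s + walk_sup x)} = Pair s -` ((\<lambda>(s, x). case_nat s x) -` ?A \<inter> space (D \<Otimes>\<^sub>M S))"
        by (auto simp: walk_sup_case_nat space_pair_measure space_PiM split: nat.split)
      finally show "emeasure S (Pair s -` ((\<lambda>(s, x). case_nat s x) -` ?A \<inter> space (D \<Otimes>\<^sub>M S))) = emeasure Q {a. a + s \<in> {u<..}}"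
        by simp
    qed
    also have "\<dots> = emeasure (convolution D Q) {u<..}"
      by (rule convolution_emeasure[symmetric]) (auto simp: D.finite_measure_axioms Q.finite_measure_axioms)
    finally show ?thesis by (simp add: measure_def)
  qed
qed

section \<open>The ruin event\<close>

abbreviation (input) arrival :: "(nat \<Rightarrow> 'a \<Rightarrow> real) \<Rightarrow> nat \<Rightarrow> 'a \<Rightarrow> real" where
  "arrival T k \<omega> \<equiv> (\<Sum>i=1..k. T i \<omega>)"

text \<open>A positive cardinality already says that the set of arrivals up to \<open>t\<close> is
  finite and nonempty. Between the largest arrival time in it and \<open>t\<close> the set does not
  change; nothing about the order of the arrivals enters.\<close>

lemma claim_count_last_arrival:
  assumes "claim_count T t \<omega> > 0"
  obtains k where "k \<ge> 1" "arrival T k \<omega> \<le> t"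
    "\<And>s. arrival T k \<omega> \<le> s \<Longrightarrow> s \<le> t \<Longrightarrow> claim_count T s \<omega> = claim_count T t \<omega>"
proof -
  let ?A = "\<lambda>t. {k. 1 \<le> k \<and> arrival T k \<omega> \<le> t}"
  have fin: "finite (?A t)" and ne: "?A t \<noteq> {}"
    using assms unfolding claim_count_def by (auto simp: card_gt_0_iff)
  define v where "v = Max ((\<lambda>k. arrival T k \<omega>) ` ?A t)"
  have "v \<in> (\<lambda>k. arrival T k \<omega>) ` ?A t" unfolding v_def by (rule Max_in) (use fin ne in auto)
  then obtain k where k: "k \<in> ?A t" "arrival T k \<omega> = v" by auto
  have eq: "?A s = ?A t" if "v \<le> s" "s \<le> t" for s
  proof (intro set_eqI iffI)
    fix j assume "j \<in> ?A t"
    then have "arrival T j \<omega> \<le> v" unfolding v_def by (intro Max_ge) (use fin in auto)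
    then show "j \<in> ?A s" using \<open>j \<in> ?A t\<close> that by auto
  qed (use that in auto)
  show thesis
  proof (rule that)
    show "k \<ge> 1" "arrival T k \<omega> \<le> t" using k(1) by auto
    show "claim_count T s \<omega> = claim_count T t \<omega>" if "arrival T k \<omega> \<le> s" "s \<le> t" for s
      unfolding claim_count_def by (subst eq) (use that k(2) in auto)
  qed
qed

text \<open>
  Countably many candidate times, the arrival times and the positive rationals, detect ruin on an
  arbitrary path, which makes the ruin event measurable.
\<close>

lemma ruin_countable_times:
  assumes c: "c > 0" and u: "u \<ge> 0"
  shows "(\<exists>t>0. surplus c X T u t \<omega> < 0) \<longleftrightarrow>
    (\<exists>k\<ge>1. arrival T k \<omega> > 0 \<and> surplus c X T u (arrival T k \<omega>) \<omega> < 0) \<or>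
    (\<exists>q::rat. of_rat q > (0::real) \<and> surplus c X T u (of_rat q) \<omega> < 0)"
proof
  assume "\<exists>t>0. surplus c X T u t \<omega> < 0"
  then obtain t where t: "t > 0" "surplus c X T u t \<omega> < 0" by blast
  have "0 \<le> u + c * t" using t c u by simp
  then have "claim_count T t \<omega> > 0"
    using t(2) by (cases "claim_count T t \<omega>") (auto simp: surplus_def)
  then obtain k where k: "k \<ge> 1" "arrival T k \<omega> \<le> t"
    and const: "\<And>s. arrival T k \<omega> \<le> s \<Longrightarrow> s \<le> t \<Longrightarrow> claim_count T s \<omega> = claim_count T t \<omega>"
    by (rule claim_count_last_arrival) blast
  have neg: "surplus c X T u s \<omega> < 0" if "arrival T k \<omega> \<le> s" "s \<le> t" for s
  proof -
    have "surplus c X T u s \<omega> \<le> surplus c X T u t \<omega>"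
      unfolding surplus_def const[OF that] using that c by simp
    then show ?thesis using t by simp
  qed
  show "(\<exists>k\<ge>1. arrival T k \<omega> > 0 \<and> surplus c X T u (arrival T k \<omega>) \<omega> < 0) \<or>
    (\<exists>q::rat. of_rat q > (0::real) \<and> surplus c X T u (of_rat q) \<omega> < 0)"
  proof (cases "arrival T k \<omega> > 0")
    case True
    then show ?thesis using k neg[of "arrival T k \<omega>"] by blast
  next
    \<comment> \<open>Without positivity of the waiting times the last arrival may be at or before
      time 0; the count is then constant on all of \<open>(0, t]\<close>, and any rational time in
      it detects ruin.\<close>
    case False
    obtain q :: rat where "0 < real_of_rat q" "real_of_rat q < t" using of_rat_dense[OF t(1)] by blast
    then have "surplus c X T u (of_rat q) \<omega> < 0" by (intro neg) (use False \<open>0 < real_of_rat q\<close> in linarith, simp)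
    then show ?thesis using \<open>0 < real_of_rat q\<close> by blast
  qed
next
  assume "(\<exists>k\<ge>1. arrival T k \<omega> > 0 \<and> surplus c X T u (arrival T k \<omega>) \<omega> < 0) \<or>
    (\<exists>q::rat. of_rat q > (0::real) \<and> surplus c X T u (of_rat q) \<omega> < 0)"
  then show "\<exists>t>0. surplus c X T u t \<omega> < 0" by (elim disjE exE conjE) (rule exI, rule conjI, assumption+)+
qed

lemma surplus_measurable:
  assumes X: "\<And>k. k \<ge> 1 \<Longrightarrow> X k \<in> borel_measurable M" and T: "\<And>k. k \<ge> 1 \<Longrightarrow> T k \<in> borel_measurable M"
    and \<theta> [measurable]: "\<theta> \<in> borel_measurable M"
  shows "(\<lambda>\<omega>. surplus c X T u (\<theta> \<omega>) \<omega>) \<in> borel_measurable M"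
proof -
  have [measurable]: "(\<lambda>\<omega>. arrival T k \<omega>) \<in> borel_measurable M" for k
    using T by (intro borel_measurable_sum) auto
  have sx: "(\<lambda>\<omega>. \<Sum>i=1..n. X i \<omega>) \<in> borel_measurable M" for n
    using X by (intro borel_measurable_sum) auto
  have cc [measurable]: "(\<lambda>\<omega>. claim_count T (\<theta> \<omega>) \<omega>) \<in> measurable M (count_space UNIV)"
    unfolding claim_count_def
  proof (rule measurable_card)
    fix i
    show "{\<omega> \<in> space M. i \<in> {k. 1 \<le> k \<and> arrival T k \<omega> \<le> \<theta> \<omega>}} \<in> sets M"
      unfolding mem_Collect_eq by measurable
  qed
  have "(\<lambda>\<omega>. \<Sum>i=1..claim_count T (\<theta> \<omega>) \<omega>. X i \<omega>) \<in> borel_measurable M"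
    by (rule measurable_compose_countable[OF sx cc])
  then show ?thesis unfolding surplus_def by simp
qed

text \<open>Between claims the surplus increases, so a negative value at \<open>t\<close> is
  preceded by one at the last arrival. Arrival times increase strictly, hence exactly
  \<open>k\<close> claims have occurred at the \<open>k\<close>-th arrival and the surplus there is
  \<open>u\<close> minus the walk.\<close>

lemma ruin_iff_walk:
  assumes c: "c > 0" and u: "u \<ge> 0" and T: "\<And>k. k \<ge> 1 \<Longrightarrow> T k \<omega> > 0"
    and fin: "\<And>t. finite {k. 1 \<le> k \<and> arrival T k \<omega> \<le> t}"
  shows "(\<exists>t>0. surplus c X T u t \<omega> < 0) \<longleftrightarrow> (\<exists>k\<ge>1. u < (\<Sum>i<k. X (Suc i) \<omega> - c * T (Suc i) \<omega>))"
proof -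
  have mono: "arrival T j \<omega> < arrival T k \<omega>" if "j < k" for j k
    using that
  proof (induction k)
    case (Suc k)
    have "arrival T k \<omega> < arrival T (Suc k) \<omega>" using T[of "Suc k"] by simp
    then show ?case using Suc by (cases "j = k") auto
  qed simp
  have le_iff: "arrival T j \<omega> \<le> arrival T k \<omega> \<longleftrightarrow> j \<le> k" for j k
    using mono[of j k] mono[of k j] by (cases j k rule: linorder_cases) auto
  have pos: "arrival T k \<omega> > 0" if "k \<ge> 1" for k using mono[of 0 k] that by simp
  have cc: "claim_count T (arrival T k \<omega>) \<omega> = k" for k
  proof -
    have "{j. 1 \<le> j \<and> arrival T j \<omega> \<le> arrival T k \<omega>} = {1..k}" unfolding le_iff by auto
    then show ?thesis unfolding claim_count_def by simp
  qed
  have eq: "(\<Sum>i<k. X (Suc i) \<omega> - c * T (Suc i) \<omega>) = (\<Sum>i=1..k. X i \<omega>) - c * arrival T k \<omega>" for k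
  proof -
    have "sum f {1..k} = (\<Sum>i<k. f (Suc i))" for f :: "nat \<Rightarrow> real"
      by (metis One_nat_def lessThan_atLeast0 sum.atLeast_Suc_atMost_Suc_shift sum.atLeast1_atMost_eq)
    then show ?thesis by (simp only: sum_subtractf sum_distrib_left)
  qed
  have surp: "surplus c X T u (arrival T k \<omega>) \<omega> = u - (\<Sum>i<k. X (Suc i) \<omega> - c * T (Suc i) \<omega>)" for k
    unfolding surplus_def cc eq by simp
  show ?thesis
  proof
    assume "\<exists>t>0. surplus c X T u t \<omega> < 0"
    then obtain t where t: "t > 0" "surplus c X T u t \<omega> < 0" by blast
    have "0 \<le> u + c * t" using t c u by simp
    then have "claim_count T t \<omega> > 0"
      using t(2) by (cases "claim_count T t \<omega>") (auto simp: surplus_def)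
    then obtain k where k: "k \<ge> 1" "arrival T k \<omega> \<le> t"
      and const: "\<And>s. arrival T k \<omega> \<le> s \<Longrightarrow> s \<le> t \<Longrightarrow> claim_count T s \<omega> = claim_count T t \<omega>"
      by (rule claim_count_last_arrival) blast
    have "surplus c X T u (arrival T k \<omega>) \<omega> \<le> surplus c X T u t \<omega>"
      unfolding surplus_def const[OF order.refl k(2)] using k c by simp
    then show "\<exists>k\<ge>1. u < (\<Sum>i<k. X (Suc i) \<omega> - c * T (Suc i) \<omega>)"
      using t k(1) unfolding surp by (intro exI[of _ k]) simp
  next
    assume "\<exists>k\<ge>1. u < (\<Sum>i<k. X (Suc i) \<omega> - c * T (Suc i) \<omega>)"
    then obtain k where k: "k \<ge> 1" "u < (\<Sum>i<k. X (Suc i) \<omega> - c * T (Suc i) \<omega>)" by blast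
    then show "\<exists>t>0. surplus c X T u t \<omega> < 0"
      using pos[OF k(1)] surp[of k] by (intro exI[of _ "arrival T k \<omega>"]) simp
  qed
qed

section \<open>The renewal risk model and its maximal loss\<close>

locale renewal_risk = prob_space M for M :: "'a measure" +
  fixes X T :: "nat \<Rightarrow> 'a \<Rightarrow> real" and c :: real and LX LT :: "real measure"
  assumes c: "c > 0"
    and indep: "indep_vars (\<lambda>_. borel) (case_sum X T) ({1..} <+> {1..})"
    and X_law: "\<And>k. k \<ge> 1 \<Longrightarrow> distr M borel (X k) = LX"
    and T_law: "\<And>k. k \<ge> 1 \<Longrightarrow> distr M borel (T k) = LT"
    and X_pos: "\<And>k. k \<ge> 1 \<Longrightarrow> AE \<omega> in M. X k \<omega> > 0"
    and T_pos: "\<And>k. k \<ge> 1 \<Longrightarrow> AE \<omega> in M. T k \<omega> > 0"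
    and net_profit: "ennreal c * (\<integral>\<^sup>+\<omega>. ennreal (T 1 \<omega>) \<partial>M) > (\<integral>\<^sup>+\<omega>. ennreal (X 1 \<omega>) \<partial>M)"
begin

lemma X_measurable:
  assumes "k \<ge> 1"
  shows "X k \<in> borel_measurable M"
proof -
  have "\<forall>i\<in>{1..} <+> {1..}. case_sum X T i \<in> borel_measurable M"
    using indep unfolding indep_vars_def2 by (rule conjunct1)
  then have "case_sum X T (Inl k) \<in> borel_measurable M" by (rule bspec) (use assms in auto)
  then show ?thesis by simp
qed

lemma T_measurable:
  assumes "k \<ge> 1"
  shows "T k \<in> borel_measurable M"
proof -
  have "\<forall>i\<in>{1..} <+> {1..}. case_sum X T i \<in> borel_measurable M"
    using indep unfolding indep_vars_def2 by (rule conjunct1)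
  then have "case_sum X T (Inr k) \<in> borel_measurable M" by (rule bspec) (use assms in auto)
  then show ?thesis by simp
qed

text \<open>By independence \<open>exp (- arrival T k)\<close> has mean \<rho>\<open>^k\<close>,
  where \<open>\<rho> < 1\<close> because the waiting times are positive. Hence the infimum over
  \<open>k\<close> has mean 0 and vanishes almost surely, that is, the arrival times are unbounded.
  No moment of the waiting times is required.\<close>

lemma arrivals_finite: "AE \<omega> in M. \<forall>t. finite {k. 1 \<le> k \<and> arrival T k \<omega> \<le> t}"
proof -
  define f where "f = (\<lambda>k \<omega>. exp (- arrival T k \<omega>))"
  define \<rho> where "\<rho> = (\<integral>t. exp (- t) \<partial>LT)"
  note T_measurable[measurable]
  have [measurable]: "(\<lambda>\<omega>. arrival T k \<omega>) \<in> borel_measurable M" for k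
    by (intro borel_measurable_sum) auto
  have T_exp: "(\<integral>\<omega>. exp (- T k \<omega>) \<partial>M) = \<rho>" if "k \<ge> 1" for k
    unfolding \<rho>_def T_law[OF that, symmetric] by (subst integral_distr) (use that in auto)
  have e_int: "integrable M (\<lambda>\<omega>. exp (- T k \<omega>))" if "k \<ge> 1" for k
    by (rule integrable_const_bound[where B = 1]) (use T_pos[OF that] that in \<open>auto elim!: eventually_mono\<close>)
  have \<rho>: "0 \<le> \<rho>" "\<rho> < 1"
  proof -
    show "0 \<le> \<rho>" unfolding \<rho>_def by simp
    have d: "integrable M (\<lambda>\<omega>. 1 - exp (- T 1 \<omega>))" using e_int[of 1] by simp
    have ae: "AE \<omega> in M. 0 \<le> 1 - exp (- T 1 \<omega>)" using T_pos[of 1] by (auto elim!: eventually_mono)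
    have "(\<integral>\<omega>. 1 - exp (- T 1 \<omega>) \<partial>M) \<noteq> 0"
    proof
      assume "(\<integral>\<omega>. 1 - exp (- T 1 \<omega>) \<partial>M) = 0"
      then have "AE \<omega> in M. 1 - exp (- T 1 \<omega>) = 0"
        using integral_nonneg_eq_0_iff_AE[OF d ae] by simp
      moreover have "AE \<omega> in M. T 1 \<omega> > 0" using T_pos[of 1] by simp
      ultimately have "AE \<omega> in M. False" by eventually_elim simp
      then show False by simp
    qed
    moreover have "(\<integral>\<omega>. 1 - exp (- T 1 \<omega>) \<partial>M) \<ge> 0" using ae by (rule integral_nonneg_AE)
    ultimately show "\<rho> < 1" using T_exp[of 1] e_int[of 1] by (simp add: prob_space)
  qed
  have fk: "(\<integral>\<omega>. f k \<omega> \<partial>M) = \<rho> ^ k" and fk_int: "integrable M (f k)" for k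
  proof -
    let ?I = "Inr ` {1..k} :: (nat + nat) set"
    let ?V = "\<lambda>i \<omega>. exp (- case_sum X T i \<omega>)"
    have ind: "indep_vars (\<lambda>_. borel) ?V ?I"
      by (rule indep_vars_compose2[OF indep_vars_subset[OF indep]]) (auto simp: Plus_def)
    have f_eq: "f k \<omega> = (\<Prod>i\<in>?I. ?V i \<omega>)" for \<omega>
      unfolding f_def by (subst prod.reindex) (auto simp: exp_sum sum_negf[symmetric] inj_on_def)
    have i: "integrable M (?V i)" if "i \<in> ?I" for i using that e_int by auto
    have "(\<integral>\<omega>. f k \<omega> \<partial>M) = (\<Prod>i\<in>?I. \<integral>\<omega>. ?V i \<omega> \<partial>M)"
      unfolding f_eq by (rule indep_vars_lebesgue_integral[OF _ ind i]) auto
    also have "\<dots> = (\<Prod>i\<in>{1..k}. \<integral>\<omega>. exp (- T i \<omega>) \<partial>M)"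
      by (subst prod.reindex) (auto simp: inj_on_def)
    also have "\<dots> = \<rho> ^ k" using T_exp by simp
    finally show "(\<integral>\<omega>. f k \<omega> \<partial>M) = \<rho> ^ k" .
    show "integrable M (f k)"
      unfolding f_eq by (rule indep_vars_integrable[OF _ ind i]) auto
  qed
  define g where "g = (\<lambda>\<omega>. INF k. ennreal (f k \<omega>))"
  have gm [measurable]: "g \<in> borel_measurable M" unfolding g_def f_def by measurable
  have "(\<integral>\<^sup>+\<omega>. g \<omega> \<partial>M) \<le> ennreal (\<rho> ^ k)" for k
  proof -
    have "(\<integral>\<^sup>+\<omega>. g \<omega> \<partial>M) \<le> (\<integral>\<^sup>+\<omega>. ennreal (f k \<omega>) \<partial>M)"
      unfolding g_def by (intro nn_integral_mono INF_lower) simp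
    also have "\<dots> = ennreal (\<rho> ^ k)"
      using nn_integral_eq_integral[OF fk_int[of k]] fk[of k] by (simp add: f_def)
    finally show ?thesis .
  qed
  moreover have "(\<lambda>k. ennreal (\<rho> ^ k)) \<longlonglongrightarrow> ennreal 0"
    using \<rho> by (intro tendsto_ennrealI LIMSEQ_power_zero) simp
  ultimately have "(\<integral>\<^sup>+\<omega>. g \<omega> \<partial>M) \<le> ennreal 0"
    by (intro LIMSEQ_le_const[of _ "ennreal 0"]) auto
  then have "AE \<omega> in M. g \<omega> = 0" by (simp add: nn_integral_0_iff_AE)
  moreover have "AE \<omega> in M. \<forall>k. T (Suc k) \<omega> > 0"
    unfolding AE_all_countable using T_pos by simp
  ultimately show ?thesis
  proof eventually_elim
    case (elim \<omega>)
    have mono: "arrival T j \<omega> \<le> arrival T k \<omega>" if "j \<le> k" for j k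
      using that
    proof (induction k rule: dec_induct)
      case (step n)
      then show ?case using elim(2)[rule_format, of n] by simp
    qed simp
    show ?case
    proof
      fix t
      have "g \<omega> < ennreal (exp (- t))" using elim(1) by simp
      then obtain k where "ennreal (f k \<omega>) < ennreal (exp (- t))" unfolding g_def INF_less_iff by auto
      then have "t < arrival T k \<omega>" by (simp add: f_def ennreal_less_iff)
      then have "{k. 1 \<le> k \<and> arrival T k \<omega> \<le> t} \<subseteq> {..k}"
      proof (intro subsetI)
        fix j assume "j \<in> {k. 1 \<le> k \<and> arrival T k \<omega> \<le> t}"
        then have "\<not> arrival T k \<omega> \<le> arrival T j \<omega>" using \<open>t < arrival T k \<omega>\<close> by auto
        then show "j \<in> {..k}" using mono[of k j] by (cases "j \<le> k") auto
      qed
      then show "finite {k. 1 \<le> k \<and> arrival T k \<omega> \<le> t}" by (rule finite_subset) simp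
    qed
  qed
qed

end

context renewal_risk
begin

lemma real_distribution_LX: "real_distribution LX" and real_distribution_LT: "real_distribution LT"
  using X_law[of 1] T_law[of 1] X_measurable[of 1] T_measurable[of 1]
  by (auto simp: real_distribution_def real_distribution_axioms_def intro!: prob_space_distr)

lemma indep_X_T:
  assumes "k \<ge> 1"
  shows "indep_var borel (X k) borel (T k)"
proof -
  have "indep_var (PiM {Inl k} (\<lambda>_. borel)) (\<lambda>\<omega>. restrict (\<lambda>i. case_sum X T i \<omega>) {Inl k})
      (PiM {Inr k} (\<lambda>_. borel)) (\<lambda>\<omega>. restrict (\<lambda>i. case_sum X T i \<omega>) {Inr k})"
    by (rule indep_var_restrict[OF indep]) (use assms in auto)
  then have "indep_var borel ((\<lambda>f. f (Inl k)) \<circ> (\<lambda>\<omega>. restrict (\<lambda>i. case_sum X T i \<omega>) {Inl k}))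
      borel ((\<lambda>f. f (Inr k)) \<circ> (\<lambda>\<omega>. restrict (\<lambda>i. case_sum X T i \<omega>) {Inr k}))"
    by (rule indep_var_compose) auto
  then show ?thesis by (simp add: comp_def)
qed

lemma joint_law:
  assumes k: "k \<ge> 1" and h [measurable]: "case_prod h \<in> borel_measurable (borel \<Otimes>\<^sub>M borel)"
  shows "distr M borel (\<lambda>\<omega>. h (X k \<omega>) (T k \<omega>)) = distr (LX \<Otimes>\<^sub>M LT) borel (case_prod h)"
proof -
  note X_measurable[OF k, measurable] T_measurable[OF k, measurable]
  have "LX \<Otimes>\<^sub>M LT = distr M (borel \<Otimes>\<^sub>M borel) (\<lambda>\<omega>. (X k \<omega>, T k \<omega>))"
    using indep_X_T[OF k] unfolding indep_var_distribution_eq X_law[OF k] T_law[OF k] by simp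
  then show ?thesis by (simp add: distr_distr comp_def)
qed

text \<open>Grouping claims and waiting times into disjoint pairs makes the steps independent. The
  general \<open>h\<close> serves both the true steps and those with a truncated waiting
  time.\<close>

lemma sequence_law:
  fixes h :: "real \<Rightarrow> real \<Rightarrow> real"
  assumes h [measurable]: "case_prod h \<in> borel_measurable (borel \<Otimes>\<^sub>M borel)"
  shows "distr M (PiM UNIV (\<lambda>_::nat. borel)) (\<lambda>\<omega> i. h (X (Suc i) \<omega>) (T (Suc i) \<omega>))
       = PiM UNIV (\<lambda>_::nat. distr (LX \<Otimes>\<^sub>M LT) borel (case_prod h))"
proof -
  let ?\<xi> = "\<lambda>i \<omega>. h (X (Suc i) \<omega>) (T (Suc i) \<omega>)"
  let ?K = "\<lambda>i::nat. {Inl (Suc i), Inr (Suc i)} :: (nat + nat) set"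
  have m: "?\<xi> i \<in> borel_measurable M" for i
    using X_measurable[of "Suc i"] T_measurable[of "Suc i"] by measurable
  have "indep_vars (\<lambda>i. PiM (?K i) (\<lambda>_. borel)) (\<lambda>i \<omega>. restrict (\<lambda>j. case_sum X T j \<omega>) (?K i)) UNIV"
    by (rule indep_vars_restrict[OF indep]) (auto simp: disjoint_family_on_def)
  then have "indep_vars (\<lambda>_. borel) (\<lambda>i \<omega>. (\<lambda>f. h (f (Inl (Suc i))) (f (Inr (Suc i)))) (restrict (\<lambda>j. case_sum X T j \<omega>) (?K i))) UNIV"
    by (rule indep_vars_compose2) measurable
  then have "indep_vars (\<lambda>_. borel) ?\<xi> UNIV" by simp
  then have eq: "distr M (PiM UNIV (\<lambda>_. borel)) (\<lambda>\<omega>. \<lambda>i\<in>UNIV. ?\<xi> i \<omega>) = PiM UNIV (\<lambda>i. distr M borel (?\<xi> i))"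
    by (subst (asm) indep_vars_iff_distr_eq_PiM) (use m in auto)
  have law: "distr M borel (?\<xi> i) = distr (LX \<Otimes>\<^sub>M LT) borel (case_prod h)" for i
    by (rule joint_law) auto
  show ?thesis using eq unfolding law by (simp only: restrict_UNIV)
qed

definition step :: "real measure" where
  "step = distr (LX \<Otimes>\<^sub>M LT) borel (\<lambda>(x, t). x - c * t)"

lemma step_eq: "step = distr M borel (\<lambda>\<omega>. X 1 \<omega> - c * T 1 \<omega>)"
  unfolding step_def by (rule joint_law[symmetric]) auto

lemma step_convolution: "step = convolution LX (distr LT borel (\<lambda>t. - (c * t)))"
proof -
  have [measurable]: "X (Suc 0) \<in> borel_measurable M" "T (Suc 0) \<in> borel_measurable M"
    using X_measurable[of 1] T_measurable[of 1] by simp_all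
  have "indep_var borel (X 1) borel (\<lambda>\<omega>. - (c * T 1 \<omega>))"
    using indep_var_compose[OF indep_X_T[of 1], of "\<lambda>x. x" borel "\<lambda>t. - (c * t)" borel]
    by (simp add: comp_def)
  then have "distr M borel (\<lambda>\<omega>. X 1 \<omega> + - (c * T 1 \<omega>)) = convolution (distr M borel (X 1)) (distr M borel (\<lambda>\<omega>. - (c * T 1 \<omega>)))"
    by (rule sum_indep_random_variable) auto
  moreover have "distr M borel (\<lambda>\<omega>. - (c * T 1 \<omega>)) = distr LT borel (\<lambda>t. - (c * t))"
    unfolding T_law[of 1, OF order.refl, symmetric] by (subst distr_distr) (auto simp: comp_def)
  ultimately show ?thesis unfolding step_eq X_law[of 1, OF order.refl] by simp
qed

lemma real_distribution_step: "real_distribution step"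
  unfolding step_convolution
proof (rule real_distribution_convolution[OF real_distribution_LX])
  interpret LT: real_distribution LT by (rule real_distribution_LT)
  show "real_distribution (distr LT borel (\<lambda>t. - (c * t)))"
    unfolding real_distribution_def real_distribution_axioms_def by (auto intro!: LT.prob_space_distr)
qed

text \<open>Carries finiteness of the supremum between sequence space and \<open>M\<close>; on
  \<open>M\<close> walks with different step functions can be compared path by path.\<close>

lemma AE_walk_sup:
  fixes h :: "real \<Rightarrow> real \<Rightarrow> real"
  assumes h [measurable]: "case_prod h \<in> borel_measurable (borel \<Otimes>\<^sub>M borel)"
  shows "(AE x in PiM UNIV (\<lambda>_::nat. distr (LX \<Otimes>\<^sub>M LT) borel (case_prod h)). walk_sup x < \<infinity>)
    \<longleftrightarrow> (AE \<omega> in M. walk_sup (\<lambda>i. h (X (Suc i) \<omega>) (T (Suc i) \<omega>)) < \<infinity>)"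
proof -
  have m: "(\<lambda>\<omega> i. h (X (Suc i) \<omega>) (T (Suc i) \<omega>)) \<in> measurable M (PiM UNIV (\<lambda>_::nat. borel))"
    using X_measurable T_measurable by (intro measurable_PiM_single') auto
  show ?thesis unfolding sequence_law[OF h, symmetric] by (subst AE_distr_iff[OF m]) auto
qed

text \<open>The waiting times may have infinite mean, so the steps need not be integrable. Monotone
  convergence supplies a level \<open>b\<close> at which the net profit condition survives for
  \<open>min T b\<close>; the truncated steps are integrable with negative mean, and they dominate
  the true ones.\<close>

lemma step_walk_sup_finite: "AE x in PiM UNIV (\<lambda>_::nat. step). walk_sup x < \<infinity>"
proof -
  have [measurable]: "X (Suc 0) \<in> borel_measurable M" "T (Suc 0) \<in> borel_measurable M"
    using X_measurable[of 1] T_measurable[of 1] by simp_all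
  have "(\<integral>\<^sup>+\<omega>. ennreal (T 1 \<omega>) \<partial>M) = (\<integral>\<^sup>+\<omega>. (SUP n. ennreal (min (T 1 \<omega>) (real n))) \<partial>M)"
  proof (intro nn_integral_cong antisym SUP_least)
    fix \<omega>
    obtain n where "T 1 \<omega> \<le> real n" using real_arch_simple by blast
    then show "ennreal (T 1 \<omega>) \<le> (SUP n. ennreal (min (T 1 \<omega>) (real n)))"
      by (intro SUP_upper2[of n]) auto
  qed (auto intro!: ennreal_leI)
  also have "\<dots> = (SUP n. \<integral>\<^sup>+\<omega>. ennreal (min (T 1 \<omega>) (real n)) \<partial>M)"
    by (rule nn_integral_monotone_convergence_SUP) (auto simp: incseq_def le_fun_def intro!: ennreal_leI)
  finally have "(\<integral>\<^sup>+\<omega>. ennreal (X 1 \<omega>) \<partial>M) < (SUP n. ennreal c * (\<integral>\<^sup>+\<omega>. ennreal (min (T 1 \<omega>) (real n)) \<partial>M))"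
    using net_profit by (simp add: SUP_mult_left_ennreal)
  then obtain b :: nat where b: "(\<integral>\<^sup>+\<omega>. ennreal (X 1 \<omega>) \<partial>M) < ennreal c * (\<integral>\<^sup>+\<omega>. ennreal (min (T 1 \<omega>) (real b)) \<partial>M)"
    unfolding less_SUP_iff by blast
  let ?h = "\<lambda>x t. x - c * min t (real b)"
  have hm: "case_prod ?h \<in> borel_measurable (borel \<Otimes>\<^sub>M borel)" by measurable
  let ?D = "distr (LX \<Otimes>\<^sub>M LT) borel (case_prod ?h)"
  have D: "?D = distr M borel (\<lambda>\<omega>. ?h (X 1 \<omega>) (T 1 \<omega>))"
    by (rule joint_law[symmetric, OF _ hm]) simp
  have Xp: "AE \<omega> in M. 0 \<le> X 1 \<omega>" using X_pos[of 1] by (auto elim!: eventually_mono)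
  have Tp: "AE \<omega> in M. 0 \<le> T 1 \<omega>" using T_pos[of 1] by (auto elim!: eventually_mono)
  have "(\<integral>\<^sup>+\<omega>. ennreal (X 1 \<omega>) \<partial>M) < \<infinity>"
    using b by (rule less_le_trans) simp
  then have Xi: "integrable M (X 1)"
    using Xp by (intro integrableI_nonneg) auto
  have Ti: "integrable M (\<lambda>\<omega>. min (T 1 \<omega>) (real b))"
    by (rule integrable_const_bound[where B = "real b"]) (use Tp in \<open>auto elim!: eventually_mono\<close>)
  have Tp': "AE \<omega> in M. 0 \<le> min (T 1 \<omega>) (real b)" using Tp by (auto elim!: eventually_mono)
  have T0: "0 \<le> (\<integral>\<omega>. min (T 1 \<omega>) (real b) \<partial>M)" using Tp' by (rule integral_nonneg_AE)
  have "ennreal (\<integral>\<omega>. X 1 \<omega> \<partial>M) < ennreal (c * (\<integral>\<omega>. min (T 1 \<omega>) (real b) \<partial>M))"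
    using b c T0 unfolding nn_integral_eq_integral[OF Xi Xp] nn_integral_eq_integral[OF Ti Tp']
    by (subst ennreal_mult) auto
  then have lt: "(\<integral>\<omega>. X 1 \<omega> \<partial>M) < c * (\<integral>\<omega>. min (T 1 \<omega>) (real b) \<partial>M)"
    using integral_nonneg_AE[OF Xp] by (simp add: ennreal_less_iff)
  have "AE x in PiM UNIV (\<lambda>_::nat. ?D). walk_sup x < \<infinity>"
  proof (rule walk_sup_finite)
    show "real_distribution ?D"
      unfolding D real_distribution_def real_distribution_axioms_def by (auto intro!: prob_space_distr)
    show "integrable ?D (\<lambda>s. s)"
      unfolding D by (subst integrable_distr_eq) (use Xi Ti in auto)
    have "(\<integral>s. s \<partial>?D) = (\<integral>\<omega>. X 1 \<omega> - c * min (T 1 \<omega>) (real b) \<partial>M)"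
      unfolding D by (subst integral_distr) auto
    also have "\<dots> = (\<integral>\<omega>. X 1 \<omega> \<partial>M) - c * (\<integral>\<omega>. min (T 1 \<omega>) (real b) \<partial>M)"
      using Xi Ti by simp
    finally show "(\<integral>s. s \<partial>?D) < 0" using lt by simp
  qed
  then have "AE \<omega> in M. walk_sup (\<lambda>i. ?h (X (Suc i) \<omega>) (T (Suc i) \<omega>)) < \<infinity>"
    by (subst (asm) AE_walk_sup[OF hm])
  then have "AE \<omega> in M. walk_sup (\<lambda>i. X (Suc i) \<omega> - c * T (Suc i) \<omega>) < \<infinity>"
  proof eventually_elim
    case (elim \<omega>)
    have "walk_sup (\<lambda>i. X (Suc i) \<omega> - c * T (Suc i) \<omega>) \<le> walk_sup (\<lambda>i. ?h (X (Suc i) \<omega>) (T (Suc i) \<omega>))"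
      by (rule walk_sup_le) (use c in auto)
    then show ?case using elim by (rule le_less_trans)
  qed
  then show ?thesis
    unfolding step_def by (subst AE_walk_sup) auto
qed

text \<open>Ruin and excess of the walk over \<open>u\<close> agree only on the almost sure event of
  positive waiting times and finitely many arrivals. Comparing their measures therefore needs
  measurability of the ruin event itself, which the countable set of times provides.\<close>

lemma ruin_probability_eq:
  assumes u: "u \<ge> 0"
  shows "ruin_probability M c X T u
    = measure (PiM UNIV (\<lambda>_::nat. step)) {x \<in> space (PiM UNIV (\<lambda>_::nat. step)). ereal u < walk_sup x}"
proof -
  let ?\<xi> = "\<lambda>\<omega> i. X (Suc i) \<omega> - c * T (Suc i) \<omega>"
  have m: "?\<xi> \<in> measurable M (PiM UNIV (\<lambda>_::nat. borel))"
    using X_measurable T_measurable by (intro measurable_PiM_single') auto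
  have arr [measurable]: "(\<lambda>\<omega>. arrival T k \<omega>) \<in> borel_measurable M" for k
    using T_measurable by (intro borel_measurable_sum) auto
  have "ruin_probability M c X T u = measure M {\<omega> \<in> space M. \<exists>t>0. surplus c X T u t \<omega> < 0}"
    unfolding ruin_probability_def INF_less_iff by (intro arg_cong[where f = "measure M"]) auto
  also have "\<dots> = measure M {\<omega> \<in> space M. ereal u < walk_sup (?\<xi> \<omega>)}"
  proof (rule measure_eq_AE)
    have "AE \<omega> in M. \<forall>k. T (Suc k) \<omega> > 0"
      unfolding AE_all_countable using T_pos by simp
    with arrivals_finite
    show "AE \<omega> in M. \<omega> \<in> {\<omega> \<in> space M. \<exists>t>0. surplus c X T u t \<omega> < 0}
        \<longleftrightarrow> \<omega> \<in> {\<omega> \<in> space M. ereal u < walk_sup (?\<xi> \<omega>)}"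
    proof eventually_elim
      case (elim \<omega>)
      have T: "T k \<omega> > 0" if "k \<ge> 1" for k using elim(2)[rule_format, of "k - 1"] that by simp
      have "(\<exists>t>0. surplus c X T u t \<omega> < 0) \<longleftrightarrow> (\<exists>k\<ge>1. u < (\<Sum>i<k. X (Suc i) \<omega> - c * T (Suc i) \<omega>))"
        by (rule ruin_iff_walk[OF c u]) (use T elim(1) in auto)
      then show ?case unfolding mem_Collect_eq walk_sup_gt_iff[OF u] by (rule arg_cong)
    qed
    have s1 [measurable]: "(\<lambda>\<omega>. surplus c X T u (arrival T k \<omega>) \<omega>) \<in> borel_measurable M" for k
      by (rule surplus_measurable) (use X_measurable T_measurable arr in auto)
    have s2 [measurable]: "(\<lambda>\<omega>. surplus c X T u (of_rat q) \<omega>) \<in> borel_measurable M" for q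
      by (rule surplus_measurable) (use X_measurable T_measurable in auto)
    show "{\<omega> \<in> space M. \<exists>t>0. surplus c X T u t \<omega> < 0} \<in> sets M"
      unfolding ruin_countable_times[OF c u] by measurable
    show "{\<omega> \<in> space M. ereal u < walk_sup (?\<xi> \<omega>)} \<in> sets M"
      using measurable_compose[OF m walk_sup_measurable] by measurable
  qed
  also have "\<dots> = measure (distr M (PiM UNIV (\<lambda>_::nat. borel)) ?\<xi>) {x \<in> space (PiM UNIV (\<lambda>_::nat. borel)). ereal u < walk_sup x}"
  proof (subst measure_distr[OF m])
    show "{x \<in> space (PiM UNIV (\<lambda>_::nat. borel)). ereal u < walk_sup x} \<in> sets (PiM UNIV (\<lambda>_::nat. borel))"
      by measurable
  qed (auto intro!: arg_cong[where f = "measure M"] simp: space_PiM)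
  also have "distr M (PiM UNIV (\<lambda>_::nat. borel)) ?\<xi> = PiM UNIV (\<lambda>_::nat. step)"
    unfolding step_def by (rule sequence_law) auto
  also have "space (PiM UNIV (\<lambda>_::nat. borel)) = space (PiM UNIV (\<lambda>_::nat. step))"
    using real_distribution.space_eq_univ[OF real_distribution_step] by (simp add: space_PiM)
  finally show ?thesis .
qed

definition max_loss :: "real measure" where
  "max_loss = distr (PiM UNIV (\<lambda>_::nat. step)) borel (\<lambda>x. real_of_ereal (walk_sup x))"

lemma real_distribution_max_loss: "real_distribution max_loss"
  unfolding max_loss_def by (rule walk_sup_law(1)[OF real_distribution_step step_walk_sup_finite])

lemma max_loss_tail:
  "u \<ge> 0 \<Longrightarrow> measure max_loss {u<..} = ruin_probability M c X T u"
  "u < 0 \<Longrightarrow> measure max_loss {u<..} = 1"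
  using walk_sup_law(2,3)[OF real_distribution_step step_walk_sup_finite, of u]
  by (simp_all add: max_loss_def ruin_probability_eq)

lemma ruin_probability_renewal:
  "u \<ge> 0 \<Longrightarrow> ruin_probability M c X T u = measure (convolution step max_loss) {u<..}"
  using walk_sup_law(4)[OF real_distribution_step step_walk_sup_finite, of u]
  by (simp add: max_loss_def ruin_probability_eq)

lemma ruin_probability_tendsto_0: "(ruin_probability M c X T \<longlongrightarrow> 0) at_top"
proof -
  interpret Q: real_distribution max_loss by (rule real_distribution_max_loss)
  have "((\<lambda>u. 1 - cdf max_loss u) \<longlongrightarrow> 1 - 1) at_top"
    by (intro tendsto_intros Q.cdf_lim_at_top_prob)
  moreover have "eventually (\<lambda>u. 1 - cdf max_loss u = ruin_probability M c X T u) at_top"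
    using eventually_ge_at_top[of 0]
    by eventually_elim (simp add: Q.measure_Ioi_eq_cdf[symmetric] max_loss_tail)
  ultimately show ?thesis by (simp add: tendsto_cong)
qed

end

section \<open>Laws of the waiting-time phases\<close>

lemma AE_lborel_affine:
  fixes c t :: real
  assumes N: "N \<in> null_sets lborel" and c: "c \<noteq> 0"
  shows "AE x in lborel. t + c * x \<notin> N"
proof -
  have Nm [measurable]: "N \<in> sets borel" using N by (auto simp: null_sets_def)
  have "0 = (\<integral>\<^sup>+ x. indicator N x \<partial>lborel)" using N by (auto simp: null_sets_def)
  also have "\<dots> = ennreal \<bar>c\<bar> * (\<integral>\<^sup>+ x. indicator N (t + c * x) \<partial>lborel)"
    by (rule nn_integral_real_affine) (use c in auto)
  finally have "(\<integral>\<^sup>+ x. indicator N (t + c * x) \<partial>lborel) = (0::ennreal)" using c by auto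
  then have "AE x in lborel. indicator N (t + c * x) = (0::ennreal)"
    by (subst (asm) nn_integral_0_iff_AE) auto
  then show ?thesis by (rule AE_mp) (auto simp: indicator_def intro!: AE_I2)
qed

lemma absolutely_continuous_scaled_density:
  fixes f :: "real \<Rightarrow> ennreal"
  assumes f [measurable]: "f \<in> borel_measurable borel" and c: "c \<noteq> 0"
  shows "absolutely_continuous lborel (distr (density lborel f) borel (\<lambda>y. - (c * y)))"
  unfolding absolutely_continuous_def
proof
  fix N assume N: "N \<in> null_sets (lborel :: real measure)"
  then have Nm [measurable]: "N \<in> sets borel" by (auto simp: null_sets_def)
  have "AE y in lborel. 0 + (- c) * y \<notin> N" by (rule AE_lborel_affine[OF N]) (use c in simp)
  then have "AE y in lborel. f y * indicator ((\<lambda>y. - (c * y)) -` N) y = 0"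
    by (rule AE_mp) (auto simp: indicator_def intro!: AE_I2)
  then have "(\<integral>\<^sup>+ y. f y * indicator ((\<lambda>y. - (c * y)) -` N) y \<partial>lborel) = 0"
    by (subst nn_integral_0_iff_AE) (auto intro!: borel_measurable_indicator measurable_sets_borel[OF _ Nm])
  then show "N \<in> null_sets (distr (density lborel f) borel (\<lambda>y. - (c * y)))"
    by (simp add: null_sets_def emeasure_distr emeasure_density measurable_sets_borel[OF _ Nm])
qed

text \<open>Every translate of a null set is null for \<open>D\<close>, and the convolution
  integrates the \<open>D\<close>-measure of translates over \<eta>.\<close>

lemma absolutely_continuous_convolution:
  assumes \<eta>: "real_distribution \<eta>" and D: "real_distribution D" and ac: "absolutely_continuous lborel D"
  shows "absolutely_continuous lborel (convolution \<eta> D)"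
  unfolding absolutely_continuous_def
proof
  interpret \<eta>: real_distribution \<eta> by fact
  interpret D: real_distribution D by fact
  fix N assume N: "N \<in> null_sets (lborel :: real measure)"
  then have Nm [measurable]: "N \<in> sets borel" by (auto simp: null_sets_def)
  have shift: "emeasure D {a. a + x \<in> N} = 0" for x
  proof -
    have m: "{a. a + x \<in> N} \<in> sets borel" by measurable
    have "AE a in lborel. x + 1 * a \<notin> N" by (rule AE_lborel_affine[OF N]) simp
    then have "{a. a + x \<in> N} \<in> null_sets lborel"
      using m by (subst AE_iff_null_sets) (auto simp: add.commute elim!: eventually_mono)
    then have "{a. a + x \<in> N} \<in> null_sets D"
      using ac unfolding absolutely_continuous_def by blast
    then show ?thesis by (simp add: null_sets_def)
  qed
  have "emeasure (convolution \<eta> D) N = (\<integral>\<^sup>+ x. emeasure D {a. a + x \<in> N} \<partial>\<eta>)"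
    by (rule convolution_emeasure) (auto simp: \<eta>.finite_measure_axioms D.finite_measure_axioms)
  then show "N \<in> null_sets (convolution \<eta> D)" by (simp add: shift null_sets_def)
qed

lemma convolution_commute:
  assumes "real_distribution \<eta>" "real_distribution D"
  shows "convolution \<eta> D = convolution D \<eta>"
proof -
  interpret \<eta>: real_distribution \<eta> by fact
  interpret D: real_distribution D by fact
  show ?thesis
    by (rule convolution_commutative) (auto simp: \<eta>.finite_measure_axioms D.finite_measure_axioms)
qed

lemma convolution_assoc:
  assumes "real_distribution A" "real_distribution B" "real_distribution C"
  shows "convolution A (convolution B C) = convolution (convolution A B) C"
proof -
  interpret A: real_distribution A by fact
  interpret B: real_distribution B by fact
  interpret C: real_distribution C by fact
  show ?thesis
    by (rule convolution_associative)
       (auto simp: A.finite_measure_axioms B.finite_measure_axioms C.finite_measure_axioms)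
qed

lemma (in prob_space) real_distribution_distr:
  "Z \<in> borel_measurable M \<Longrightarrow> real_distribution (distr M borel Z)"
  unfolding real_distribution_def real_distribution_axioms_def by (auto intro!: prob_space_distr)

lemma (in prob_space) distributed_distr_scaled:
  fixes Z :: "'a \<Rightarrow> real"
  assumes "distributed M lborel Z f" "f \<in> borel_measurable borel"
  shows "distr M borel (\<lambda>\<omega>. - (c * Z \<omega>)) = distr (density lborel f) borel (\<lambda>y. - (c * y))"
proof -
  have Z: "Z \<in> measurable M lborel" using assms(1) by (rule distributed_measurable)
  have "distr (distr M lborel Z) borel (\<lambda>y. - (c * y)) = distr M borel (\<lambda>\<omega>. - (c * Z \<omega>))"
  proof (subst distr_distr)
    show "(\<lambda>y. - (c * y)) \<in> measurable lborel borel" by measurable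
  qed (use Z in \<open>auto simp: comp_def\<close>)
  then show ?thesis using distributed_distr_eq_density[OF assms(1)] by simp
qed

lemma (in prob_space) distributed_AE_pos:
  fixes f :: "real \<Rightarrow> real"
  assumes Z: "distributed M lborel Z f" and f: "\<And>x. x \<le> 0 \<Longrightarrow> f x = 0"
  shows "AE \<omega> in M. 0 < Z \<omega>"
proof -
  have Zm: "Z \<in> measurable M lborel" using Z by (rule distributed_measurable)
  have "AE x in density lborel f. 0 < x"
    using distributed_borel_measurable[OF Z] f
    by (subst AE_density) (auto intro!: AE_I2, metis less_irrefl not_le)
  then have "AE x in distr M lborel Z. 0 < x" unfolding distributed_distr_eq_density[OF Z] .
  then show ?thesis by (subst (asm) AE_distr_iff[OF Zm]) auto
qed

text \<open>Indexed by the set \<open>J\<close> of phases still present, so that each factor of the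
  operator removes one element of \<open>J\<close>; the empty set gives the Dirac mass at 0.\<close>

definition (in prob_space) phase_law :: "real \<Rightarrow> ('i \<Rightarrow> 'a \<Rightarrow> real) \<Rightarrow> 'i set \<Rightarrow> real measure" where
  "phase_law c V J = distr M borel (\<lambda>\<omega>. - (c * (\<Sum>k\<in>J. V k \<omega>)))"

lemma (in prob_space) real_distribution_phase_law:
  assumes "indep_vars (\<lambda>_. borel) V I" "J \<subseteq> I"
  shows "real_distribution (phase_law c V J)"
proof -
  have "V k \<in> borel_measurable M" if "k \<in> J" for k
    using assms that unfolding indep_vars_def2 by blast
  then have "(\<lambda>\<omega>. - (c * (\<Sum>k\<in>J. V k \<omega>))) \<in> borel_measurable M"
    by (intro borel_measurable_uminus borel_measurable_times borel_measurable_const borel_measurable_sum)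
  then show ?thesis unfolding phase_law_def by (rule real_distribution_distr)
qed

lemma (in prob_space) phase_law_insert:
  assumes ind: "indep_vars (\<lambda>_. borel) V I" and J: "insert k J \<subseteq> I" "finite J" "k \<notin> J"
  shows "phase_law c V (insert k J) = convolution (phase_law c V J) (distr M borel (\<lambda>\<omega>. - (c * V k \<omega>)))"
proof -
  have Vm [measurable]: "V i \<in> borel_measurable M" if "i \<in> insert k J" for i
    using ind J that unfolding indep_vars_def2 by blast
  have sm [measurable]: "(\<lambda>\<omega>. \<Sum>i\<in>J. V i \<omega>) \<in> borel_measurable M"
    by (intro borel_measurable_sum Vm) auto
  have km [measurable]: "V k \<in> borel_measurable M" by (rule Vm) simp
  have "indep_var borel (V k) borel (\<lambda>\<omega>. \<Sum>i\<in>J. V i \<omega>)"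
    by (rule indep_vars_sum[OF J(2,3) indep_vars_subset[OF ind J(1)]])
  then have "indep_var borel ((\<lambda>y. - (c * y)) \<circ> V k) borel ((\<lambda>y. - (c * y)) \<circ> (\<lambda>\<omega>. \<Sum>i\<in>J. V i \<omega>))"
    by (rule indep_var_compose) auto
  then have iv: "indep_var borel (\<lambda>\<omega>. - (c * V k \<omega>)) borel (\<lambda>\<omega>. - (c * (\<Sum>i\<in>J. V i \<omega>)))"
    by (simp add: comp_def)
  have "distr M borel (\<lambda>\<omega>. - (c * V k \<omega>) + - (c * (\<Sum>i\<in>J. V i \<omega>)))
      = convolution (distr M borel (\<lambda>\<omega>. - (c * V k \<omega>))) (phase_law c V J)"
    unfolding phase_law_def by (rule sum_indep_random_variable[OF iv]) auto
  moreover have "(\<lambda>\<omega>. - (c * V k \<omega>) + - (c * (\<Sum>i\<in>J. V i \<omega>))) = (\<lambda>\<omega>. - (c * (\<Sum>i\<in>insert k J. V i \<omega>)))"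
    using J by (simp add: algebra_simps)
  ultimately have "phase_law c V (insert k J) = convolution (distr M borel (\<lambda>\<omega>. - (c * V k \<omega>))) (phase_law c V J)"
    by (simp add: phase_law_def)
  also have "\<dots> = convolution (phase_law c V J) (distr M borel (\<lambda>\<omega>. - (c * V k \<omega>)))"
  proof (rule convolution_commute)
    show "real_distribution (distr M borel (\<lambda>\<omega>. - (c * V k \<omega>)))" by (rule real_distribution_distr) simp
    show "real_distribution (phase_law c V J)" by (rule real_distribution_phase_law[OF ind]) (use J in auto)
  qed
  finally show ?thesis .
qed

lemma (in prob_space) measure_convolution_phase_law_empty:
  assumes "real_distribution \<eta>"
  shows "measure (convolution \<eta> (phase_law c V {})) {u<..} = measure \<eta> {u<..}"
proof -
  interpret \<eta>: real_distribution \<eta> by fact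
  have B: "real_distribution (phase_law c V {})"
    unfolding phase_law_def by (rule real_distribution_distr) simp
  have [measurable]: "(\<lambda>y. emeasure \<eta> {u - y<..}) \<in> borel_measurable borel"
    unfolding \<eta>.emeasure_eq_measure
    using measurable_compose[of "\<lambda>y. u - y" borel borel, OF _ \<eta>.measure_Ioi_measurable] by simp
  have "(\<integral>\<^sup>+ y. emeasure \<eta> {u - y<..} \<partial>phase_law c V {}) = emeasure \<eta> {u<..}"
    unfolding phase_law_def by (subst nn_integral_distr) (auto simp: emeasure_space_1)
  then have "emeasure (convolution \<eta> (phase_law c V {})) {u<..} = emeasure \<eta> {u<..}"
    using emeasure_convolution_Ioi[OF assms B, of u] by simp
  then show ?thesis by (simp add: measure_def)
qed

lemma left_comp_0: "left_comp L 0 f = f"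
  by (simp add: left_comp_def)

lemma left_comp_Suc: "left_comp L (Suc k) f = L (Suc k) (left_comp L k f)"
  by (simp add: left_comp_def)

section \<open>The fractional integro-differential equation\<close>

text \<open>Condition on the claim \<open>x\<close>, which is positive almost surely. For
  \<open>x \<le> u\<close> the rest is the ruin probability from capital \<open>u - x\<close>; for
  \<open>x > u\<close> the argument \<open>u - x\<close> is negative and the tail of the nonnegative
  maximal loss is 1, which produces the second integral.\<close>

lemma (in renewal_risk) max_aggregate_loss_tail:
  assumes u: "u \<ge> 0"
  shows "measure (convolution LX max_loss) {u<..}
    = (LINT y:{0..u}|LX. ruin_probability M c X T (u - y)) + (LINT y:{u<..}|LX. 1)"
proof -
  interpret LX: real_distribution LX by (rule real_distribution_LX)
  interpret Q: real_distribution max_loss by (rule real_distribution_max_loss)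
  let ?\<psi> = "ruin_probability M c X T"
  let ?q = "\<lambda>x. measure max_loss {u - x<..}"
  have pos: "AE x in LX. 0 < x"
    using X_pos[of 1] X_measurable[of 1] unfolding X_law[of 1, OF order.refl, symmetric]
    by (subst AE_distr_iff) auto
  have qm [measurable]: "?q \<in> borel_measurable LX"
    using measurable_compose[of "\<lambda>x. u - x" borel borel, OF _ Q.measure_Ioi_measurable] by simp
  have "emeasure (convolution LX max_loss) {u<..} = (\<integral>\<^sup>+ x. emeasure max_loss {a. a + x \<in> {u<..}} \<partial>LX)"
    by (rule convolution_emeasure) (auto simp: LX.finite_measure_axioms Q.finite_measure_axioms)
  also have "\<dots> = (\<integral>\<^sup>+ x. ennreal (?q x) \<partial>LX)"
  proof (rule nn_integral_cong)
    fix x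
    have "{a. a + x \<in> {u<..}} = {u - x<..}" by auto
    then show "emeasure max_loss {a. a + x \<in> {u<..}} = ennreal (?q x)" by (simp add: Q.emeasure_eq_measure)
  qed
  finally have "measure (convolution LX max_loss) {u<..} = enn2real (\<integral>\<^sup>+ x. ennreal (?q x) \<partial>LX)"
    by (simp add: measure_def)
  also have "\<dots> = (LINT x|LX. ?q x)" by (subst integral_eq_nn_integral) auto
  also have "\<dots> = (LINT x|LX. indicator {0..u} x * ?q x + indicator {u<..} x * 1)"
  proof (rule integral_cong_AE)
    show "AE x in LX. ?q x = indicator {0..u} x * ?q x + indicator {u<..} x * 1"
      using pos
    proof eventually_elim
      case (elim x)
      then show ?case using max_loss_tail(2)[of "u - x"] by (auto simp: indicator_def)
    qed
  qed auto
  also have "\<dots> = (LINT x|LX. indicator {0..u} x * ?q x) + (LINT x|LX. indicator {u<..} x * 1)"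
  proof (rule Bochner_Integration.integral_add)
    show "integrable LX (\<lambda>x. indicator {0..u} x * ?q x)"
      by (rule LX.integrable_const_bound[where B = 1]) (auto simp: indicator_def)
    show "integrable LX (\<lambda>x. indicator {u<..} x * 1 :: real)"
      by (rule LX.integrable_const_bound[where B = 1]) (auto simp: indicator_def)
  qed
  also have "(LINT x|LX. indicator {0..u} x * ?q x) = (LINT y:{0..u}|LX. ?\<psi> (u - y))"
    unfolding set_lebesgue_integral_def
    by (rule Bochner_Integration.integral_cong) (auto simp: indicator_def max_loss_tail)
  finally show ?thesis by (simp add: set_lebesgue_integral_def)
qed

theorem theorem2:
  fixes M :: "'a measure" and P :: "'b measure"
    and X T :: "nat \<Rightarrow> 'a \<Rightarrow> real" and Y Z :: "nat \<Rightarrow> 'b \<Rightarrow> real"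
    and F_X :: "real \<Rightarrow> real" and c :: real and m n :: nat
    and r l1 \<mu> l2 :: "nat \<Rightarrow> real"
  assumes "prob_space M"
    and "c > 0"
    and "\<not> (m = 0 \<and> n = 0)"
    and "\<And>i. i \<in> {1..m} \<Longrightarrow> r i > 0 \<and> l1 i > 0"
    and "\<And>j. j \<in> {1..n} \<Longrightarrow> 0 < \<mu> j \<and> \<mu> j \<le> 1 \<and> l2 j > 0"
    and "prob_space.indep_vars M (\<lambda>_. borel) (case_sum X T) ({1..} <+> {1..})"
    and "\<And>k. k \<ge> 1 \<Longrightarrow> AE \<omega> in M. X k \<omega> > 0"
    and "\<And>k. k \<ge> 1 \<Longrightarrow> cdf (distr M borel (X k)) = F_X"
    and "prob_space P"
    and "prob_space.indep_vars P (\<lambda>_. borel) (case_sum Y Z) ({1..m} <+> {1..n})"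
    and "\<And>i. i \<in> {1..m} \<Longrightarrow> distributed P lborel (Y i) (gamma_density (r i) (l1 i))"
    and "\<And>j. j \<in> {1..n} \<Longrightarrow> distributed P lborel (Z j) (mittag_leffler_density (\<mu> j) (l2 j))"
    and "\<And>k. k \<ge> 1 \<Longrightarrow>
      distr M borel (T k) = distr P borel (\<lambda>\<omega>. (\<Sum>i=1..m. Y i \<omega>) + (\<Sum>j=1..n. Z j \<omega>))"
    \<comment> \<open>net profit condition; a Mittag-Leffler distribution with \<open>\<mu> < 1\<close> has infinite mean\<close>
    and "\<And>k. k \<ge> 1 \<Longrightarrow>
      ennreal c * (\<integral>\<^sup>+\<omega>. ennreal (T k \<omega>) \<partial>M) > (\<integral>\<^sup>+\<omega>. ennreal (X k \<omega>) \<partial>M)"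
    \<comment> \<open>the outermost Caputo derivative, if of integer order \<open>r\<close>, takes \<open>r + 1\<close> derivatives of
      a function that is only as smooth as an \<open>r\<close>-fold integral of \<open>F_X\<close>\<close>
    and "(if n > 0 then \<mu> n else r m) \<in> \<int> \<Longrightarrow>
      absolutely_continuous lborel (interval_measure F_X)"
  defines "\<psi> \<equiv> ruin_probability M c X T"
  shows "(\<forall>u\<ge>0.
      A_star_exists c m n r l1 \<mu> l2 \<psi> u \<and>
      A_star c m n r l1 \<mu> l2 \<psi> u =
        (\<Prod>i=1..m. l1 i powr r i) * (\<Prod>j=1..n. l2 j) *
        ((LINT y:{0..u}|interval_measure F_X. \<psi> (u - y)) +
         (LINT y:{u<..}|interval_measure F_X. 1))) \<and>
    (\<psi> \<longlongrightarrow> 0) at_top"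
proof -
  interpret M: prob_space M by fact
  interpret P: prob_space P by fact
  note c = assms(2) and Y_par = assms(4) and Z_par = assms(5)
  note indXT = assms(6) and indYZ = assms(10) and Y_dist = assms(11) and Z_dist = assms(12) and T_law = assms(13)
  define V where "V = case_sum Y Z"
  define I where "I = ({1..m} <+> {1..n} :: (nat + nat) set)"
  have indV: "P.indep_vars (\<lambda>_. borel) V I" unfolding V_def I_def by (rule indYZ)
  have Xm: "X k \<in> borel_measurable M" and Tm: "T k \<in> borel_measurable M" if "k \<ge> 1" for k
  proof -
    have "\<forall>i\<in>{1..} <+> {1..}. case_sum X T i \<in> borel_measurable M"
      using indXT unfolding M.indep_vars_def2 by (rule conjunct1)
    note * = bspec[OF this]
    show "X k \<in> borel_measurable M" "T k \<in> borel_measurable M"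
      using *[of "Inl k"] *[of "Inr k"] that by auto
  qed
  have Vm: "V k \<in> borel_measurable P" if "k \<in> I" for k
    using indV that unfolding P.indep_vars_def2 by blast
  define LX where "LX = interval_measure F_X"
  define LT where "LT = distr P borel (\<lambda>\<omega>. (\<Sum>i=1..m. Y i \<omega>) + (\<Sum>j=1..n. Z j \<omega>))"
  have X_law: "distr M borel (X k) = LX" if "k \<ge> 1" for k
  proof -
    interpret Xk: real_distribution "distr M borel (X k)" by (rule M.real_distribution_distr[OF Xm[OF that]])
    have F: "F_X = cdf (distr M borel (X k))" using assms(8)[OF that] by simp
    have cl: "cdf LX = F_X" unfolding LX_def F
      by (rule cdf_interval_measure[OF Xk.cdf_nondecreasing Xk.cdf_is_right_cont Xk.cdf_lim_at_bot])
    have rd: "real_distribution LX" unfolding LX_def F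
      by (rule real_distribution_interval_measure[OF Xk.cdf_nondecreasing Xk.cdf_is_right_cont
            Xk.cdf_lim_at_bot Xk.cdf_lim_at_top_prob])
    show ?thesis
      by (rule cdf_unique[OF Xk.real_distribution_axioms rd trans[OF F[symmetric] cl[symmetric]]])
  qed
  have sumV: "(\<Sum>k\<in>I. V k \<omega>) = (\<Sum>i=1..m. Y i \<omega>) + (\<Sum>j=1..n. Z j \<omega>)" for \<omega>
    unfolding I_def V_def by (subst sum.Plus) (auto simp: comp_def)
  have Y_pos: "AE \<omega> in P. 0 < V k \<omega>" if "k \<in> I" for k
    using that P.distributed_AE_pos[OF Y_dist] P.distributed_AE_pos[OF Z_dist]
    by (auto simp: I_def V_def gamma_density_def mittag_leffler_density_def)
  have LT_eq: "LT = distr P borel (\<lambda>\<omega>. \<Sum>k\<in>I. V k \<omega>)" unfolding LT_def sumV ..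
  have sumVm [measurable]: "(\<lambda>\<omega>. \<Sum>k\<in>I. V k \<omega>) \<in> borel_measurable P"
    by (intro borel_measurable_sum Vm)
  have LT_pos: "AE t in LT. 0 < t"
  proof -
    have fin: "finite I" and ne: "I \<noteq> {}" using assms(3) by (auto simp: I_def)
    have "AE \<omega> in P. \<forall>k\<in>I. 0 < V k \<omega>" using fin Y_pos by (intro AE_finite_allI) auto
    then have "AE \<omega> in P. 0 < (\<Sum>k\<in>I. V k \<omega>)"
      by eventually_elim (intro sum_pos fin ne, auto)
    then show ?thesis unfolding LT_eq by (subst AE_distr_iff) auto
  qed
  have T_law': "distr M borel (T k) = LT" if "k \<ge> 1" for k unfolding LT_def by (rule T_law[OF that])
  have T_pos: "AE \<omega> in M. 0 < T k \<omega>" if "k \<ge> 1" for k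
    using LT_pos unfolding T_law'[OF that, symmetric] by (subst (asm) AE_distr_iff) (use Tm[OF that] in auto)
  interpret renewal_risk M X T c LX LT
    by unfold_locales (use c indXT X_law T_law' assms(7) T_pos assms(14)[of 1] in auto)
  define Q where "Q = max_loss"
  define \<eta> where "\<eta> = convolution LX Q"
  have Q: "real_distribution Q" unfolding Q_def by (rule real_distribution_max_loss)
  have \<eta>: "real_distribution \<eta>" unfolding \<eta>_def by (rule real_distribution_convolution[OF real_distribution_LX Q])
  define B where "B = P.phase_law c V"
  have B: "real_distribution (B J)" if "J \<subseteq> I" for J
    unfolding B_def by (rule P.real_distribution_phase_law[OF indV that])
  \<comment> \<open>The law of a claim plus the maximal loss minus \<open>c\<close> times the phases
    in \<open>J\<close>. The tail of \<open>H I\<close> is the ruin probability on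
    \<open>[0, \<infinity>)\<close>, that of \<open>H {}\<close> the integral term; the operator
    leads from one to the other.\<close>
  define H where "H = (\<lambda>J. convolution \<eta> (B J))"
  have H: "real_distribution (H J)" if "J \<subseteq> I" for J
    unfolding H_def by (rule real_distribution_convolution[OF \<eta> B[OF that]])
  define D where "D = (\<lambda>k. distr P borel (\<lambda>\<omega>. - (c * V k \<omega>)))"
  have D: "real_distribution (D k)" if "k \<in> I" for k
    unfolding D_def by (rule P.real_distribution_distr) (use Vm[OF that] in simp)
  have B_insert: "B (insert k J) = convolution (B J) (D k)" if "insert k J \<subseteq> I" "k \<notin> J" for k J
    unfolding B_def D_def
    by (rule P.phase_law_insert[OF indV that(1) _ that(2)])
       (use that finite_subset[of J I] in \<open>auto simp: I_def\<close>)
  have H_insert: "H (insert k J) = convolution (H J) (D k)" if "insert k J \<subseteq> I" "k \<notin> J" for k J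
    unfolding H_def B_insert[OF that] by (rule convolution_assoc[OF \<eta> B D]) (use that in auto)
  have \<psi>_eq: "\<psi> u = measure (H I) {u<..}" if "u \<ge> 0" for u
  proof -
    have BI: "distr LT borel (\<lambda>t. - (c * t)) = B I"
      unfolding LT_eq B_def P.phase_law_def by (subst distr_distr) (auto simp: comp_def)
    have "convolution step Q = convolution (convolution LX (B I)) Q" unfolding step_convolution BI ..
    also have "\<dots> = convolution Q (convolution LX (B I))"
      by (rule convolution_commute) (auto intro!: real_distribution_convolution real_distribution_LX B Q)
    also have "\<dots> = convolution (convolution Q LX) (B I)" by (rule convolution_assoc[OF Q real_distribution_LX B]) simp
    also have "convolution Q LX = \<eta>" unfolding \<eta>_def by (rule convolution_commute[OF Q real_distribution_LX])
    finally show ?thesis using ruin_probability_renewal[OF that] unfolding \<psi>_def H_def Q_def by simp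
  qed
  have D_Y: "D (Inl i) = distr (density lborel (\<lambda>y. ennreal (gamma_density (r i) (l1 i) y))) borel (\<lambda>y. - (c * y))"
    if "i \<in> {1..m}" for i
    unfolding D_def V_def using P.distributed_distr_scaled[OF Y_dist[OF that]] by simp
  have D_Z: "D (Inr j) = distr (density lborel (\<lambda>y. ennreal (mittag_leffler_density (\<mu> j) (l2 j) y))) borel (\<lambda>y. - (c * y))"
    if "j \<in> {1..n}" for j
    unfolding D_def V_def
    using P.distributed_distr_scaled[OF Z_dist[OF that]] distributed_borel_measurable[OF Z_dist[OF that]] by simp
  have D_ac: "absolutely_continuous lborel (D k)" if "k \<in> I" for k
  proof -
    have "absolutely_continuous lborel (D (Inl i))" if "i \<in> {1..m}" for i
      unfolding D_Y[OF that] by (rule absolutely_continuous_scaled_density) (use c in auto)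
    moreover have "absolutely_continuous lborel (D (Inr j))" if "j \<in> {1..n}" for j
      unfolding D_Z[OF that]
      by (rule absolutely_continuous_scaled_density)
         (use c distributed_borel_measurable[OF Z_dist[OF that]] in auto)
    ultimately show ?thesis using that by (auto simp: I_def)
  qed
  have H_ac: "absolutely_continuous lborel (H J)" if sub: "J \<subseteq> I" and ne: "J \<noteq> {}" for J
  proof -
    obtain k where k: "k \<in> J" using ne by blast
    then have J: "insert k (J - {k}) = J" by blast
    have "H (insert k (J - {k})) = convolution (H (J - {k})) (D k)"
      by (rule H_insert) (use k sub in auto)
    moreover have "absolutely_continuous lborel (convolution (H (J - {k})) (D k))"
      by (rule absolutely_continuous_convolution) (use k sub in \<open>auto intro!: H D D_ac\<close>)
    ultimately show ?thesis unfolding J by simp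
  qed
  \<comment> \<open>When no phase is left, the density has to come from the claim law, which is
    where the hypothesis on \<open>F_X\<close> enters.\<close>
  have H_ac_outer: "absolutely_continuous lborel (H J)"
    if "J \<subseteq> I" "(if n > 0 then \<mu> n else r m) \<in> \<int>" for J
  proof -
    have "absolutely_continuous lborel LX" unfolding LX_def by (rule assms(15)[OF that(2)])
    then have "absolutely_continuous lborel (convolution Q LX)"
      by (rule absolutely_continuous_convolution[OF Q real_distribution_LX])
    then have "absolutely_continuous lborel \<eta>" unfolding \<eta>_def convolution_commute[OF Q real_distribution_LX] .
    then have "absolutely_continuous lborel (convolution (B J) \<eta>)"
      by (rule absolutely_continuous_convolution[OF B[OF that(1)] \<eta>])
    then show ?thesis unfolding H_def convolution_commute[OF B[OF that(1)] \<eta>] .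
  qed
  let ?G = "\<lambda>i. gamma_op c (r i) (l1 i)"
  let ?L = "\<lambda>j. ml_op c (\<mu> j) (l2 j)"
  \<comment> \<open>\<open>J1 i\<close> holds the phases left after \<open>i\<close> gamma factors,
    \<open>J2 j\<close> those left after all gamma and \<open>j\<close> Mittag-Leffler
    factors.\<close>
  define J1 where "J1 = (\<lambda>i. {Suc i..m} <+> {1..n} :: (nat + nat) set)"
  define J2 where "J2 = (\<lambda>j. {} <+> {Suc j..n} :: (nat + nat) set)"
  have J1: "J1 i = insert (Inl (Suc i)) (J1 (Suc i))" "Inl (Suc i) \<notin> J1 (Suc i)" if "i < m" for i
    using that by (auto simp: J1_def Plus_def image_iff)
  have J2: "J2 j = insert (Inr (Suc j)) (J2 (Suc j))" "Inr (Suc j) \<notin> J2 (Suc j)" if "j < n" for j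
    using that by (auto simp: J2_def Plus_def image_iff)
  have J_sub: "J1 i \<subseteq> I" "J2 j \<subseteq> I" for i j by (auto simp: J1_def J2_def I_def)
  have J_ends: "J1 0 = I" "J1 m = J2 0" "J2 n = {}" by (auto simp: J1_def J2_def I_def)
  have gamma_step: "right_caputo_exists (r (Suc i)) (\<lambda>y. exp (- (l1 (Suc i) / c) * y) * F y) u"
    "?G (Suc i) F u = l1 (Suc i) powr r (Suc i) * C * measure (H (J1 (Suc i))) {u<..}"
    if i: "i < m" and F: "\<And>y. y \<ge> 0 \<Longrightarrow> F y = C * measure (H (J1 i)) {y<..}" and u: "u \<ge> 0" for i F C u
  proof -
    have im: "Suc i \<in> {1..m}" using i by simp
    have par: "r (Suc i) > 0" "l1 (Suc i) > 0" using Y_par[OF im] by auto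
    have kI: "Inl (Suc i) \<in> I" using im by (auto simp: I_def)
    have Hi: "H (J1 i) = convolution (H (J1 (Suc i))) (D (Inl (Suc i)))"
      unfolding J1(1)[OF i] by (rule H_insert) (use J1(2)[OF i] kI J_sub in auto)
    \<comment> \<open>An empty remainder means \<open>n = 0\<close> and \<open>Suc i = m\<close>:
      this gamma factor is the outermost one, and its order is the one named in the hypothesis on
      the claim law.\<close>
    have ac: "absolutely_continuous lborel (H (J1 (Suc i)))" if "r (Suc i) \<in> \<int>"
    proof (cases "J1 (Suc i) = {}")
      case False
      then show ?thesis by (intro H_ac J_sub)
    next
      case True
      then have "n = 0" "Suc i = m" using i by (auto simp: J1_def)
      then show ?thesis using that by (intro H_ac_outer J_sub) auto
    qed
    show "right_caputo_exists (r (Suc i)) (\<lambda>y. exp (- (l1 (Suc i) / c) * y) * F y) u"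
      "?G (Suc i) F u = l1 (Suc i) powr r (Suc i) * C * measure (H (J1 (Suc i))) {u<..}"
      using gamma_op_tail[OF H[OF J_sub(1)] par c u D_Y[OF im] D[OF kI], of F C] F ac
      unfolding Hi by auto
  qed
  have ml_step: "right_caputo_exists (\<mu> (Suc j)) F u"
    "?L (Suc j) F u = l2 (Suc j) * C * measure (H (J2 (Suc j))) {u<..}"
    if j: "j < n" and F: "\<And>y. y \<ge> 0 \<Longrightarrow> F y = C * measure (H (J2 j)) {y<..}" and u: "u \<ge> 0" for j F C u
  proof -
    have jn: "Suc j \<in> {1..n}" using j by simp
    have par: "0 < \<mu> (Suc j)" "\<mu> (Suc j) \<le> 1" "l2 (Suc j) > 0" using Z_par[OF jn] by auto
    have kI: "Inr (Suc j) \<in> I" using jn by (auto simp: I_def)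
    have Hj: "H (J2 j) = convolution (H (J2 (Suc j))) (D (Inr (Suc j)))"
      unfolding J2(1)[OF j] by (rule H_insert) (use J2(2)[OF j] kI J_sub in auto)
    have ac: "absolutely_continuous lborel (H (J2 (Suc j)))" if "\<mu> (Suc j) \<in> \<int>"
    proof (cases "J2 (Suc j) = {}")
      case False
      then show ?thesis by (intro H_ac J_sub)
    next
      case True
      then have "n > 0" "Suc j = n" using j by (auto simp: J2_def)
      then show ?thesis using that by (intro H_ac_outer J_sub) auto
    qed
    show "right_caputo_exists (\<mu> (Suc j)) F u"
      "?L (Suc j) F u = l2 (Suc j) * C * measure (H (J2 (Suc j))) {u<..}"
      using ml_op_tail[OF H[OF J_sub(2)] par c u D_Z[OF jn] D[OF kI], of F C] F ac
      unfolding Hj by auto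
  qed
  have gamma_iter: "left_comp ?G i \<psi> u = (\<Prod>k=1..i. l1 k powr r k) * measure (H (J1 i)) {u<..}"
    if "i \<le> m" "u \<ge> 0" for i u
    using that
  proof (induction i arbitrary: u)
    case 0
    then show ?case using \<psi>_eq J_ends by (simp add: left_comp_0)
  next
    case (Suc i)
    then show ?case
      using gamma_step(2)[of i "left_comp ?G i \<psi>" "\<Prod>k=1..i. l1 k powr r k" u]
      by (simp add: left_comp_Suc mult.commute)
  qed
  let ?f = "left_comp ?G m \<psi>"
  let ?\<Lambda> = "\<Prod>k=1..m. l1 k powr r k"
  have ml_iter: "left_comp ?L j ?f u = ?\<Lambda> * (\<Prod>k=1..j. l2 k) * measure (H (J2 j)) {u<..}"
    if "j \<le> n" "u \<ge> 0" for j u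
    using that
  proof (induction j arbitrary: u)
    case 0
    then show ?case using gamma_iter[of m u] J_ends by (simp add: left_comp_0)
  next
    case (Suc j)
    then show ?case
      using ml_step(2)[of j "left_comp ?L j ?f" "?\<Lambda> * (\<Prod>k=1..j. l2 k)" u]
      by (simp add: left_comp_Suc ac_simps)
  qed
  have "A_star_exists c m n r l1 \<mu> l2 \<psi> u" if "u \<ge> 0" for u
    unfolding A_star_exists_def
    using gamma_step(1)[OF _ gamma_iter that] ml_step(1)[OF _ ml_iter that] by auto
  moreover have "A_star c m n r l1 \<mu> l2 \<psi> u =
        (\<Prod>i=1..m. l1 i powr r i) * (\<Prod>j=1..n. l2 j) *
        ((LINT y:{0..u}|interval_measure F_X. \<psi> (u - y)) +
         (LINT y:{u<..}|interval_measure F_X. 1))" if "u \<ge> 0" for u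
  proof -
    have "measure (H (J2 n)) {u<..} = measure \<eta> {u<..}"
      unfolding J_ends H_def B_def by (rule P.measure_convolution_phase_law_empty[OF \<eta>])
    also have "\<dots> = (LINT y:{0..u}|LX. \<psi> (u - y)) + (LINT y:{u<..}|LX. 1)"
      unfolding \<eta>_def Q_def \<psi>_def by (rule max_aggregate_loss_tail[OF that])
    finally show ?thesis
      unfolding A_star_def ml_iter[OF order.refl that] LX_def by simp
  qed
  moreover have "(\<psi> \<longlongrightarrow> 0) at_top" unfolding \<psi>_def by (rule ruin_probability_tendsto_0)
  ultimately show ?thesis by blast
qed

end
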